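(* Let $\mathscr{M}$ be a properly infinite von Neumann algebra acting on the Hilbert space $\mathcal{H}$. Then there is a pair of non-singular (that is, one-to-one) positive self-adjoint operators $A,B$ affiliated with $\mathscr{M}$ with their domains satisfying $$\mathrm{dom}(A)\cap\mathrm{dom}(B)=\mathrm{dom}(A^{-1})\cap\mathrm{dom}(B^{-1})=\{0\}.$$
   Context: A closed operator $T$ on $\mathcal{H}$ is affiliated with $\mathscr{M}$ if $U^*TU=T$ for every unitary $U$ in the commutant $\mathscr{M}'$; equivalently, $T$ has the form $Bx\mapsto Ax$ ($x\in\mathcal{H}$) with domain $\mathrm{ran}(B)$ for some $A,B\in\mathscr{M}$ with $\mathrm{null}(B)\subseteq\mathrm{null}(A)$. The self-adjoint operators are (possibly unbounded) densely-defined; for one-to-one $T$, $\mathrm{dom}(T^{-1})=\mathrm{ran}(T)$. *)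

theory Defs
  imports "HOL-Analysis.Analysis"
begin

text \<open>Complex Hilbert spaces; the inner product is linear in its first argument.\<close>

class chilbert_space = banach +
  fixes scaleC :: "complex \<Rightarrow> 'a \<Rightarrow> 'a" (infixr "*\<^sub>C" 75)
    and cinner :: "'a \<Rightarrow> 'a \<Rightarrow> complex"
  assumes scaleC_add_right: "c *\<^sub>C (x + y) = c *\<^sub>C x + c *\<^sub>C y"
    and scaleC_add_left: "(c + d) *\<^sub>C x = c *\<^sub>C x + d *\<^sub>C x"
    and scaleC_scaleC: "c *\<^sub>C d *\<^sub>C x = (c * d) *\<^sub>C x"
    and scaleC_one: "1 *\<^sub>C x = x"
    and scaleR_scaleC: "r *\<^sub>R x = complex_of_real r *\<^sub>C x"
    and cinner_add_left: "cinner (x + y) z = cinner x z + cinner y z"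
    and cinner_scaleC_left: "cinner (c *\<^sub>C x) y = c * cinner x y"
    and cinner_commute: "cinner x y = cnj (cinner y x)"
    and cinner_ge_zero: "cinner x x \<in> \<real>\<^sub>\<ge>\<^sub>0"
    and cinner_eq_zero_iff: "cinner x x = 0 \<longleftrightarrow> x = 0"
    and norm_eq_sqrt_cinner: "norm x = sqrt (Re (cinner x x))"

text \<open>
  A possibly unbounded operator is its graph, so that domain, range and inverse are
  \<^const>\<open>Domain\<close>, \<^const>\<open>Range\<close> and \<^const>\<open>converse\<close> of the graph.
\<close>

type_synonym 'a operator = "('a \<times> 'a) set"

definition linear_operator :: "'a::chilbert_space operator \<Rightarrow> bool" where
  "linear_operator T \<longleftrightarrow>
     single_valued T \<and> (0, 0) \<in> T \<and>
     (\<forall>x y x' y'. (x, y) \<in> T \<longrightarrow> (x', y') \<in> T \<longrightarrow> (x + x', y + y') \<in> T) \<and>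
     (\<forall>c x y. (x, y) \<in> T \<longrightarrow> (c *\<^sub>C x, c *\<^sub>C y) \<in> T)"

definition closed_operator :: "'a::chilbert_space operator \<Rightarrow> bool" where
  "closed_operator T \<longleftrightarrow> linear_operator T \<and> closed T"

definition densely_defined :: "'a::chilbert_space operator \<Rightarrow> bool" where
  "densely_defined T \<longleftrightarrow> closure (Domain T) = UNIV"

text \<open>The following relation is single-valued when \<^term>\<open>T\<close> is densely defined.\<close>

definition op_adjoint :: "'a::chilbert_space operator \<Rightarrow> 'a operator" where
  "op_adjoint T = {(y, z). \<forall>x w. (x, w) \<in> T \<longrightarrow> cinner w y = cinner x z}"

definition self_adjoint_operator :: "'a::chilbert_space operator \<Rightarrow> bool" where
  "self_adjoint_operator T \<longleftrightarrow>
     linear_operator T \<and> densely_defined T \<and> op_adjoint T = T"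

definition positive_operator :: "'a::chilbert_space operator \<Rightarrow> bool" where
  "positive_operator T \<longleftrightarrow> (\<forall>x y. (x, y) \<in> T \<longrightarrow> cinner y x \<in> \<real>\<^sub>\<ge>\<^sub>0)"

definition one_to_one_operator :: "'a::chilbert_space operator \<Rightarrow> bool" where
  "one_to_one_operator T \<longleftrightarrow> single_valued (T\<inverse>)"

text \<open>Bounded, everywhere defined operators are represented by functions.\<close>

definition bounded_clinear :: "('a::chilbert_space \<Rightarrow> 'a) \<Rightarrow> bool" where
  "bounded_clinear f \<longleftrightarrow> bounded_linear f \<and> (\<forall>c x. f (c *\<^sub>C x) = c *\<^sub>C f x)"

definition op_graph :: "('a \<Rightarrow> 'a) \<Rightarrow> 'a operator" where
  "op_graph f = {(x, y). y = f x}"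

definition is_adjoint :: "('a::chilbert_space \<Rightarrow> 'a) \<Rightarrow> ('a \<Rightarrow> 'a) \<Rightarrow> bool" where
  "is_adjoint g f \<longleftrightarrow> op_graph g = op_adjoint (op_graph f)"

definition unitary :: "('a::chilbert_space \<Rightarrow> 'a) \<Rightarrow> bool" where
  "unitary U \<longleftrightarrow>
     bounded_clinear U \<and> (\<exists>V. is_adjoint V U \<and> V \<circ> U = id \<and> U \<circ> V = id)"

definition projection :: "('a::chilbert_space \<Rightarrow> 'a) \<Rightarrow> bool" where
  "projection p \<longleftrightarrow> bounded_clinear p \<and> p \<circ> p = p \<and> is_adjoint p p"

definition commutant :: "('a::chilbert_space \<Rightarrow> 'a) set \<Rightarrow> ('a \<Rightarrow> 'a) set" where
  "commutant S = {f. bounded_clinear f \<and> (\<forall>g\<in>S. f \<circ> g = g \<circ> f)}"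

definition von_neumann_algebra :: "('a::chilbert_space \<Rightarrow> 'a) set \<Rightarrow> bool" where
  "von_neumann_algebra M \<longleftrightarrow>
     (\<forall>f\<in>M. \<exists>g\<in>M. is_adjoint g f) \<and> commutant (commutant M) = M"

text \<open>Murray--von Neumann equivalence relative to \<^term>\<open>M\<close>: $p = v^*v$ and $q = vv^*$.\<close>

definition mvn_equivalent ::
    "('a::chilbert_space \<Rightarrow> 'a) set \<Rightarrow> ('a \<Rightarrow> 'a) \<Rightarrow> ('a \<Rightarrow> 'a) \<Rightarrow> bool" where
  "mvn_equivalent M p q \<longleftrightarrow>
     (\<exists>v\<in>M. \<exists>w\<in>M. is_adjoint w v \<and> w \<circ> v = p \<and> v \<circ> w = q)"

definition finite_projection ::
    "('a::chilbert_space \<Rightarrow> 'a) set \<Rightarrow> ('a \<Rightarrow> 'a) \<Rightarrow> bool" where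
  "finite_projection M p \<longleftrightarrow>
     projection p \<and> p \<in> M \<and>
     (\<forall>q\<in>M. projection q \<and> range q \<subseteq> range p \<and> mvn_equivalent M p q \<longrightarrow> q = p)"

text \<open>The algebra on the zero space counts as properly infinite.\<close>

definition properly_infinite :: "('a::chilbert_space \<Rightarrow> 'a) set \<Rightarrow> bool" where
  "properly_infinite M \<longleftrightarrow>
     (\<forall>p \<in> M \<inter> commutant M. projection p \<and> p \<noteq> (\<lambda>x. 0) \<longrightarrow> \<not> finite_projection M p)"

text \<open>The composite relation below is the graph of $U^*TU$, with its natural domain.\<close>

definition affiliated ::
    "'a::chilbert_space operator \<Rightarrow> ('a \<Rightarrow> 'a) set \<Rightarrow> bool" where
  "affiliated T M \<longleftrightarrow>
     closed_operator T \<and>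
     (\<forall>U \<in> commutant M. unitary U \<longrightarrow> op_graph U O T O op_adjoint (op_graph U) = T)"

end

(* Every P in M with 0 <= P <= 1 for which P and 1 - P are injective yields the positive self-adjoint
   operator P^-1 - 1, whose domain is ran P and whose inverse has domain ran (1 - P).  So it suffices
   to find two such contractions P and R for which ran P and ran R meet only in 0, and likewise
   ran (1 - P) and ran (1 - R).

   Suppose that M contains a pure isometry.  Then H is a sum of shifted copies of one subspace, and
   splitting these into even and odd ones identifies H with H + H.  Let P be (1 - S) + S on H + H
   with S positive and of small norm, and let R be (1 - S') + S' relative to the decomposition that
   is obtained from H + H by a rotation with diagonal sines D.  Both intersections vanish as soon as
   the ranges of D, S and S' are independent.  D has exponentially decaying weights, while vectors
   in ran S and ran S' decay much more slowly along two disjoint sparse sets of coordinates.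

   To get a pure isometry, use Zorn's lemma to find a maximal projection p which is the sum of two
   orthogonal projections both equivalent to p.  Maximality makes 1 - p finite, comparison with p and
   proper infiniteness make 1 - p equivalent to a subprojection of p, and a Schroeder-Bernstein
   argument makes p equivalent to 1. *)
theory Submission
  imports Defs
begin


text \<open>The summands \<open>1 - S\<close> and \<open>S\<close> are placed so that
  \<open>P\<close> has a thin range in one component and \<open>1 - P\<close> in the other. A vector
  common to \<open>P\<close> and \<open>R\<close>, read in the thin component of \<open>P\<close>,
  lies in the range of \<open>S\<close>. By the rotation it also has the form
  \<open>D u + C (S' y)\<close>, with \<open>C\<close> the diagonal of cosines. Independence forces
  \<open>u = 0\<close> and \<open>S' y = 0\<close>, hence the vector is 0. The complements give the
  same equation in the other component, up to the sign of the sine. The cosines stay away from 0, so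
  they cannot hide a slow decay. The step from a maximal doubled projection \<open>p\<close> to 1 is
  obstructed by the fact that two projections are comparable only up to a central projection. The
  central support of the part of \<open>1 - p\<close> that is not matched inside \<open>p\<close>
  has to be shown to vanish, and only there does proper infiniteness enter. Spectral theory is
  replaced by two devices: square roots of \<open>adj x (x u)\<close> for contractions
  \<open>x\<close>, and graphs of isometries, whose closures supply partial isometries without a
  polar decomposition.\<close>

section \<open>Inner product calculus and Cauchy-Schwarz\<close>

lemma cinner_add_right: "cinner x (y + z) = cinner x y + cinner x z"
  for x :: "'a::chilbert_space"
  by (metis cinner_add_left cinner_commute complex_cnj_add)

lemma cinner_scaleC_right: "cinner x (c *\<^sub>C y) = cnj c * cinner x y"
  for x :: "'a::chilbert_space"
  by (metis cinner_commute cinner_scaleC_left complex_cnj_mult)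

lemma cinner_scaleR_left: "cinner (r *\<^sub>R x) y = r *\<^sub>R cinner x y"
  for x :: "'a::chilbert_space"
  by (simp add: scaleR_scaleC cinner_scaleC_left scaleR_conv_of_real)

lemma cinner_scaleR_right: "cinner x (r *\<^sub>R y) = r *\<^sub>R cinner x y"
  for x :: "'a::chilbert_space"
  by (simp add: scaleR_scaleC cinner_scaleC_right scaleR_conv_of_real)

lemma cinner_self: "cinner x x = complex_of_real ((norm x)\<^sup>2)"
  for x :: "'a::chilbert_space"
proof -
  have "cinner x x \<in> \<real>\<^sub>\<ge>\<^sub>0" by (rule cinner_ge_zero)
  then show ?thesis
    by (auto simp: norm_eq_sqrt_cinner complex_nonneg_Reals_iff complex_eq_iff)
qed

lemma Re_cinner_commute: "Re (cinner y x) = Re (cinner x y)"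
  for x :: "'a::chilbert_space"
  by (metis cinner_commute complex_cnj(1) complex.sel(1) complex_surj)

lemma cinner_minus_left: "cinner (- x) y = - cinner x y" for x :: "'a::chilbert_space"
  using cinner_scaleR_left[of "-1" x y] by simp

lemma cinner_minus_right: "cinner x (- y) = - cinner x y" for x :: "'a::chilbert_space"
  using cinner_scaleR_right[of x "-1" y] by simp

lemma cinner_diff_left: "cinner (x - y) z = cinner x z - cinner y z"
  for x :: "'a::chilbert_space"
  using cinner_add_left[of x "- y" z] by (simp add: cinner_minus_left)

lemma cinner_diff_right: "cinner x (y - z) = cinner x y - cinner x z"
  for x :: "'a::chilbert_space"
  using cinner_add_right[of x y "- z"] by (simp add: cinner_minus_right)

lemma cinner_zero_left [simp]: "cinner 0 x = 0" for x :: "'a::chilbert_space"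
  using cinner_scaleR_left[of 0 x x] by simp

lemma cinner_zero_right [simp]: "cinner x 0 = 0" for x :: "'a::chilbert_space"
  using cinner_scaleR_right[of x 0 x] by simp

lemmas cinner_simps = cinner_add_left cinner_add_right cinner_diff_left cinner_diff_right
  cinner_minus_left cinner_minus_right cinner_scaleC_left cinner_scaleC_right
  cinner_scaleR_left cinner_scaleR_right

lemma scaleC_zero_right [simp]: "c *\<^sub>C (0::'a::chilbert_space) = 0"
  using scaleC_add_right[of c "0::'a" 0] by simp

lemma scaleC_minus_right: "c *\<^sub>C (- x) = - (c *\<^sub>C x)" for x :: "'a::chilbert_space"
  using scaleC_add_right[of c x "- x"] by (simp add: eq_neg_iff_add_eq_0 add.commute)

lemma scaleC_diff_right: "c *\<^sub>C (x - y) = c *\<^sub>C x - c *\<^sub>C y" for x :: "'a::chilbert_space"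
  using scaleC_add_right[of c x "- y"] by (simp add: scaleC_minus_right)

lemma norm_scaleC: "norm (c *\<^sub>C x) = cmod c * norm x" for x :: "'a::chilbert_space"
proof -
  have "complex_of_real ((norm (c *\<^sub>C x))\<^sup>2) = complex_of_real ((cmod c * norm x)\<^sup>2)"
    unfolding power_mult_distrib of_real_mult cinner_self[symmetric] cinner_simps complex_norm_square
    by (simp add: mult_ac)
  then have "(norm (c *\<^sub>C x))\<^sup>2 = (cmod c * norm x)\<^sup>2"
    using of_real_eq_iff by blast
  then show ?thesis by (simp add: power2_eq_iff_nonneg)
qed

lemma norm_add_square:
  "(norm (x + y))\<^sup>2 = (norm x)\<^sup>2 + (norm y)\<^sup>2 + 2 * Re (cinner x y)"
  for x :: "'a::chilbert_space"
proof -
  have "Re (cinner (x + y) (x + y)) = (norm x)\<^sup>2 + (norm y)\<^sup>2 + 2 * Re (cinner x y)"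
    by (simp add: cinner_simps Re_cinner_commute[of x y]) (simp add: cinner_self)
  then show ?thesis by (simp add: cinner_self)
qed

lemma norm_diff_square:
  "(norm (x - y))\<^sup>2 = (norm x)\<^sup>2 + (norm y)\<^sup>2 - 2 * Re (cinner x y)"
  for x :: "'a::chilbert_space"
  using norm_add_square[of x "- y"] by (simp add: cinner_minus_right)

text \<open>Pythagoras for the projection of \<open>x\<close> to the line of \<open>y\<close>. That
  the right side is nonnegative is Cauchy-Schwarz; that it is smaller than
  \<open>(norm x)\<^sup>2\<close> unless \<open>cinner x y = 0\<close> makes nearest points have
  orthogonal residuals.\<close>

lemma norm_residual_square:
  fixes x y :: "'a::chilbert_space"
  assumes "y \<noteq> 0"
  shows "(norm (x - (cinner x y / cinner y y) *\<^sub>C y))\<^sup>2 = (norm x)\<^sup>2 - (cmod (cinner x y))\<^sup>2 / (norm y)\<^sup>2"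
proof -
  define u where "u = cinner x y"
  have "cinner x ((u / cinner y y) *\<^sub>C y) = complex_of_real ((cmod u)\<^sup>2 / (norm y)\<^sup>2)"
    unfolding of_real_divide complex_norm_square
    by (simp add: cinner_simps cinner_self u_def[symmetric] mult.commute)
  then have "Re (cinner x ((u / cinner y y) *\<^sub>C y)) = (cmod u)\<^sup>2 / (norm y)\<^sup>2"
    by simp
  moreover have "(norm ((u / cinner y y) *\<^sub>C y))\<^sup>2 = (cmod u)\<^sup>2 / (norm y)\<^sup>2"
    using assms by (simp add: norm_scaleC cinner_self norm_divide power2_eq_square norm_mult)
  ultimately show ?thesis
    unfolding norm_diff_square u_def[symmetric] by simp
qed

lemma cinner_Cauchy_Schwarz: "cmod (cinner x y) \<le> norm x * norm y"
  for x :: "'a::chilbert_space"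
proof (cases "y = 0")
  case False
  have "(cmod (cinner x y))\<^sup>2 / (norm y)\<^sup>2 \<le> (norm x)\<^sup>2"
    using norm_residual_square[OF False, of x] by (smt (verit) zero_le_power2)
  then have "(cmod (cinner x y))\<^sup>2 \<le> (norm x * norm y)\<^sup>2"
    using False by (simp add: divide_simps power_mult_distrib)
  then show ?thesis by (rule power2_le_imp_le) simp
qed simp

lemma bounded_bilinear_cinner: "bounded_bilinear (cinner :: 'a::chilbert_space \<Rightarrow> 'a \<Rightarrow> complex)"
  by standard (auto simp: cinner_simps intro!: exI[of _ 1] cinner_Cauchy_Schwarz)

lemmas tendsto_cinner = bounded_bilinear.tendsto[OF bounded_bilinear_cinner]

lemma cinner_ext_left: "(\<And>z. cinner z x = cinner z y) \<Longrightarrow> x = y" for x :: "'a::chilbert_space"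
  by (metis cinner_diff_right cinner_eq_zero_iff diff_self eq_iff_diff_eq_0)

lemma bounded_linear_scaleC: "bounded_linear (\<lambda>x::'a::chilbert_space. c *\<^sub>C x)"
  by (rule bounded_linear_intro[of _ "cmod c"])
    (auto simp: scaleC_add_right scaleR_scaleC scaleC_scaleC norm_scaleC mult_ac)

lemmas tendsto_scaleC = bounded_linear.tendsto[OF bounded_linear_scaleC]

section \<open>Bounded complex-linear maps\<close>

lemma bounded_clinearI:
  fixes f :: "'a::chilbert_space \<Rightarrow> 'a"
  assumes "\<And>x y. f (x + y) = f x + f y" "\<And>c x. f (c *\<^sub>C x) = c *\<^sub>C f x"
    "\<And>x. norm (f x) \<le> K * norm x"
  shows "bounded_clinear f"
  unfolding bounded_clinear_def
  by (auto intro!: bounded_linear_intro[of _ K] simp: assms scaleR_scaleC mult.commute)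

lemma
  assumes "bounded_clinear f"
  shows bounded_clinear_bounded_linear: "bounded_linear f"
    and bounded_clinear_scaleC: "f (c *\<^sub>C x) = c *\<^sub>C f x"
    and bounded_clinear_add: "f (x + y) = f x + f y"
    and bounded_clinear_diff: "f (x - y) = f x - f y"
    and bounded_clinear_minus: "f (- x) = - f x"
    and bounded_clinear_scaleR: "f (r *\<^sub>R x) = r *\<^sub>R f x"
    and bounded_clinear_zero: "f 0 = 0"
  using assms unfolding bounded_clinear_def
  by (auto simp: bounded_linear.linear linear_add linear_diff linear_neg linear_cmul linear_0)

lemmas bounded_clinear_tendsto = bounded_linear.tendsto[OF bounded_clinear_bounded_linear]

lemmas bounded_clinear_simps = bounded_clinear_scaleC bounded_clinear_add bounded_clinear_diff
  bounded_clinear_minus bounded_clinear_scaleR bounded_clinear_zero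

lemma bounded_clinear_continuous_on: "bounded_clinear f \<Longrightarrow> continuous_on S f"
  by (simp add: bounded_clinear_bounded_linear linear_continuous_on)

lemma bounded_clinear_compose:
  "bounded_clinear f \<Longrightarrow> bounded_clinear g \<Longrightarrow> bounded_clinear (\<lambda>x. f (g x))"
  unfolding bounded_clinear_def by (auto intro: bounded_linear_compose)

text \<open>Complex polarization: putting \<open>\<i> *\<^sub>C u\<close> for \<open>u\<close> in
  the symmetrised identity separates its two terms. Over the reals a quarter turn would be a
  counterexample.\<close>

lemma bounded_clinear_eq_0:
  fixes h :: "'a::chilbert_space \<Rightarrow> 'a"
  assumes "bounded_clinear h" "\<And>x. cinner (h x) x = 0"
  shows "h x = 0"
proof -
  have s: "cinner (h u) v + cinner (h v) u = 0" for u v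
    using assms(2)[of "u + v"] by (simp add: cinner_simps bounded_clinear_simps[OF assms(1)] assms(2) add.commute)
  have "cinner (h u) v = 0" for u v
    using s[of u v] s[of "\<i> *\<^sub>C u" v]
    by (simp add: cinner_simps bounded_clinear_simps[OF assms(1)])
  then show ?thesis using cinner_eq_zero_iff by blast
qed

section \<open>Closed subspaces and orthogonal projections\<close>

definition closed_csubspace :: "'a::chilbert_space set \<Rightarrow> bool" where
  "closed_csubspace V \<longleftrightarrow> closed V \<and> 0 \<in> V \<and> (\<forall>x\<in>V. \<forall>y\<in>V. x + y \<in> V) \<and> (\<forall>c. \<forall>x\<in>V. c *\<^sub>C x \<in> V)"

lemma closed_csubspace_diff:
  "closed_csubspace V \<Longrightarrow> x \<in> V \<Longrightarrow> y \<in> V \<Longrightarrow> x - y \<in> V"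
proof -
  assume V: "closed_csubspace V" "x \<in> V" "y \<in> V"
  have "(-1) *\<^sub>C y = - y"
    using scaleR_scaleC[of "-1" y] by simp
  then have "- y \<in> V" using V unfolding closed_csubspace_def by metis
  then show "x - y \<in> V" using V unfolding closed_csubspace_def by (metis add_uminus_conv_diff)
qed

text \<open>The midpoint of two points of \<open>V\<close> is again at distance at least
  \<open>d\<close> from \<open>x\<close>, so the parallelogram law forces a minimising sequence to
  be Cauchy.\<close>

lemma nearest_point_exists:
  fixes V :: "'a::chilbert_space set"
  assumes V: "closed_csubspace V"
  obtains v where "v \<in> V" "\<And>u. u \<in> V \<Longrightarrow> norm (x - v) \<le> norm (x - u)"
proof -
  define d where "d = (INF u\<in>V. norm (x - u))"
  have V0: "V \<noteq> {}" and bdd: "bdd_below ((\<lambda>u. norm (x - u)) ` V)"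
    using V by (auto simp: closed_csubspace_def intro: bdd_belowI[of _ 0])
  have d_le: "d \<le> norm (x - u)" if "u \<in> V" for u
    unfolding d_def using bdd that by (rule cINF_lower)
  have d0: "0 \<le> d" unfolding d_def using V0 by (intro cINF_greatest) auto
  have "\<exists>u\<in>V. norm (x - u) < d + 1 / Suc n" for n
    using cINF_less_iff[OF V0 bdd, of "d + 1 / Suc n"] unfolding d_def by simp
  then obtain u where u: "\<And>n. u n \<in> V" "\<And>n. norm (x - u n) < d + 1 / Suc n" by metis
  have lim_d: "(\<lambda>n. norm (x - u n)) \<longlonglongrightarrow> d"
  proof (rule tendsto_sandwich[of "\<lambda>_. d" _ _ "\<lambda>n. d + 1 / Suc n"])
    show "(\<lambda>n. d + 1 / real (Suc n)) \<longlonglongrightarrow> d"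
      using tendsto_add[OF tendsto_const LIMSEQ_inverse_real_of_nat, of d] by (simp add: inverse_eq_divide)
  qed (use d_le u(1) less_imp_le[OF u(2)] in \<open>auto intro!: always_eventually\<close>)
  have key: "(norm (u m - u n))\<^sup>2 \<le> 2 * (norm (x - u m))\<^sup>2 + 2 * (norm (x - u n))\<^sup>2 - 4 * d\<^sup>2" for m n
  proof -
    have "(1/2) *\<^sub>R (u m + u n) \<in> V"
      using V u unfolding closed_csubspace_def scaleR_scaleC by blast
    then have "d \<le> norm (x - (1/2) *\<^sub>R (u m + u n))" by (rule d_le)
    then have "d\<^sup>2 \<le> (norm (x - (1/2) *\<^sub>R (u m + u n)))\<^sup>2" using d0 by (simp add: power_mono)
    moreover have "x - (1/2) *\<^sub>R (u m + u n) = (1/2) *\<^sub>R ((x - u m) + (x - u n))"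
      by (simp add: algebra_simps flip: scaleR_add_left)
    ultimately have "4 * d\<^sup>2 \<le> (norm ((x - u m) + (x - u n)))\<^sup>2"
      by (simp add: power_divide)
    moreover have "u m - u n = (x - u n) - (x - u m)" by simp
    ultimately show ?thesis
      using norm_add_square[of "x - u m" "x - u n"] norm_diff_square[of "x - u n" "x - u m"]
      by (simp add: Re_cinner_commute[of "x - u n" "x - u m"])
  qed
  have "Cauchy u"
  proof (rule CauchyI)
    fix e :: real assume e: "e > 0"
    have "(\<lambda>n. 4 * (norm (x - u n))\<^sup>2 - 4 * d\<^sup>2) \<longlonglongrightarrow> 4 * d\<^sup>2 - 4 * d\<^sup>2"
      by (intro tendsto_intros lim_d)
    then have "\<forall>\<^sub>F n in sequentially. 4 * (norm (x - u n))\<^sup>2 - 4 * d\<^sup>2 < e\<^sup>2"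
      using e by (auto intro: order_tendstoD(2))
    then obtain N where N: "\<And>n. n \<ge> N \<Longrightarrow> 4 * (norm (x - u n))\<^sup>2 - 4 * d\<^sup>2 < e\<^sup>2"
      by (auto simp: eventually_sequentially)
    have "norm (u m - u n) < e" if "m \<ge> N" "n \<ge> N" for m n
    proof (rule power2_less_imp_less)
      show "(norm (u m - u n))\<^sup>2 < e\<^sup>2"
        using key[of m n] N[OF that(1)] N[OF that(2)] by linarith
    qed (use e in simp)
    then show "\<exists>N. \<forall>m\<ge>N. \<forall>n\<ge>N. norm (u m - u n) < e" by blast
  qed
  then obtain v where v: "u \<longlonglongrightarrow> v"
    using Cauchy_convergent_iff convergent_def by blast
  have "v \<in> V" using V u v unfolding closed_csubspace_def closed_sequential_limits by blast
  moreover have "norm (x - v) = d"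
    using LIMSEQ_unique[OF lim_d tendsto_norm[OF tendsto_diff[OF tendsto_const v]]] by simp
  ultimately show thesis using d_le that by metis
qed

lemma projection_iff:
  "projection p \<longleftrightarrow> bounded_clinear p \<and> (\<forall>x. p (p x) = p x) \<and> (\<forall>x y. cinner (p x) y = cinner x (p y))"
proof -
  have "is_adjoint p p \<longleftrightarrow> (\<forall>x y. cinner (p x) y = cinner x (p y))"
    unfolding is_adjoint_def op_graph_def op_adjoint_def
    by (auto simp: set_eq_iff) (metis cinner_ext_left)
  then show ?thesis unfolding projection_def by (auto simp: fun_eq_iff)
qed

lemma projection_exists:
  fixes V :: "'a::chilbert_space set"
  assumes V: "closed_csubspace V"
  obtains p where "projection p" "range p = V"
proof -
  have "\<exists>v\<in>V. \<forall>w\<in>V. cinner (x - v) w = 0" for x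
  proof -
    obtain v where v: "v \<in> V" "\<And>u. u \<in> V \<Longrightarrow> norm (x - v) \<le> norm (x - u)"
      using nearest_point_exists[OF V] by metis
    have "cinner (x - v) w = 0" if w: "w \<in> V" for w
    proof (cases "w = 0")
      case False
      \<comment> \<open>Among all multiples of \<open>w\<close>, this one lowers the distance most;
        minimality of \<open>v\<close> therefore makes the inner product vanish.\<close>
      define c where "c = cinner (x - v) w / cinner w w"
      have "v + c *\<^sub>C w \<in> V" using V w v(1) unfolding closed_csubspace_def by blast
      then have "norm (x - v) \<le> norm (x - v - c *\<^sub>C w)" using v(2) by (simp add: diff_diff_add)
      then have "(norm (x - v))\<^sup>2 \<le> (norm (x - v - c *\<^sub>C w))\<^sup>2" by (simp add: power_mono)
      then have "(cmod (cinner (x - v) w))\<^sup>2 / (norm w)\<^sup>2 \<le> 0"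
        unfolding c_def norm_residual_square[OF False] by simp
      then show ?thesis using False
        by (metis divide_eq_0_iff norm_eq_zero not_one_le_zero order_antisym_conv power_eq_0_iff zero_le_divide_iff zero_le_power2)
    qed simp
    then show ?thesis using v by blast
  qed
  then obtain p where pV: "\<And>x. p x \<in> V" and orth: "\<And>x w. w \<in> V \<Longrightarrow> cinner (x - p x) w = 0"
    by metis
  \<comment> \<open>Since orthogonality of the residual characterises \<open>p x\<close>, linearity
    can be checked on the obvious candidates.\<close>
  have uniq: "p x = v" if "v \<in> V" "\<And>w. w \<in> V \<Longrightarrow> cinner (x - v) w = 0" for x v
  proof -
    have "p x - v \<in> V" using closed_csubspace_diff[OF V pV that(1)] .
    then have "cinner (x - v) (p x - v) - cinner (x - p x) (p x - v) = 0"
      using that orth by simp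
    then have "cinner (p x - v) (p x - v) = 0"
      by (simp flip: cinner_diff_left)
    then show ?thesis by (simp add: cinner_eq_zero_iff)
  qed
  have le: "norm (p x) \<le> norm x" for x
  proof (rule power2_le_imp_le)
    have "cinner (x - p x) (p x) = 0" using orth pV by blast
    then show "(norm (p x))\<^sup>2 \<le> (norm x)\<^sup>2"
      using norm_add_square[of "x - p x" "p x"] by simp
  qed simp
  have bcl: "bounded_clinear p"
  proof (rule bounded_clinearI[of _ 1])
    show "p (x + y) = p x + p y" for x y
    proof (rule uniq)
      show "cinner (x + y - (p x + p y)) w = 0" if "w \<in> V" for w
        using orth[OF that, of x] orth[OF that, of y] by (simp add: cinner_simps algebra_simps)
    qed (use pV V in \<open>auto simp: closed_csubspace_def\<close>)
    show "p (c *\<^sub>C x) = c *\<^sub>C p x" for c x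
    proof (rule uniq)
      show "cinner (c *\<^sub>C x - c *\<^sub>C p x) w = 0" if "w \<in> V" for w
        using orth[OF that, of x] by (simp add: cinner_scaleC_left flip: scaleC_diff_right)
    qed (use pV V in \<open>auto simp: closed_csubspace_def\<close>)
  qed (simp add: le)
  have fixp: "p v = v" if "v \<in> V" for v by (rule uniq) (use that in auto)
  have "cinner (p x) y = cinner x (p y)" for x y
  proof -
    have "cinner (p x) (y - p y) = 0"
      using orth[OF pV] by (metis cinner_commute complex_cnj_zero)
    moreover have "cinner (x - p x) (p y) = 0" using orth pV by blast
    ultimately show ?thesis by (simp add: cinner_simps)
  qed
  then have "projection p" using bcl fixp pV by (simp add: projection_iff)
  moreover have "range p = V" using pV fixp by (metis range_eqI image_subset_iff subsetI subset_antisym)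
  ultimately show thesis using that by blast
qed

lemma projection_fixes: "projection p \<Longrightarrow> x \<in> range p \<longleftrightarrow> p x = x"
  by (metis projection_iff rangeE rangeI)

section \<open>Riesz representation and adjoints\<close>

lemma Riesz_representation:
  fixes \<phi> :: "'a::chilbert_space \<Rightarrow> complex"
  assumes bl: "bounded_linear \<phi>" and lin: "\<And>c x. \<phi> (c *\<^sub>C x) = c * \<phi> x"
  obtains y where "\<And>x. \<phi> x = cinner x y"
proof (cases "\<forall>x. \<phi> x = 0")
  case True
  then show thesis using that[of 0] by simp
next
  case False
  then obtain u where u: "\<phi> u \<noteq> 0" by blast
  interpret bounded_linear \<phi> by fact
  define V where "V = {x. \<phi> x = 0}"
  have "closed V" unfolding V_def
    by (intro closed_Collect_eq) (auto intro: continuous_on continuous_on_id)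
  then have V: "closed_csubspace V"
    by (auto simp: closed_csubspace_def V_def add lin zero)
  then obtain p where p: "projection p" "range p = V" by (rule projection_exists)
  define z where "z = u - p u"
  have "\<phi> (p u) = 0" using p by (auto simp: V_def)
  then have z: "\<phi> z \<noteq> 0" using u by (simp add: z_def diff)
  then have z0: "cinner z z \<noteq> 0" by (metis cinner_eq_zero_iff zero)
  have orth: "cinner v z = 0" if "v \<in> V" for v
  proof -
    have "p v = v" using that p projection_fixes by blast
    then show ?thesis using p(1) unfolding projection_iff z_def cinner_diff_right by (metis cancel_comm_monoid_add_class.diff_cancel)
  qed
  have "\<phi> x = cinner x (cnj (\<phi> z / cinner z z) *\<^sub>C z)" for x
  proof -
    have "x - (\<phi> x / \<phi> z) *\<^sub>C z \<in> V" using z by (simp add: V_def diff lin)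
    then have "cinner x z = \<phi> x / \<phi> z * cinner z z"
      using orth[of "x - (\<phi> x / \<phi> z) *\<^sub>C z"] by (simp add: cinner_simps)
    then show ?thesis using z z0 by (simp add: cinner_simps)
  qed
  then show thesis by (rule that)
qed

lemma adjoint_exists:
  fixes f :: "'a::chilbert_space \<Rightarrow> 'a"
  assumes f: "bounded_clinear f"
  obtains g where "bounded_clinear g" "\<And>x y. cinner (f x) y = cinner x (g y)"
proof -
  have "\<exists>z. \<forall>x. cinner (f x) y = cinner x z" for y
  proof -
    have "bounded_linear (\<lambda>x. cinner (f x) y)"
      using bounded_linear_compose[OF bounded_bilinear.bounded_linear_left[OF bounded_bilinear_cinner]
          bounded_clinear_bounded_linear[OF f]] .
    then show ?thesis
      using Riesz_representation[of "\<lambda>x. cinner (f x) y"]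
      by (metis bounded_clinear_scaleC[OF f] cinner_scaleC_left)
  qed
  then obtain g where g: "\<And>x y. cinner (f x) y = cinner x (g y)" by metis
  obtain K where K: "K > 0" "\<And>x. norm (f x) \<le> norm x * K"
    using bounded_linear.pos_bounded[OF bounded_clinear_bounded_linear[OF f]] by blast
  have "bounded_clinear g"
  proof (rule bounded_clinearI[of _ K])
    show "g (x + y) = g x + g y" for x y
      by (rule cinner_ext_left) (simp add: g[symmetric] cinner_simps)
    show "g (c *\<^sub>C x) = c *\<^sub>C g x" for c x
      by (rule cinner_ext_left) (simp add: g[symmetric] cinner_simps)
    show "norm (g x) \<le> K * norm x" for x
    proof (cases "g x = 0")
      case False
      have "complex_of_real ((norm (g x))\<^sup>2) = cinner (f (g x)) x"
        by (simp add: g cinner_self)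
      then have "(norm (g x))\<^sup>2 = cmod (cinner (f (g x)) x)"
        by (metis norm_of_real abs_of_nonneg zero_le_power2)
      also have "\<dots> \<le> norm (g x) * K * norm x"
        using cinner_Cauchy_Schwarz[of "f (g x)" x] K(2)[of "g x"]
        by (meson mult_right_mono norm_ge_zero order_trans)
      finally show ?thesis using False by (simp add: power2_eq_square mult.assoc)
    qed (use K in simp)
  qed
  then show thesis using g that by blast
qed


section \<open>Von Neumann algebras\<close>

text \<open>A function in place of the relation \<open>is_adjoint\<close>, so that adjoints can be
  computed by rewriting; \<open>is_adjoint_adj\<close> gives it its meaning for bounded
  complex-linear maps.\<close>

definition adj :: "('a::chilbert_space \<Rightarrow> 'a) \<Rightarrow> 'a \<Rightarrow> 'a" where
  "adj f = (THE g. is_adjoint g f)"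

lemma is_adjoint_iff: "is_adjoint g f \<longleftrightarrow> (\<forall>x y. cinner (f x) y = cinner x (g y))"
  unfolding is_adjoint_def op_graph_def op_adjoint_def
  by (auto simp: set_eq_iff) (metis cinner_ext_left)

lemma is_adjoint_unique: "is_adjoint g f \<Longrightarrow> is_adjoint h f \<Longrightarrow> g = h"
  unfolding is_adjoint_iff fun_eq_iff by (metis cinner_ext_left)

lemma is_adjoint_sym: "is_adjoint g f \<Longrightarrow> is_adjoint f g"
  unfolding is_adjoint_iff by (metis cinner_commute)

lemma adj_eqI: "(\<And>x y. cinner (f x) y = cinner x (g y)) \<Longrightarrow> adj f = g"
  unfolding adj_def using is_adjoint_iff is_adjoint_unique by (metis the_equality)

lemma is_adjoint_adj: "bounded_clinear f \<Longrightarrow> is_adjoint (adj f) f"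
  by (metis adjoint_exists adj_eqI is_adjoint_iff)

lemma bounded_clinear_plus:
  "bounded_clinear f \<Longrightarrow> bounded_clinear g \<Longrightarrow> bounded_clinear (\<lambda>x. f x + g x)"
  unfolding bounded_clinear_def by (auto intro: bounded_linear_add simp: scaleC_add_right)

locale vn_algebra =
  fixes M :: "('a::chilbert_space \<Rightarrow> 'a) set"
  assumes vna: "von_neumann_algebra M"
begin

section \<open>Closure properties of \<open>M\<close> and calculus of adjoints\<close>

abbreviation "M' \<equiv> commutant M"

lemma in_M_iff: "f \<in> M \<longleftrightarrow> bounded_clinear f \<and> (\<forall>g\<in>M'. \<forall>x. f (g x) = g (f x))"
proof -
  have "f \<in> M \<longleftrightarrow> f \<in> commutant M'" using vna unfolding von_neumann_algebra_def by blast
  then show ?thesis by (auto simp: commutant_def fun_eq_iff)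
qed

lemma in_M'_iff: "f \<in> M' \<longleftrightarrow> bounded_clinear f \<and> (\<forall>g\<in>M. \<forall>x. f (g x) = g (f x))"
  by (auto simp: commutant_def fun_eq_iff)

lemma M_bcl: "f \<in> M \<Longrightarrow> bounded_clinear f"
  by (simp add: in_M_iff)

lemma M'_bcl: "f \<in> M' \<Longrightarrow> bounded_clinear f"
  by (simp add: in_M'_iff)

lemmas M_lin = bounded_clinear_simps[OF M_bcl]
lemmas M'_lin = bounded_clinear_simps[OF M'_bcl]

lemma M_commute: "f \<in> M \<Longrightarrow> g \<in> M' \<Longrightarrow> f (g x) = g (f x)"
  by (simp add: in_M_iff)

lemma M_compose: "f \<in> M \<Longrightarrow> g \<in> M \<Longrightarrow> (\<lambda>x. f (g x)) \<in> M"
  by (auto simp: in_M_iff intro: bounded_clinear_compose)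

lemma M_funpow: "f \<in> M \<Longrightarrow> (\<lambda>x. (f ^^ n) x) \<in> M"
proof (induction n)
  case 0
  show ?case by (auto simp: in_M_iff intro: bounded_clinearI[of _ 1])
next
  case (Suc n)
  then show ?case using M_compose by simp
qed

lemma M_id: "(\<lambda>x. x) \<in> M"
  by (auto simp: in_M_iff intro: bounded_clinearI[of _ 1])

lemma M_zero: "(\<lambda>x. 0) \<in> M"
  by (auto simp: in_M_iff M'_lin intro: bounded_clinearI[of _ 1])

lemma M_add: "f \<in> M \<Longrightarrow> g \<in> M \<Longrightarrow> (\<lambda>x. f x + g x) \<in> M"
  by (auto simp: in_M_iff M'_lin intro: bounded_clinear_plus)

lemma M_scaleR: "f \<in> M \<Longrightarrow> (\<lambda>x. r *\<^sub>R f x) \<in> M"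
  unfolding in_M_iff bounded_clinear_def
  by (auto simp: M'_lin scaleR_scaleC scaleC_scaleC mult.commute
      intro: bounded_linear_compose[OF bounded_linear_scaleC])

lemma M_diff: "f \<in> M \<Longrightarrow> g \<in> M \<Longrightarrow> (\<lambda>x. f x - g x) \<in> M"
  using M_add[of f "\<lambda>x. (-1) *\<^sub>R g x"] M_scaleR[of g "-1"] by simp

lemma M_sum: "(\<And>i. i \<in> A \<Longrightarrow> F i \<in> M) \<Longrightarrow> (\<lambda>x. \<Sum>i\<in>A. F i x) \<in> M"
  by (induction A rule: infinite_finite_induct) (auto simp: M_zero M_add)

text \<open>Commuting with \<open>M'\<close> passes to bounded pointwise limits, and
  \<open>M\<close> is its own double commutant. All infinite sums of operators enter
  \<open>M\<close> this way.\<close>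

lemma M_limit:
  assumes F: "\<And>n. F n \<in> M" and lim: "\<And>x. (\<lambda>n. F n x) \<longlonglongrightarrow> G x"
    and bd: "\<And>n x. norm (F n x) \<le> K * norm x"
  shows "G \<in> M"
proof -
  have "bounded_clinear G"
  proof (rule bounded_clinearI[of _ K])
    show "G (x + y) = G x + G y" for x y
      using LIMSEQ_unique[OF lim[of "x + y"]] tendsto_add[OF lim[of x] lim[of y]] M_lin[OF F] by simp
    show "G (c *\<^sub>C x) = c *\<^sub>C G x" for c x
      using LIMSEQ_unique[OF lim[of "c *\<^sub>C x"]] tendsto_scaleC[OF lim[of x], of c] M_lin[OF F] by simp
    show "norm (G x) \<le> K * norm x" for x
      using tendsto_norm[OF lim[of x]] bd by (intro LIMSEQ_le_const2) auto
  qed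
  moreover have "G (g x) = g (G x)" if "g \<in> M'" for g x
    using LIMSEQ_unique[OF lim[of "g x"]] bounded_clinear_tendsto[OF M'_bcl[OF that] lim[of x]]
      M_commute[OF F that] by simp
  ultimately show ?thesis by (simp add: in_M_iff)
qed

lemma M_adj: "f \<in> M \<Longrightarrow> adj f \<in> M"
  using vna is_adjoint_adj[OF M_bcl] is_adjoint_unique unfolding von_neumann_algebra_def by blast

lemma cinner_adj: "f \<in> M \<Longrightarrow> cinner (f x) y = cinner x (adj f y)"
  using is_adjoint_adj[OF M_bcl] is_adjoint_iff by blast

lemma cinner_adj': "f \<in> M \<Longrightarrow> cinner (adj f x) y = cinner x (f y)"
  using is_adjoint_adj[OF M_bcl] is_adjoint_iff is_adjoint_sym by blast

lemma adj_adj: "f \<in> M \<Longrightarrow> adj (adj f) = f"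
  by (rule adj_eqI) (rule cinner_adj')

lemma adj_compose: "f \<in> M \<Longrightarrow> g \<in> M \<Longrightarrow> adj (\<lambda>x. f (g x)) = (\<lambda>x. adj g (adj f x))"
  by (rule adj_eqI) (simp add: cinner_adj)

lemma adj_add: "f \<in> M \<Longrightarrow> g \<in> M \<Longrightarrow> adj (\<lambda>x. f x + g x) = (\<lambda>x. adj f x + adj g x)"
  by (rule adj_eqI) (simp add: cinner_adj cinner_simps)

lemma adj_diff: "f \<in> M \<Longrightarrow> g \<in> M \<Longrightarrow> adj (\<lambda>x. f x - g x) = (\<lambda>x. adj f x - adj g x)"
  by (rule adj_eqI) (simp add: cinner_adj cinner_simps)

lemma adj_id: "adj (\<lambda>x. x) = (\<lambda>x. x)"
  by (rule adj_eqI) simp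

lemma adj_funpow: "f \<in> M \<Longrightarrow> adj (\<lambda>x. (f ^^ n) x) = (\<lambda>x. (adj f ^^ n) x)"
proof (induction n)
  case 0
  show ?case by (rule adj_eqI) simp
next
  case (Suc n)
  then show ?case
    using adj_compose[OF _ M_funpow[of f n], of f] by (simp add: funpow_swap1)
qed

lemma adj_projection: "projection p \<Longrightarrow> adj p = p"
  by (rule adj_eqI) (simp add: projection_iff)

lemma projection_iff_adj: "p \<in> M \<Longrightarrow> projection p \<longleftrightarrow> (\<forall>x. p (p x) = p x) \<and> adj p = p"
  using M_bcl cinner_adj adj_projection unfolding projection_iff by metis

lemma M'_adj:
  assumes "f \<in> M'"
  shows "adj f \<in> M'"
proof -
  obtain g where g: "bounded_clinear g" "\<And>x y. cinner (f x) y = cinner x (g y)"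
    using adjoint_exists[OF M'_bcl[OF assms]] by metis
  have "g (m x) = m (g x)" if m: "m \<in> M" for m x
  proof (rule cinner_ext_left)
    fix z
    have "cinner z (g (m x)) = cinner (adj m (f z)) x"
      using g(2) cinner_adj'[OF m] by metis
    also have "\<dots> = cinner (f (adj m z)) x"
      using M_commute[OF M_adj[OF m] assms] by simp
    also have "\<dots> = cinner z (m (g x))"
      using g(2) cinner_adj'[OF m] by metis
    finally show "cinner z (g (m x)) = cinner z (m (g x))" .
  qed
  then show ?thesis using g adj_eqI[of f g] by (simp add: in_M'_iff)
qed

text \<open>\<open>M'\<close> is closed under adjoints, so \<open>V\<close> is invariant under
  \<open>g\<close> and under \<open>adj g\<close>; together these say that \<open>p\<close> commutes
  with \<open>g\<close>, and the double commutant does the rest.\<close>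

lemma projection_in_M:
  assumes V: "closed_csubspace V" and inv: "\<And>g v. g \<in> M' \<Longrightarrow> v \<in> V \<Longrightarrow> g v \<in> V"
  obtains p where "p \<in> M" "projection p" "range p = V"
proof -
  obtain p where p: "projection p" "range p = V" using projection_exists[OF V] .
  have inv': "p (g (p x)) = g (p x)" if "g \<in> M'" for g x
    using inv[OF that, of "p x"] p projection_fixes[of p] by blast
  have "p (g x) = g (p x)" if g: "g \<in> M'" for g x
  proof (rule cinner_ext_left)
    fix z
    have ga: "adj g \<in> M'" using g by (rule M'_adj)
    have ad: "cinner u (g v) = cinner (adj g u) v" for u v
      using is_adjoint_adj[OF M'_bcl[OF g]] is_adjoint_iff is_adjoint_sym by metis
    have "cinner z (p (g x)) = cinner (adj g (p z)) x"
      using p by (simp add: projection_iff flip: ad)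
    also have "\<dots> = cinner (p (adj g (p z))) x" using inv'[OF ga] by simp
    also have "\<dots> = cinner z (p (g (p x)))"
      using p by (simp add: projection_iff flip: ad)
    finally show "cinner z (p (g x)) = cinner z (g (p x))" using inv'[OF g] by simp
  qed
  then have "p \<in> M" using p by (simp add: in_M_iff projection_iff)
  then show thesis using p that by blast
qed

lemma adj_adj_compose_eqI:
  assumes f: "f \<in> M" and p: "p \<in> M" and eq: "\<And>x. norm (f x) = norm (p x)"
  shows "adj f (f x) = adj p (p x)"
proof -
  have "adj f (f x) - adj p (p x) = 0"
  proof (rule bounded_clinear_eq_0[of "\<lambda>x. adj f (f x) - adj p (p x)"])
    show "bounded_clinear (\<lambda>x. adj f (f x) - adj p (p x))"
      by (rule M_bcl[OF M_diff[OF M_compose[OF M_adj[OF f] f] M_compose[OF M_adj[OF p] p]]])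
    show "cinner (adj f (f y) - adj p (p y)) y = 0" for y
      by (simp add: cinner_simps cinner_adj' f p cinner_self eq)
  qed
  then show ?thesis by simp
qed

lemma norm_square_adj: "f \<in> M \<Longrightarrow> complex_of_real ((norm (f x))\<^sup>2) = cinner (adj f (f x)) x"
  by (simp add: cinner_adj' cinner_self del: of_real_power)

lemma isometry_norm: "f \<in> M \<Longrightarrow> (\<And>x. adj f (f x) = x) \<Longrightarrow> norm (f x) = norm x"
proof -
  assume f: "f \<in> M" "\<And>x. adj f (f x) = x"
  have "complex_of_real ((norm (f x))\<^sup>2) = complex_of_real ((norm x)\<^sup>2)"
    using norm_square_adj[OF f(1), of x] f(2) by (simp add: cinner_self)
  then have "(norm (f x))\<^sup>2 = (norm x)\<^sup>2" using of_real_eq_iff by blast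
  then show ?thesis by (simp add: power2_eq_iff_nonneg)
qed

lemma adj_compose_eq_0:
  assumes "f \<in> M" "adj f (f x) = 0"
  shows "f x = 0"
  using norm_square_adj[OF assms(1), of x] assms(2) by simp

lemma norm_adj_le:
  assumes "f \<in> M" "\<And>x. norm (f x) \<le> K * norm x"
  shows "norm (adj f x) \<le> K * norm x"
proof (cases "adj f x = 0")
  case True
  then show ?thesis using order_trans[OF norm_ge_zero assms(2)] by simp
next
  case False
  have "complex_of_real ((norm (adj f x))\<^sup>2) = cinner (f (adj f x)) x"
    by (simp add: assms(1) cinner_adj cinner_self)
  then have "(norm (adj f x))\<^sup>2 = cmod (cinner (f (adj f x)) x)"
    by (metis norm_of_real abs_of_nonneg zero_le_power2)
  also have "\<dots> \<le> K * norm (adj f x) * norm x"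
    using cinner_Cauchy_Schwarz assms(2) by (meson mult_right_mono norm_ge_zero order_trans)
  finally show ?thesis using False by (simp add: power2_eq_square)
qed

subsection \<open>Square roots\<close>

text \<open>With \<open>X = 1 - (adj x) x\<close>, the root is \<open>1 - Z\<close> for a solution
  \<open>Z\<close> of \<open>2 Z = X + Z\<^sup>2\<close>, found by iteration. The scalar iteration
  \<open>t \<mapsto> (1 + t\<^sup>2) / 2\<close> from 0 dominates the iterates and their increments,
  which gives pointwise convergence.\<close>

lemma M_contraction_sqrt:
  assumes x: "x \<in> M" "\<And>u. norm (x u) \<le> norm u"
  obtains h where "h \<in> M" "adj h = h" "\<And>u. h (h u) = adj x (x u)"
proof -
  define X where "X u = u - adj x (x u)" for u
  have XM: "X \<in> M"
    unfolding X_def by (rule M_diff[OF M_id M_compose[OF M_adj[OF x(1)] x(1)]])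
  have Xadj: "adj X = X"
    unfolding X_def using x(1) by (simp add: adj_diff adj_id adj_compose adj_adj M_id M_compose M_adj)
  have X1: "norm (X u) \<le> norm u" for u
  proof (rule power2_le_imp_le)
    have a1: "norm (adj x v) \<le> norm v" for v
      using norm_adj_le[OF x(1), of 1 v] x(2) by simp
    have "Re (cinner u (adj x (x u))) = (norm (x u))\<^sup>2"
      using cinner_adj[OF x(1), of u "x u"] unfolding cinner_self by (metis Re_complex_of_real)
    moreover have "(norm (adj x (x u)))\<^sup>2 \<le> (norm (x u))\<^sup>2" using a1 by (simp add: power_mono)
    ultimately show "(norm (X u))\<^sup>2 \<le> (norm u)\<^sup>2"
      unfolding X_def norm_diff_square using zero_le_power2[of "norm (x u)"] by linarith
  qed simp
  define y :: "nat \<Rightarrow> real" where "y = rec_nat 0 (\<lambda>_ t. (1 + t\<^sup>2) / 2)"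
  define Y where "Y = rec_nat (\<lambda>u. 0) (\<lambda>_ T u. (1/2) *\<^sub>R (X u + T (T u)))"
  have y0: "y 0 = 0" and yS: "y (Suc n) = (1 + (y n)\<^sup>2) / 2" for n by (simp_all add: y_def)
  have Y0: "Y 0 u = 0" and YS: "Y (Suc n) u = (1/2) *\<^sub>R (X u + Y n (Y n u))" for n u
    by (simp_all add: Y_def)
  have YM: "Y n \<in> M" for n
  proof (induction n)
    case 0 then show ?case by (simp add: Y_def M_zero)
  next
    case (Suc n)
    have "(\<lambda>u. (1/2) *\<^sub>R (X u + Y n (Y n u))) \<in> M"
      by (rule M_scaleR[OF M_add[OF XM M_compose[OF Suc Suc]]])
    moreover have "Y (Suc n) = (\<lambda>u. (1/2) *\<^sub>R (X u + Y n (Y n u)))" by (rule ext) (rule YS)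
    ultimately show ?case by simp
  qed
  have YX: "Y n (X u) = X (Y n u)" for n u
    by (induction n arbitrary: u) (simp_all add: Y0 YS M_lin[OF XM])
  have YY: "Y n (Y m u) = Y m (Y n u)" for n m u
  proof (induction n arbitrary: u)
    case 0 then show ?case by (simp add: Y0 M_lin[OF YM])
  next
    case (Suc n) then show ?case by (simp add: YS M_lin[OF YM] YX)
  qed
  have y01: "0 \<le> y n \<and> y n \<le> 1" for n
  proof (induction n)
    case (Suc n)
    then have "(y n)\<^sup>2 \<le> 1" by (simp add: power_le_one)
    then show ?case by (simp add: yS)
  qed (simp add: y0)
  have Yy: "norm (Y n u) \<le> y n * norm u" for n u
  proof (induction n arbitrary: u)
    case 0 then show ?case by (simp add: Y0 y0)
  next
    case (Suc n)
    have "norm (Y n (Y n u)) \<le> y n * (y n * norm u)"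
      using Suc[of "Y n u"] Suc[of u] y01 by (meson mult_left_mono order_trans)
    then have "norm (X u + Y n (Y n u)) \<le> norm u + y n * (y n * norm u)"
      using X1[of u] norm_triangle_ineq[of "X u" "Y n (Y n u)"] by linarith
    moreover have "norm (Y (Suc n) u) = norm (X u + Y n (Y n u)) / 2" by (simp add: YS)
    ultimately show ?case by (simp add: yS power2_eq_square field_simps)
  qed
  have ymono: "y n \<le> y (Suc n)" for n
    using sum_squares_bound[of 1 "y n"] by (simp add: yS)
  have Ydiff: "norm (Y (Suc n) u - Y n u) \<le> (y (Suc n) - y n) * norm u" for n u
  proof (induction n arbitrary: u)
    case 0 show ?case using X1[of u] by (simp add: Y0 y0 YS yS)
  next
    case (Suc n)
    \<comment> \<open>The iterates commute, so the difference of their squares at \<open>u\<close>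
      is \<open>Y (Suc n) w - Y n w\<close>; the scalar sequence factors in the same way.\<close>
    define w where "w = Y (Suc n) u + Y n u"
    have "Y (Suc (Suc n)) u - Y (Suc n) u = (1/2) *\<^sub>R (Y (Suc n) (Y (Suc n) u) - Y n (Y n u))"
      by (simp only: YS[of "Suc n"] YS[of n u]) (simp add: algebra_simps)
    also have "Y (Suc n) (Y (Suc n) u) - Y n (Y n u) = Y (Suc n) w - Y n w"
      unfolding w_def by (simp add: M_lin[OF YM] YY[of "Suc n" n])
    finally have eq: "norm (Y (Suc (Suc n)) u - Y (Suc n) u) = norm (Y (Suc n) w - Y n w) / 2"
      by simp
    have "norm w \<le> (y (Suc n) + y n) * norm u"
      unfolding w_def using Yy[of "Suc n" u] Yy[of n u] norm_triangle_ineq[of "Y (Suc n) u" "Y n u"]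
      by (simp add: distrib_right)
    then have "norm (Y (Suc n) w - Y n w) \<le> (y (Suc n) - y n) * ((y (Suc n) + y n) * norm u)"
      using Suc[of w] ymono[of n] by (meson diff_ge_0_iff_ge mult_left_mono order_trans)
    also have "\<dots> = 2 * (y (Suc (Suc n)) - y (Suc n)) * norm u"
    proof -
      have "2 * (s - t) * c = (p - q) * ((p + q) * c)" if "s = (1 + p\<^sup>2) / 2" "t = (1 + q\<^sup>2) / 2" for s t p q c :: real
        unfolding that power2_eq_square by (simp add: field_simps)
      from this[OF yS[of "Suc n"] yS[of n]] show ?thesis by (rule sym)
    qed
    finally show ?case unfolding eq by (simp add: algebra_simps)
  qed
  have "Bseq y" using y01 by (intro BseqI'[of _ 1]) (simp add: abs_le_iff)
  then have "convergent y"
    using ymono by (intro Bseq_monoseq_convergent) (auto simp: monoseq_Suc)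
  then have sy: "summable (\<lambda>n. y (Suc n) - y n)"
    using telescope_summable[of y] convergent_LIMSEQ_iff[of y] by auto
  have conv: "\<exists>l. (\<lambda>n. Y n u) \<longlonglongrightarrow> l" for u
  proof -
    have "summable (\<lambda>n. Y (Suc n) u - Y n u)"
      using summable_comparison_test'[OF summable_mult2[OF sy, of "norm u"] Ydiff] .
    then obtain l where "(\<lambda>n. \<Sum>i<n. Y (Suc i) u - Y i u) \<longlonglongrightarrow> l"
      by (auto simp: summable_def sums_def)
    then show ?thesis using sum_lessThan_telescope[of "\<lambda>n. Y n u"] by (auto simp: Y0)
  qed
  then obtain Z where Z: "\<And>u. (\<lambda>n. Y n u) \<longlonglongrightarrow> Z u" by metis
  have Y1: "norm (Y n u) \<le> 1 * norm u" for n u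
    using Yy[of n u] y01[of n] by (meson mult_right_mono norm_ge_zero order_trans)
  have ZM: "Z \<in> M" by (rule M_limit[OF YM Z Y1])
  have Yadj: "cinner (Y n u) v = cinner u (Y n v)" for n u v
  proof (induction n arbitrary: u v)
    case (Suc n)
    have "cinner (X u) v = cinner u (X v)" using cinner_adj[OF XM, of u v] Xadj by simp
    then show ?case by (simp add: YS cinner_simps Suc)
  qed (simp add: Y0)
  have Zadj: "adj Z = Z"
  proof (rule adj_eqI)
    show "cinner (Z u) v = cinner u (Z v)" for u v
      using LIMSEQ_unique[OF tendsto_cinner[OF Z[of u] tendsto_const, of v]]
        tendsto_cinner[OF tendsto_const Z[of v], of u] Yadj by simp
  qed
  have "2 *\<^sub>R Z u = X u + Z (Z u)" for u
  proof -
    have "(\<lambda>n. Y n (Y n u - Z u)) \<longlonglongrightarrow> 0"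
    proof (rule Lim_null_comparison)
      show "\<forall>\<^sub>F n in sequentially. norm (Y n (Y n u - Z u)) \<le> norm (Y n u - Z u)"
        using Y1 by simp
      show "(\<lambda>n. norm (Y n u - Z u)) \<longlonglongrightarrow> 0"
        using Z[of u] LIM_zero tendsto_norm_zero by blast
    qed
    from tendsto_add[OF this Z[of "Z u"]] have "(\<lambda>n. Y n (Y n u)) \<longlonglongrightarrow> Z (Z u)"
      by (simp add: M_lin[OF YM])
    then have "(\<lambda>n. Y (Suc n) u) \<longlonglongrightarrow> (1/2) *\<^sub>R (X u + Z (Z u))"
      unfolding YS by (intro tendsto_intros)
    then have "Z u = (1/2) *\<^sub>R (X u + Z (Z u))"
      by (rule LIMSEQ_unique[OF LIMSEQ_Suc[OF Z[of u]]])
    from arg_cong[OF this, of "\<lambda>v. 2 *\<^sub>R v"] show ?thesis by simp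
  qed
  \<comment> \<open>The fixed point equation read as \<open>(1 - Z)\<^sup>2 = 1 - X\<close>.\<close>
  then have "u - Z u - Z (u - Z u) = adj x (x u)" for u
    by (simp add: M_lin[OF ZM] X_def scaleR_2 algebra_simps)
  moreover have "(\<lambda>u. u - Z u) \<in> M" by (rule M_diff[OF M_id ZM])
  moreover have "adj (\<lambda>u. u - Z u) = (\<lambda>u. u - Z u)"
    using adj_diff[OF M_id ZM] by (simp add: adj_id Zadj)
  ultimately show thesis using that[of "\<lambda>u. u - Z u"] by simp
qed

end


section \<open>Shifts\<close>

lemma norm_sum_orthogonal:
  fixes y :: "'i \<Rightarrow> 'a::chilbert_space"
  assumes "finite A" "\<And>m n. m \<in> A \<Longrightarrow> n \<in> A \<Longrightarrow> m \<noteq> n \<Longrightarrow> cinner (y m) (y n) = 0"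
  shows "(norm (\<Sum>n\<in>A. y n))\<^sup>2 = (\<Sum>n\<in>A. (norm (y n))\<^sup>2)"
  using assms
proof (induction A rule: finite_induct)
  case (insert m A)
  have "cinner (y m) (\<Sum>n\<in>A. y n) = (\<Sum>n\<in>A. cinner (y m) (y n))"
    using bounded_bilinear.sum_right[OF bounded_bilinear_cinner] .
  also have "\<dots> = 0" using insert by (intro sum.neutral) auto
  finally show ?case using insert by (simp add: norm_add_square)
qed simp

text \<open>By Pythagoras the Cauchy criterion for the series is that for the squared norms.\<close>

lemma summable_orthogonal:
  fixes y :: "nat \<Rightarrow> 'a::chilbert_space"
  assumes orth: "\<And>m n. m \<noteq> n \<Longrightarrow> cinner (y m) (y n) = 0"
    and sq: "summable (\<lambda>n. (norm (y n))\<^sup>2)"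
  shows "summable y"
  unfolding summable_Cauchy
proof (intro allI impI)
  fix e :: real assume e: "e > 0"
  then obtain N where N: "\<And>m n. m \<ge> N \<Longrightarrow> norm (\<Sum>n=m..<n. (norm (y n))\<^sup>2) < e\<^sup>2"
    using sq unfolding summable_Cauchy by (metis zero_less_power)
  have "norm (sum y {m..<n}) < e" if "m \<ge> N" for m n
  proof (rule power2_less_imp_less)
    show "(norm (sum y {m..<n}))\<^sup>2 < e\<^sup>2"
      using N[OF that, of n] orth by (subst norm_sum_orthogonal) auto
  qed (use e in simp)
  then show "\<exists>N. \<forall>m\<ge>N. \<forall>n. norm (sum y {m..<n}) < e" by blast
qed

text \<open>The images of the range of \<open>f\<close> under the powers of \<open>a\<close> are
  mutually orthogonal copies of it. \<open>f\<close> may be smaller than the complement of the range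
  of \<open>a\<close>, and \<open>a\<close> may have a unitary part, so the copies may fail to span
  the space.\<close>

locale vn_shift = vn_algebra M for M :: "('a::chilbert_space \<Rightarrow> 'a) set" +
  fixes a f :: "'a \<Rightarrow> 'a"
  assumes aM: "a \<in> M" and a_iso: "\<And>x. adj a (a x) = x"
    and fM: "f \<in> M" and f_proj: "projection f" and adj_a_f: "\<And>x. adj a (f x) = 0"
begin

abbreviation "a' \<equiv> adj a"

text \<open>The component in the \<open>n\<close>-th copy, pulled back to the range of
  \<open>f\<close>; components at different places thus live in one space and can be
  compared.\<close>

definition coord :: "nat \<Rightarrow> 'a \<Rightarrow> 'a" where
  "coord n x = f ((a' ^^ n) x)"

lemma a'M: "a' \<in> M" using aM by (rule M_adj)

lemma coord_M: "coord n \<in> M"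
  using M_compose[OF fM M_funpow[OF a'M, of n]] by (simp add: coord_def[abs_def])

lemma ff [simp]: "f (f x) = f x" using f_proj by (simp add: projection_iff)

lemma cinner_f: "cinner (f x) y = cinner x (f y)" using f_proj by (simp add: projection_iff)

lemma f_a [simp]: "f (a x) = 0"
proof (rule cinner_ext_left)
  show "cinner z (f (a x)) = cinner z 0" for z
    using cinner_adj'[OF aM, of "f z" x] by (simp add: adj_a_f cinner_f)
qed

lemma f_coord [simp]: "f (coord n x) = coord n x" by (simp add: coord_def)

lemma funpow_a'_a_le: "(a' ^^ m) ((a ^^ (m + k)) x) = (a ^^ k) x"
proof (induction m)
  case (Suc m)
  then show ?case
    by (simp add: funpow_Suc_right[of m a'] funpow.simps(2)[of "m + k" a] a_iso del: funpow.simps(2))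
qed simp

lemma funpow_a'_f: "(a' ^^ Suc k) (f x) = 0"
  by (simp only: funpow_Suc_right o_apply adj_a_f M_lin[OF M_funpow[OF a'M]])

text \<open>Off the diagonal, \<open>f a = 0\<close> kills the case \<open>m < n\<close> and
  \<open>a' f = 0\<close> the case \<open>m > n\<close>.\<close>

lemma coord_funpow: "coord m ((a ^^ n) (f y)) = (if m = n then f y else 0)"
proof (cases m n rule: linorder_cases)
  case less
  then obtain k where "n = m + Suc k" by (metis less_imp_Suc_add add_Suc_right)
  then have "(a' ^^ m) ((a ^^ n) (f y)) = (a ^^ Suc k) (f y)"
    by (simp only: funpow_a'_a_le)
  then show ?thesis using less by (simp add: coord_def)
next
  case equal
  then show ?thesis using funpow_a'_a_le[of m 0 "f y"] by (simp add: coord_def)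
next
  case greater
  then obtain k where "m = Suc k + n" by (metis less_imp_Suc_add add_Suc_right add_Suc add.commute)
  then have "(a' ^^ m) = (a' ^^ Suc k) \<circ> (a' ^^ n)" by (simp only: funpow_add)
  then have "(a' ^^ m) ((a ^^ n) (f y)) = 0"
    using funpow_a'_a_le[of n 0 "f y"] funpow_a'_f by (simp del: funpow.simps(2))
  then show ?thesis using greater by (simp add: coord_def M_lin[OF fM])
qed

lemma cinner_funpow: "cinner ((a ^^ n) x) y = cinner x ((a' ^^ n) y)"
  using cinner_adj[OF M_funpow[OF aM]] adj_funpow[OF aM] by metis

lemma norm_funpow: "norm ((a ^^ n) x) = norm x"
  by (induction n) (auto simp: isometry_norm[OF aM a_iso])

lemma funpow_orthogonal: "m \<noteq> n \<Longrightarrow> cinner ((a ^^ m) (f x)) ((a ^^ n) (f y)) = 0"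
  using coord_funpow[of m n y] by (simp add: cinner_funpow cinner_f coord_def)

text \<open>\<open>u\<close> is the projection of \<open>y\<close> to the sum of the orthogonal
  ranges of \<open>f\<close> and \<open>a\<close>. Iterating on \<open>a' y\<close> gives Bessel's
  inequality with its remainder.\<close>

lemma norm_f_a': "(norm (f y))\<^sup>2 + (norm (a' y))\<^sup>2 \<le> (norm y)\<^sup>2"
proof -
  define u where "u = f y + a (a' y)"
  have "Re (cinner (f y) (a (a' y))) = 0"
    using cinner_adj'[OF aM, of "f y" "a' y"] by (simp add: adj_a_f)
  then have u: "(norm u)\<^sup>2 = (norm (f y))\<^sup>2 + (norm (a' y))\<^sup>2"
    by (simp add: u_def norm_add_square isometry_norm[OF aM a_iso])
  have "cinner (y - u) u = cinner (f (y - u)) y + cinner (a' (y - u)) (a' y)"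
    by (subst (2) u_def) (simp add: cinner_simps cinner_f cinner_adj'[OF aM])
  also have "\<dots> = 0" by (simp add: u_def M_lin[OF fM] M_lin[OF a'M] adj_a_f a_iso)
  finally show ?thesis using norm_add_square[of "y - u" u] u by simp
qed

lemma Bessel_partial: "(\<Sum>n<N. (norm (coord n x))\<^sup>2) + (norm ((a' ^^ N) x))\<^sup>2 \<le> (norm x)\<^sup>2"
proof (induction N)
  case (Suc N)
  then show ?case using norm_f_a'[of "(a' ^^ N) x"] by (simp add: coord_def)
qed simp

lemma Bessel_finite:
  assumes "finite A"
  shows "(\<Sum>n\<in>A. (norm (coord n x))\<^sup>2) \<le> (norm x)\<^sup>2"
proof -
  obtain N where "A \<subseteq> {..<N}" using assms finite_nat_iff_bounded by blast
  then have "(\<Sum>n\<in>A. (norm (coord n x))\<^sup>2) \<le> (\<Sum>n<N. (norm (coord n x))\<^sup>2)"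
    by (intro sum_mono2) auto
  also have "\<dots> \<le> (norm x)\<^sup>2" using Bessel_partial[where N = N and x = x] zero_le_power2[of "norm ((a' ^^ N) x)"] by linarith
  finally show ?thesis .
qed

lemma norm_coord_le: "norm (coord n x) \<le> norm x"
  by (rule power2_le_imp_le) (use Bessel_finite[of "{n}" x] in auto)

lemma summable_coord: "summable (\<lambda>n. (norm (coord n x))\<^sup>2)"
  by (rule bounded_imp_summable[of _ "(norm x)\<^sup>2"]) (simp_all add: Bessel_finite)

text \<open>A weighted series of matrix units, from place \<open>\<tau> n\<close> to place
  \<open>\<sigma> n\<close>. For injective \<open>\<sigma>\<close> and \<open>\<tau>\<close> it
  covers the projection to the span of the copies, diagonal operators and relabellings of the
  places.\<close>

definition shift_op :: "(nat \<Rightarrow> nat) \<Rightarrow> (nat \<Rightarrow> nat) \<Rightarrow> (nat \<Rightarrow> real) \<Rightarrow> 'a \<Rightarrow> 'a" where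
  "shift_op \<sigma> \<tau> w x = (\<Sum>n. w n *\<^sub>R (a ^^ \<sigma> n) (coord (\<tau> n) x))"

context
  fixes \<sigma> \<tau> :: "nat \<Rightarrow> nat" and w :: "nat \<Rightarrow> real" and K :: real
  assumes inj: "inj \<sigma>" "inj \<tau>" and wK: "\<And>n. \<bar>w n\<bar> \<le> K"
begin

lemma K_nonneg: "0 \<le> K" using wK[of 0] by linarith

lemma shift_term_orthogonal: "m \<noteq> n \<Longrightarrow>
  cinner (w m *\<^sub>R (a ^^ \<sigma> m) (coord (\<tau> m) x)) (w n *\<^sub>R (a ^^ \<sigma> n) (coord (\<tau> n) y)) = 0"
  using funpow_orthogonal[of "\<sigma> m" "\<sigma> n" "coord (\<tau> m) x" "coord (\<tau> n) y"] inj
  by (simp add: cinner_simps inj_eq)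

lemma norm_shift_term: "(norm (w n *\<^sub>R (a ^^ \<sigma> n) (coord (\<tau> n) x)))\<^sup>2 \<le> K\<^sup>2 * (norm (coord (\<tau> n) x))\<^sup>2"
  using wK[of n] by (simp add: norm_funpow power_mult_distrib mult_right_mono abs_le_square_iff[symmetric] abs_of_nonneg[OF K_nonneg])

lemma shift_op_sums: "(\<lambda>n. w n *\<^sub>R (a ^^ \<sigma> n) (coord (\<tau> n) x)) sums shift_op \<sigma> \<tau> w x"
  unfolding shift_op_def
proof (intro summable_sums summable_orthogonal shift_term_orthogonal)
  have "summable (\<lambda>n. K\<^sup>2 * (norm (coord (\<tau> n) x))\<^sup>2)"
    using summable_reindex[OF summable_coord inj(2), of x] by (auto intro: summable_mult simp: o_def)
  then show "summable (\<lambda>n. (norm (w n *\<^sub>R (a ^^ \<sigma> n) (coord (\<tau> n) x)))\<^sup>2)"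
    by (rule summable_comparison_test') (use norm_shift_term in simp)
qed

lemma norm_shift_partial: "norm (\<Sum>n<N. w n *\<^sub>R (a ^^ \<sigma> n) (coord (\<tau> n) x)) \<le> K * norm x"
proof (rule power2_le_imp_le)
  have "(norm (\<Sum>n<N. w n *\<^sub>R (a ^^ \<sigma> n) (coord (\<tau> n) x)))\<^sup>2
      = (\<Sum>n<N. (norm (w n *\<^sub>R (a ^^ \<sigma> n) (coord (\<tau> n) x)))\<^sup>2)"
    by (intro norm_sum_orthogonal shift_term_orthogonal) auto
  also have "\<dots> \<le> (\<Sum>n<N. K\<^sup>2 * (norm (coord (\<tau> n) x))\<^sup>2)"
    by (intro sum_mono norm_shift_term)
  also have "\<dots> = K\<^sup>2 * (\<Sum>n\<in>\<tau> ` {..<N}. (norm (coord n x))\<^sup>2)"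
    using inj(2) by (simp add: sum_distrib_left sum.reindex inj_on_subset)
  also have "\<dots> \<le> K\<^sup>2 * (norm x)\<^sup>2" by (intro mult_left_mono Bessel_finite) auto
  finally show "(norm (\<Sum>n<N. w n *\<^sub>R (a ^^ \<sigma> n) (coord (\<tau> n) x)))\<^sup>2 \<le> (K * norm x)\<^sup>2"
    by (simp add: power_mult_distrib)
qed (simp add: K_nonneg)

lemma shift_op_lim: "(\<lambda>N. \<Sum>n<N. w n *\<^sub>R (a ^^ \<sigma> n) (coord (\<tau> n) x)) \<longlonglongrightarrow> shift_op \<sigma> \<tau> w x"
  using shift_op_sums by (simp add: sums_def)

lemma norm_shift_op: "norm (shift_op \<sigma> \<tau> w x) \<le> K * norm x"
  by (rule LIMSEQ_le_const2[OF tendsto_norm[OF shift_op_lim]]) (use norm_shift_partial in blast)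

lemma shift_op_M: "shift_op \<sigma> \<tau> w \<in> M"
proof (rule M_limit[OF _ shift_op_lim norm_shift_partial])
  show "(\<lambda>x. \<Sum>n<N. w n *\<^sub>R (a ^^ \<sigma> n) (coord (\<tau> n) x)) \<in> M" for N
    by (rule M_sum) (rule M_scaleR[OF M_compose[OF M_funpow[OF aM] coord_M]])
qed

lemma coord_shift_op_sums:
  "(\<lambda>n. if m = \<sigma> n then w n *\<^sub>R coord (\<tau> n) x else 0) sums coord m (shift_op \<sigma> \<tau> w x)"
proof -
  have "coord m (w n *\<^sub>R (a ^^ \<sigma> n) (coord (\<tau> n) x)) = (if m = \<sigma> n then w n *\<^sub>R coord (\<tau> n) x else 0)" for n
    using coord_funpow[of m "\<sigma> n" "coord (\<tau> n) x"] by (simp add: M_lin[OF coord_M])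
  then show ?thesis
    using bounded_linear.sums[OF bounded_clinear_bounded_linear[OF M_bcl[OF coord_M[of m]]] shift_op_sums[of x]]
    by simp
qed

lemma coord_shift_op: "coord (\<sigma> n) (shift_op \<sigma> \<tau> w x) = w n *\<^sub>R coord (\<tau> n) x"
proof -
  have "(\<lambda>k. if \<sigma> n = \<sigma> k then w k *\<^sub>R coord (\<tau> k) x else 0) sums (w n *\<^sub>R coord (\<tau> n) x)"
    using sums_single[of n "\<lambda>k. w k *\<^sub>R coord (\<tau> k) x"] inj(1) by (simp add: inj_eq eq_commute)
  then show ?thesis using coord_shift_op_sums sums_unique2 by blast
qed

lemma coord_shift_op_outside: "m \<notin> range \<sigma> \<Longrightarrow> coord m (shift_op \<sigma> \<tau> w x) = 0"
proof -
  assume "m \<notin> range \<sigma>"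
  then have "(\<lambda>n. if m = \<sigma> n then w n *\<^sub>R coord (\<tau> n) x else 0) = (\<lambda>_. 0)" by (auto simp: fun_eq_iff)
  then show ?thesis using coord_shift_op_sums[of m x] sums_unique2[OF _ sums_zero] by simp
qed

end

text \<open>Each matrix unit is turned around and the real weights stay.\<close>

lemma adj_shift_op:
  assumes "inj \<sigma>" "inj \<tau>" "\<And>n. \<bar>w n\<bar> \<le> K"
  shows "adj (shift_op \<sigma> \<tau> w) = shift_op \<tau> \<sigma> w"
proof (rule adj_eqI)
  fix x y
  have "cinner (w n *\<^sub>R (a ^^ \<sigma> n) (coord (\<tau> n) x)) y = cinner x (w n *\<^sub>R (a ^^ \<tau> n) (coord (\<sigma> n) y))" for n
  proof -
    have "cinner ((a ^^ \<sigma> n) (coord (\<tau> n) x)) y = cinner ((a' ^^ \<tau> n) x) (coord (\<sigma> n) y)"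
      by (simp add: cinner_funpow coord_def cinner_f)
    also have "\<dots> = cinner x ((a ^^ \<tau> n) (coord (\<sigma> n) y))"
      by (metis cinner_commute cinner_funpow)
    finally show ?thesis by (simp add: cinner_simps)
  qed
  then have "(\<lambda>n. cinner (w n *\<^sub>R (a ^^ \<sigma> n) (coord (\<tau> n) x)) y) sums cinner x (shift_op \<tau> \<sigma> w y)"
    using bounded_linear.sums[OF bounded_bilinear.bounded_linear_right[OF bounded_bilinear_cinner]
        shift_op_sums[OF assms(2,1,3)]] by simp
  moreover have "(\<lambda>n. cinner (w n *\<^sub>R (a ^^ \<sigma> n) (coord (\<tau> n) x)) y) sums cinner (shift_op \<sigma> \<tau> w x) y"
    using bounded_linear.sums[OF bounded_bilinear.bounded_linear_left[OF bounded_bilinear_cinner]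
        shift_op_sums[OF assms]] .
  ultimately show "cinner (shift_op \<sigma> \<tau> w x) y = cinner x (shift_op \<tau> \<sigma> w y)"
    by (rule sums_unique2[symmetric])
qed

lemma shift_op_compose:
  assumes "inj \<tau>" "inj \<rho>" "\<And>n. \<bar>v n\<bar> \<le> K"
  shows "shift_op \<sigma> \<tau> w (shift_op \<tau> \<rho> v x) = shift_op \<sigma> \<rho> (\<lambda>n. w n * v n) x"
  unfolding shift_op_def[of \<sigma>]
  by (simp add: coord_shift_op[OF assms] M_lin[OF M_funpow[OF aM]])

definition span_proj :: "'a \<Rightarrow> 'a" where
  "span_proj = shift_op (\<lambda>n. n) (\<lambda>n. n) (\<lambda>_. 1)"

lemma inj_ident: "inj (\<lambda>n::nat. n)" by (simp add: inj_on_def)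

lemma span_proj_sums: "(\<lambda>n. (a ^^ n) (coord n x)) sums span_proj x"
  unfolding span_proj_def using shift_op_sums[OF inj_ident inj_ident, of "\<lambda>_. 1" 1 x] by simp

lemma span_proj_M: "span_proj \<in> M"
  unfolding span_proj_def by (rule shift_op_M[OF inj_ident inj_ident, of _ 1]) simp

lemma projection_span_proj: "projection span_proj"
  unfolding projection_iff_adj[OF span_proj_M] unfolding span_proj_def
  by (simp add: shift_op_compose[OF inj_ident inj_ident, of _ 1] adj_shift_op[OF inj_ident inj_ident, of _ 1])

lemma coord_span_proj: "coord n (span_proj x) = coord n x"
  unfolding span_proj_def by (simp add: coord_shift_op[OF inj_ident inj_ident, of _ 1])

text \<open>Self-similarity of the shift: all copies but the first are the image under
  \<open>a\<close> of all copies. The Schroeder-Bernstein argument rests on this.\<close>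

lemma span_proj_eq: "span_proj x = f x + a (span_proj (a' x))"
proof -
  have "(\<lambda>n. (a ^^ Suc n) (coord (Suc n) x)) sums a (span_proj (a' x))"
    using bounded_linear.sums[OF bounded_clinear_bounded_linear[OF M_bcl[OF aM]] span_proj_sums[of "a' x"]]
    by (simp add: coord_def funpow_swap1)
  from sums_unique2[OF sums_Suc[OF this] span_proj_sums] show ?thesis
    by (simp add: coord_def add.commute)
qed

lemma span_proj_f [simp]: "span_proj (f x) = f x"
  using span_proj_eq[of "f x"] by (simp add: adj_a_f M_lin[OF span_proj_M] M_lin[OF aM])

lemma span_proj_a: "span_proj (a x) = a (span_proj x)"
  using span_proj_eq[of "a x"] by (simp add: a_iso)

lemma span_proj_a': "a' (span_proj x) = span_proj (a' x)"
  by (subst span_proj_eq) (simp add: M_lin[OF a'M] adj_a_f a_iso)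

lemma span_proj_eq_0:
  assumes "p \<in> M" "\<And>n x. p ((a ^^ n) (f x)) = 0"
  shows "p (span_proj x) = 0"
proof -
  have "(\<lambda>n. p ((a ^^ n) (coord n x))) sums p (span_proj x)"
    using bounded_linear.sums[OF bounded_clinear_bounded_linear[OF M_bcl[OF assms(1)]] span_proj_sums] .
  moreover have "p ((a ^^ n) (coord n x)) = 0" for n
    using assms(2)[of n "coord n x"] by simp
  ultimately show ?thesis using sums_unique2[OF _ sums_zero] by simp
qed

end

text \<open>A pair of Cuntz isometries in the corner of \<open>p\<close>. That both live in this
  corner and have orthogonal ranges follows from the sum formula; see \<open>doubling_p_left\<close>
  and \<open>doubling_cross\<close>.\<close>

definition (in vn_algebra) doubling :: "('a \<Rightarrow> 'a) \<Rightarrow> ('a \<Rightarrow> 'a) \<Rightarrow> ('a \<Rightarrow> 'a) \<Rightarrow> bool" where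
  "doubling p \<alpha> \<beta> \<longleftrightarrow> p \<in> M \<and> projection p \<and> \<alpha> \<in> M \<and> \<beta> \<in> M \<and>
     (\<forall>x. adj \<alpha> (\<alpha> x) = p x) \<and> (\<forall>x. adj \<beta> (\<beta> x) = p x) \<and>
     (\<forall>x. \<alpha> (adj \<alpha> x) + \<beta> (adj \<beta> x) = p x)"

text \<open>Place \<open>n\<close> is sent to \<open>2 * n\<close> by one isometry and to
  \<open>2 * n + 1\<close> by the other. In the sum formula, \<open>N\<close> even and
  \<open>N\<close> odd terms make up the first \<open>2 * N\<close> terms of the full
  series.\<close>

lemma (in vn_shift) doubling_span_proj: "\<exists>\<alpha> \<beta>. doubling span_proj \<alpha> \<beta>"
proof -
  define \<alpha> where "\<alpha> = shift_op (\<lambda>n. 2 * n) (\<lambda>n. n) (\<lambda>_. 1)"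
  define \<beta> where "\<beta> = shift_op (\<lambda>n. 2 * n + 1) (\<lambda>n. n) (\<lambda>_. 1)"
  have inj: "inj (\<lambda>n::nat. 2 * n)" "inj (\<lambda>n::nat. 2 * n + 1)" by (auto simp: inj_on_def)
  have \<alpha>': "adj \<alpha> = shift_op (\<lambda>n. n) (\<lambda>n. 2 * n) (\<lambda>_. 1)"
    unfolding \<alpha>_def by (rule adj_shift_op[OF inj(1) inj_ident, of _ 1]) simp
  have \<beta>': "adj \<beta> = shift_op (\<lambda>n. n) (\<lambda>n. 2 * n + 1) (\<lambda>_. 1)"
    unfolding \<beta>_def by (rule adj_shift_op[OF inj(2) inj_ident, of _ 1]) simp
  have "\<alpha> (adj \<alpha> x) + \<beta> (adj \<beta> x) = span_proj x" for x
  proof -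
    have e: "\<alpha> (adj \<alpha> x) = shift_op (\<lambda>n. 2 * n) (\<lambda>n. 2 * n) (\<lambda>_. 1) x"
      unfolding \<alpha>' by (simp add: \<alpha>_def shift_op_compose[OF inj_ident inj(1), of _ 1])
    have o: "\<beta> (adj \<beta> x) = shift_op (\<lambda>n. 2 * n + 1) (\<lambda>n. 2 * n + 1) (\<lambda>_. 1) x"
      unfolding \<beta>' by (simp only: \<beta>_def shift_op_compose[OF inj_ident inj(2), of _ 1]) simp
    let ?g = "\<lambda>n. (a ^^ n) (coord n x)"
    have "(\<lambda>N. (\<Sum>n<N. ?g (2 * n)) + (\<Sum>n<N. ?g (2 * n + 1))) \<longlonglongrightarrow> \<alpha> (adj \<alpha> x) + \<beta> (adj \<beta> x)"
      unfolding e o using shift_op_lim[OF inj(1) inj(1), of "\<lambda>_. 1" 1 x] shift_op_lim[OF inj(2) inj(2), of "\<lambda>_. 1" 1 x]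
      by (intro tendsto_add) simp_all
    moreover have "(\<Sum>n<N. ?g (2 * n)) + (\<Sum>n<N. ?g (2 * n + 1)) = (\<Sum>n<2 * N. ?g n)" for N
      by (induction N) (simp_all add: algebra_simps)
    moreover have "(\<lambda>N. \<Sum>n<2 * N. ?g n) \<longlonglongrightarrow> span_proj x"
      using span_proj_sums[of x] unfolding sums_def
      by (rule filterlim_compose) (auto simp: filterlim_subseq strict_mono_def)
    ultimately show ?thesis by (simp only:) (rule LIMSEQ_unique)
  qed
  moreover have "adj \<alpha> (\<alpha> x) = span_proj x" "adj \<beta> (\<beta> x) = span_proj x" for x
    unfolding \<alpha>' \<beta>' unfolding \<alpha>_def \<beta>_def span_proj_def
    using shift_op_compose[OF inj(1) inj_ident, of "\<lambda>_. 1" 1 "\<lambda>n. n"]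
      shift_op_compose[OF inj(2) inj_ident, of "\<lambda>_. 1" 1 "\<lambda>n. n"] by simp_all
  moreover have "\<alpha> \<in> M" "\<beta> \<in> M"
    unfolding \<alpha>_def \<beta>_def using shift_op_M[OF inj(1) inj_ident, of _ 1] shift_op_M[OF inj(2) inj_ident, of _ 1] by simp_all
  ultimately show ?thesis
    using span_proj_M projection_span_proj unfolding doubling_def by blast
qed

text \<open>With \<open>f = 1 - q\<close> and \<open>r\<close> the projection to the span of all
  copies of \<open>f\<close> under \<open>a\<close>, let \<open>y\<close> act as \<open>a\<close> on
  the range of \<open>r\<close> and as the identity beside it. By \<open>span_proj_eq\<close> the
  range loses exactly \<open>f\<close>.\<close>

lemma (in vn_algebra) Schroeder_Bernstein_isometry:
  assumes aM: "a \<in> M" and a: "\<And>x. adj a (a x) = x"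
    and q: "q \<in> M" "projection q" and qa: "\<And>x. q (a x) = a x"
  obtains y where "y \<in> M" "\<And>x. adj y (y x) = x" "\<And>x. y (adj y x) = q x"
proof -
  define f where "f x = x - q x" for x
  have qq: "q (q x) = q x" for x using q by (simp add: projection_iff)
  have fM: "f \<in> M" unfolding f_def by (rule M_diff[OF M_id q(1)])
  have "adj f = f" unfolding f_def using adj_diff[OF M_id q(1)] adj_projection[OF q(2)] by (simp add: adj_id)
  then have fp: "projection f"
    by (simp add: projection_iff_adj[OF fM]) (simp add: f_def M_lin[OF q(1)] qq)
  have "adj a (f x) = 0" for x
  proof (rule cinner_ext_left)
    fix z
    have "cinner z (adj a (f x)) = cinner (q (a z)) (f x)" by (simp add: qa cinner_adj[OF aM])
    also have "\<dots> = cinner (a z) (q (f x))" using q(2) by (simp add: projection_iff)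
    finally show "cinner z (adj a (f x)) = cinner z 0" by (simp add: f_def M_lin[OF q(1)] qq)
  qed
  then interpret vn_shift M a f
    by unfold_locales (use aM a fM fp in auto)
  let ?r = span_proj
  define y where "y x = a (?r x) + (x - ?r x)" for x
  have rM: "?r \<in> M" and r_adj: "adj ?r = ?r" and rr: "?r (?r x) = ?r x" for x
    using span_proj_M projection_span_proj by (auto simp: adj_projection projection_iff)
  have arM: "(\<lambda>x. a (?r x)) \<in> M" by (rule M_compose[OF aM rM])
  have yM: "y \<in> M" unfolding y_def by (rule M_add[OF arM M_diff[OF M_id rM]])
  have y': "adj y x = ?r (adj a x) + (x - ?r x)" for x
    unfolding y_def
    by (simp add: adj_add[OF arM M_diff[OF M_id rM]] adj_diff[OF M_id rM] adj_id r_adj adj_compose[OF aM rM])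
  note lin = M_lin[OF aM] M_lin[OF a'M] M_lin[OF rM] M_lin[OF q(1)]
  have "adj y (y x) = x" for x
    unfolding y' unfolding y_def by (simp add: lin a span_proj_a span_proj_a' rr)
  moreover have "y (adj y x) = q x" for x
  proof -
    have "y (adj y x) = a (?r (adj a x)) + (x - ?r x)"
      unfolding y' unfolding y_def by (simp add: lin rr span_proj_a)
    also have "\<dots> = q x" by (subst (2) span_proj_eq) (simp add: f_def)
    finally show ?thesis .
  qed
  ultimately show thesis using that yM by blast
qed


section \<open>Isometric relations\<close>

lemma closure_seq: "t \<in> closure X \<longleftrightarrow> (\<exists>x y w. (\<forall>n. (x n, y n, w n) \<in> X) \<and>
    x \<longlonglongrightarrow> fst t \<and> y \<longlonglongrightarrow> fst (snd t) \<and> w \<longlonglongrightarrow> snd (snd t))"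
  for t :: "'a::first_countable_topology \<times> 'b::first_countable_topology \<times> 'c::first_countable_topology"
proof
  assume "t \<in> closure X"
  then obtain s where "\<forall>n. s n \<in> X" "s \<longlonglongrightarrow> t" by (auto simp: closure_sequential)
  then show "\<exists>x y w. (\<forall>n. (x n, y n, w n) \<in> X) \<and> x \<longlonglongrightarrow> fst t \<and> y \<longlonglongrightarrow> fst (snd t) \<and> w \<longlonglongrightarrow> snd (snd t)"
    by (intro exI[of _ "\<lambda>n. fst (s n)"] exI[of _ "\<lambda>n. fst (snd (s n))"] exI[of _ "\<lambda>n. snd (snd (s n))"])
      (auto intro!: tendsto_fst tendsto_snd)
next
  assume "\<exists>x y w. (\<forall>n. (x n, y n, w n) \<in> X) \<and> x \<longlonglongrightarrow> fst t \<and> y \<longlonglongrightarrow> fst (snd t) \<and> w \<longlonglongrightarrow> snd (snd t)"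
  then obtain x y w where *: "\<forall>n. (x n, y n, w n) \<in> X" "x \<longlonglongrightarrow> fst t" "y \<longlonglongrightarrow> fst (snd t)" "w \<longlonglongrightarrow> snd (snd t)"
    by blast
  have "(\<lambda>n. (x n, y n, w n)) \<longlonglongrightarrow> (fst t, fst (snd t), snd (snd t))"
    by (intro tendsto_Pair *)
  then show "t \<in> closure X" using *(1) unfolding closure_sequential
    by (intro exI[of _ "\<lambda>n. (x n, y n, w n)"]) simp
qed

lemma closure_seqE:
  assumes "(x, y, w) \<in> closure (X :: ('a::first_countable_topology \<times> 'b::first_countable_topology \<times> 'c::first_countable_topology) set)"
  obtains s t r where "\<And>n. (s n, t n, r n) \<in> X" "s \<longlonglongrightarrow> x" "t \<longlonglongrightarrow> y" "r \<longlonglongrightarrow> w"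
  using assms unfolding closure_seq by auto

context vn_algebra
begin

text \<open>A triple \<open>(x, y, w)\<close> stands for the value \<open>w\<close> of a partially defined isometry at
  \<open>(x, y) \<in> H \<oplus> H\<close>. Working with graphs makes Zorn's lemma applicable to partial isometries.\<close>

definition isometric_rel :: "('a \<times> 'a \<times> 'a) set \<Rightarrow> bool" where
  "isometric_rel X \<longleftrightarrow> (0, 0, 0) \<in> X \<and>
     (\<forall>x y w x' y' w'. (x, y, w) \<in> X \<longrightarrow> (x', y', w') \<in> X \<longrightarrow> (x + x', y + y', w + w') \<in> X) \<and>
     (\<forall>c x y w. (x, y, w) \<in> X \<longrightarrow> (c *\<^sub>C x, c *\<^sub>C y, c *\<^sub>C w) \<in> X) \<and>
     (\<forall>g\<in>M'. \<forall>x y w. (x, y, w) \<in> X \<longrightarrow> (g x, g y, g w) \<in> X) \<and>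
     (\<forall>x y w. (x, y, w) \<in> X \<longrightarrow> (norm w)\<^sup>2 = (norm x)\<^sup>2 + (norm y)\<^sup>2)"

lemma
  assumes "isometric_rel X"
  shows isometric_rel_zero: "(0, 0, 0) \<in> X"
    and isometric_rel_add: "(x, y, w) \<in> X \<Longrightarrow> (x', y', w') \<in> X \<Longrightarrow> (x + x', y + y', w + w') \<in> X"
    and isometric_rel_scaleC: "(x, y, w) \<in> X \<Longrightarrow> (c *\<^sub>C x, c *\<^sub>C y, c *\<^sub>C w) \<in> X"
    and isometric_rel_M': "g \<in> M' \<Longrightarrow> (x, y, w) \<in> X \<Longrightarrow> (g x, g y, g w) \<in> X"
    and isometric_rel_norm: "(x, y, w) \<in> X \<Longrightarrow> (norm w)\<^sup>2 = (norm x)\<^sup>2 + (norm y)\<^sup>2"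
  using assms unfolding isometric_rel_def by blast+

lemma isometric_rel_diff:
  assumes "isometric_rel X" "(x, y, w) \<in> X" "(x', y', w') \<in> X"
  shows "(x - x', y - y', w - w') \<in> X"
proof -
  have "(-1) *\<^sub>C u = - u" for u :: 'a using scaleR_scaleC[of "-1" u] by simp
  then show ?thesis
    using isometric_rel_add[OF assms(1,2) isometric_rel_scaleC[OF assms(1,3), of "-1"]] by simp
qed

lemma isometric_rel_unique:
  assumes "isometric_rel X" "(x, y, w) \<in> X" "(x, y, w') \<in> X"
  shows "w = w'"
  using isometric_rel_norm[OF assms(1) isometric_rel_diff[OF assms]] by simp

lemma isometric_rel_closure:
  assumes X: "isometric_rel X"
  shows "isometric_rel (closure X)"
  unfolding isometric_rel_def
proof (intro conjI allI impI ballI)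
  show "(0, 0, 0) \<in> closure X" using isometric_rel_zero[OF X] closure_subset by blast
next
  fix x y w x' y' w' assume "(x, y, w) \<in> closure X" "(x', y', w') \<in> closure X"
  moreover obtain s t r where "\<And>n. (s n, t n, r n) \<in> X" "s \<longlonglongrightarrow> x" "t \<longlonglongrightarrow> y" "r \<longlonglongrightarrow> w"
    using calculation(1) by (rule closure_seqE) (rule that)
  moreover obtain s' t' r' where "\<And>n. (s' n, t' n, r' n) \<in> X" "s' \<longlonglongrightarrow> x'" "t' \<longlonglongrightarrow> y'" "r' \<longlonglongrightarrow> w'"
    using calculation(2) by (rule closure_seqE) (rule that)
  ultimately show "(x + x', y + y', w + w') \<in> closure X"
    unfolding closure_seq
    by (intro exI[of _ "\<lambda>n. s n + s' n"] exI[of _ "\<lambda>n. t n + t' n"] exI[of _ "\<lambda>n. r n + r' n"])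
      (auto intro!: tendsto_add isometric_rel_add[OF X])
next
  fix c x y w assume "(x, y, w) \<in> closure X"
  then obtain s t r where s: "\<And>n. (s n, t n, r n) \<in> X" "s \<longlonglongrightarrow> x" "t \<longlonglongrightarrow> y" "r \<longlonglongrightarrow> w"
    by (rule closure_seqE) (rule that)
  then show "(c *\<^sub>C x, c *\<^sub>C y, c *\<^sub>C w) \<in> closure X"
    unfolding closure_seq
    by (intro exI[of _ "\<lambda>n. c *\<^sub>C s n"] exI[of _ "\<lambda>n. c *\<^sub>C t n"] exI[of _ "\<lambda>n. c *\<^sub>C r n"])
      (auto intro!: tendsto_scaleC isometric_rel_scaleC[OF X])
next
  fix g x y w assume g: "g \<in> M'" and "(x, y, w) \<in> closure X"
  from this(2) obtain s t r where s: "\<And>n. (s n, t n, r n) \<in> X" "s \<longlonglongrightarrow> x" "t \<longlonglongrightarrow> y" "r \<longlonglongrightarrow> w"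
    by (rule closure_seqE) (rule that)
  then show "(g x, g y, g w) \<in> closure X"
    unfolding closure_seq
    by (intro exI[of _ "\<lambda>n. g (s n)"] exI[of _ "\<lambda>n. g (t n)"] exI[of _ "\<lambda>n. g (r n)"])
      (auto intro!: bounded_clinear_tendsto[OF M'_bcl[OF g]] isometric_rel_M'[OF X g])
next
  fix x y w assume "(x, y, w) \<in> closure X"
  then obtain s t r where s: "\<And>n. (s n, t n, r n) \<in> X" "s \<longlonglongrightarrow> x" "t \<longlonglongrightarrow> y" "r \<longlonglongrightarrow> w"
    by (rule closure_seqE) (rule that)
  have "(\<lambda>n. (norm (r n))\<^sup>2) \<longlonglongrightarrow> (norm w)\<^sup>2" by (intro tendsto_intros s)
  moreover have "(\<lambda>n. (norm (s n))\<^sup>2 + (norm (t n))\<^sup>2) \<longlonglongrightarrow> (norm x)\<^sup>2 + (norm y)\<^sup>2" by (intro tendsto_intros s)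
  ultimately show "(norm w)\<^sup>2 = (norm x)\<^sup>2 + (norm y)\<^sup>2"
    using isometric_rel_norm[OF X s(1)] by (simp add: LIMSEQ_unique)
qed

lemma isometric_rel_Union_chain:
  assumes C: "\<And>X. X \<in> C \<Longrightarrow> isometric_rel X" and ne: "C \<noteq> {}"
    and chain: "\<And>X Y. X \<in> C \<Longrightarrow> Y \<in> C \<Longrightarrow> X \<subseteq> Y \<or> Y \<subseteq> X"
  shows "isometric_rel (\<Union>C)"
proof -
  have pair: "\<exists>Z\<in>C. s \<in> Z \<and> t \<in> Z" if "s \<in> \<Union>C" "t \<in> \<Union>C" for s t
    using that chain by blast
  show ?thesis
    unfolding isometric_rel_def
  proof (intro conjI allI impI ballI)
    show "(0, 0, 0) \<in> \<Union>C" using ne C isometric_rel_zero by blast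
  next
    fix x y w x' y' w' assume "(x, y, w) \<in> \<Union>C" "(x', y', w') \<in> \<Union>C"
    then obtain Z where "Z \<in> C" "(x, y, w) \<in> Z" "(x', y', w') \<in> Z" using pair by blast
    then show "(x + x', y + y', w + w') \<in> \<Union>C" using C isometric_rel_add by blast
  next
    fix c x y w assume "(x, y, w) \<in> \<Union>C"
    then show "(c *\<^sub>C x, c *\<^sub>C y, c *\<^sub>C w) \<in> \<Union>C" using C isometric_rel_scaleC by blast
  next
    fix g x y w assume "g \<in> M'" "(x, y, w) \<in> \<Union>C"
    then show "(g x, g y, g w) \<in> \<Union>C" using C isometric_rel_M' by blast
  next
    fix x y w assume "(x, y, w) \<in> \<Union>C"
    then show "(norm w)\<^sup>2 = (norm x)\<^sup>2 + (norm y)\<^sup>2" using C isometric_rel_norm by blast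
  qed
qed

text \<open>An isometry reflects Cauchy sequences, so limits of values come from limits of
  arguments.\<close>

lemma isometric_rel_preimage_limit:
  assumes X: "isometric_rel X" and s: "\<And>n. (s n, t n, r n) \<in> X" and r: "r \<longlonglongrightarrow> w"
  obtains x y where "s \<longlonglongrightarrow> x" "t \<longlonglongrightarrow> y"
proof -
  have le: "norm (s m - s n) \<le> norm (r m - r n)" "norm (t m - t n) \<le> norm (r m - r n)" for m n
    by (rule power2_le_imp_le; use isometric_rel_norm[OF X isometric_rel_diff[OF X s[of m] s[of n]]] in simp)+
  have "Cauchy r" using r by (rule LIMSEQ_imp_Cauchy)
  then have "Cauchy s" "Cauchy t"
    unfolding Cauchy_def dist_norm using le by (meson le_less_trans)+
  then show thesis using that by (metis Cauchy_convergent_iff convergent_def)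
qed

text \<open>The slice \<open>y = 0\<close> is an isometry on a closed \<open>M'\<close>-invariant
  subspace \<open>D\<close>. Extended by 0 along the projection to \<open>D\<close>, it becomes a
  partial isometry that commutes with \<open>M'\<close>.\<close>

lemma isometric_rel_operator:
  assumes X: "isometric_rel X" and clX: "closed X"
  obtains d v where "d \<in> M" "projection d" "range d = {x. \<exists>w. (x, 0, w) \<in> X}" "v \<in> M"
    "\<And>x. (d x, 0, v x) \<in> X" "\<And>x. adj v (v x) = d x"
proof -
  define D where "D = {x. \<exists>w. (x, 0, w) \<in> X}"
  have "closed D"
    unfolding closed_sequential_limits
  proof (intro allI impI, elim conjE)
    fix x l assume x: "\<forall>n. x n \<in> D" "x \<longlonglongrightarrow> l"
    then obtain w where w: "\<And>n. (x n, 0, w n) \<in> X"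
      unfolding D_def mem_Collect_eq by metis
    have "norm (w m - w n) = norm (x m - x n)" for m n
      using isometric_rel_norm[OF X isometric_rel_diff[OF X w[of m] w[of n]]]
      by (simp add: power2_eq_iff_nonneg)
    then have "Cauchy w" using LIMSEQ_imp_Cauchy[OF x(2)] unfolding Cauchy_def dist_norm by simp
    then obtain u where u: "w \<longlonglongrightarrow> u" by (auto simp: Cauchy_convergent_iff convergent_def)
    have "(l, 0, u) \<in> closure X"
      unfolding closure_seq using w x(2) u by (intro exI[of _ x] exI[of _ "\<lambda>_. 0"] exI[of _ w]) auto
    then show "l \<in> D" using clX by (auto simp: D_def)
  qed
  then have "closed_csubspace D"
    unfolding closed_csubspace_def D_def
    using isometric_rel_zero[OF X] isometric_rel_add[OF X, of _ 0 _ _ 0] isometric_rel_scaleC[OF X, of _ 0]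
    by auto blast+
  moreover have "g x \<in> D" if "g \<in> M'" "x \<in> D" for g x
    using isometric_rel_M'[OF X that(1), of x 0] that by (auto simp: D_def M'_lin)
  ultimately obtain d where d: "d \<in> M" "projection d" "range d = D"
    using projection_in_M by metis
  have "\<exists>w. (d x, 0, w) \<in> X" for x using d(3) unfolding D_def by blast
  then obtain v where v: "\<And>x. (d x, 0, v x) \<in> X" by metis
  have nv: "norm (v x) = norm (d x)" for x
    using isometric_rel_norm[OF X v[of x]] by (simp add: power2_eq_iff_nonneg)
  obtain K where K: "\<And>x. norm (d x) \<le> norm x * K"
    using bounded_linear.bounded[OF bounded_clinear_bounded_linear[OF M_bcl[OF d(1)]]] by blast
  have "bounded_clinear v"
  proof (rule bounded_clinearI[of _ K])
    show "v (x + y) = v x + v y" for x y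
      using isometric_rel_unique[OF X v[of "x + y"]] isometric_rel_add[OF X v[of x] v[of y]]
      by (simp add: M_lin[OF d(1)])
    show "v (c *\<^sub>C x) = c *\<^sub>C v x" for c x
      using isometric_rel_unique[OF X v[of "c *\<^sub>C x"]] isometric_rel_scaleC[OF X v[of x], of c]
      by (simp add: M_lin[OF d(1)])
    show "norm (v x) \<le> K * norm x" for x using K[of x] by (simp add: nv mult.commute)
  qed
  moreover have "v (g x) = g (v x)" if g: "g \<in> M'" for g x
    using isometric_rel_unique[OF X v[of "g x"]] isometric_rel_M'[OF X g v[of x]]
    by (simp add: M_commute[OF d(1) g] M'_lin[OF g])
  ultimately have vM: "v \<in> M" by (simp add: in_M_iff)
  have "adj v (v x) = d x" for x
    using adj_adj_compose_eqI[OF vM d(1) nv] d(2) by (simp add: adj_projection projection_iff)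
  then show thesis using that d vM v unfolding D_def by blast
qed

subsection \<open>Comparison of projections\<close>

text \<open>\<open>v\<close> is a maximal partial isometry from a part of \<open>g\<close> to a part
  of \<open>p\<close>. The last conclusion says that no element of \<open>M\<close> connects the two
  leftovers: \<open>(p - v (adj v)) m (g - (adj v) v) = 0\<close>. Otherwise the polar part of such
  a corner element would extend \<open>v\<close>.\<close>

lemma comparison:
  assumes g: "g \<in> M" "projection g" and p: "p \<in> M" "projection p"
  obtains v where "v \<in> M" "\<And>x. v (adj v (v x)) = v x" "\<And>x. v (g x) = v x" "\<And>x. p (v x) = v x"
    "\<And>m x. m \<in> M \<Longrightarrow> p (m (g x - adj v (v x))) = v (adj v (m (g x - adj v (v x))))"
proof -
  \<comment> \<open>Freezing the second argument at 0 leaves the graphs of isometries from subspaces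
    of \<open>range g\<close> into \<open>range p\<close>.\<close>
  define A where "A = {X. isometric_rel X \<and> closed X \<and> (\<forall>x y w. (x, y, w) \<in> X \<longrightarrow> g x = x \<and> y = 0 \<and> p w = w)}"
  have side: "g x = x \<and> y = 0 \<and> p w = w"
    if X: "\<And>x y w. (x, y, w) \<in> X \<Longrightarrow> g x = x \<and> y = 0 \<and> p w = w" and c: "(x, y, w) \<in> closure X" for X :: "('a \<times> 'a \<times> 'a) set" and x y w
  proof -
    obtain s t r where s: "\<And>n. (s n, t n, r n) \<in> X" "s \<longlonglongrightarrow> x" "t \<longlonglongrightarrow> y" "r \<longlonglongrightarrow> w"
      using c by (rule closure_seqE) (rule that)
    have *: "g (s n) = s n" "t n = 0" "p (r n) = r n" for n using X[OF s(1)] by auto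
    have "g x = x"
      using LIMSEQ_unique[OF bounded_clinear_tendsto[OF M_bcl[OF g(1)] s(2)]] s(2) unfolding * .
    moreover have "p w = w"
      using LIMSEQ_unique[OF bounded_clinear_tendsto[OF M_bcl[OF p(1)] s(4)]] s(4) unfolding * .
    moreover have "y = 0" using LIMSEQ_unique[OF s(3)] unfolding * by simp
    ultimately show ?thesis by simp
  qed
  have closure_A: "closure X \<in> A"
    if "isometric_rel X" "\<And>x y w. (x, y, w) \<in> X \<Longrightarrow> g x = x \<and> y = 0 \<and> p w = w" for X
    unfolding A_def mem_Collect_eq
    by (intro conjI allI impI isometric_rel_closure that(1) closed_closure)
      (use side[OF that(2)] in auto)
  have "\<exists>X\<in>A. \<forall>Y\<in>A. X \<subseteq> Y \<longrightarrow> Y = X"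
  proof (rule subset_Zorn)
    fix C assume C: "subset.chain A C"
    show "\<exists>U\<in>A. \<forall>X\<in>C. X \<subseteq> U"
    proof (cases "C = {}")
      case True
      have "isometric_rel {(0, 0, 0)}" unfolding isometric_rel_def using M'_lin(6) by simp
      then have "closure {(0, 0, 0)} \<in> A"
        by (rule closure_A) (simp add: M_lin[OF g(1)] M_lin[OF p(1)])
      then show ?thesis by (rule bexI[rotated]) (simp add: True)
    next
      case False
      have CA: "C \<subseteq> A" and ch: "\<And>X Y. X \<in> C \<Longrightarrow> Y \<in> C \<Longrightarrow> X \<subseteq> Y \<or> Y \<subseteq> X"
        using C by (auto simp: subset_chain_def)
      have CX: "isometric_rel X" if "X \<in> C" for X using subsetD[OF CA that] by (simp add: A_def)
      have "isometric_rel (\<Union>C)" by (rule isometric_rel_Union_chain[OF CX False ch])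
      moreover have "g x = x \<and> y = 0 \<and> p w = w" if xyw: "(x, y, w) \<in> \<Union>C" for x y w
      proof -
        obtain Z where "Z \<in> C" "(x, y, w) \<in> Z" using xyw by blast
        moreover have "Z \<in> A" using CA \<open>Z \<in> C\<close> by (rule subsetD)
        ultimately show ?thesis by (simp add: A_def)
      qed
      ultimately have "closure (\<Union>C) \<in> A" by (intro closure_A)
      moreover have "X \<subseteq> closure (\<Union>C)" if "X \<in> C" for X
        using Union_upper[OF that] closure_subset by (rule order_trans)
      ultimately show ?thesis by (intro bexI[of _ "closure (\<Union>C)"]) auto
    qed
  qed
  then obtain X where XA: "X \<in> A" and max: "\<forall>Y\<in>A. X \<subseteq> Y \<longrightarrow> Y = X" by (rule bexE)
  have X: "isometric_rel X" "closed X" and Xside: "\<And>x y w. (x, y, w) \<in> X \<Longrightarrow> g x = x \<and> y = 0 \<and> p w = w"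
    using XA unfolding A_def mem_Collect_eq by simp_all
  obtain d v where d: "d \<in> M" "projection d" "range d = {x. \<exists>w. (x, 0, w) \<in> X}" and vM: "v \<in> M"
    and v: "\<And>x. (d x, 0, v x) \<in> X" and v'v: "\<And>x. adj v (v x) = d x"
    by (rule isometric_rel_operator[OF X]) (rule that)
  have v'M: "adj v \<in> M" using vM by (rule M_adj)
  have dd: "d (d x) = d x" and gs: "cinner (g x) y = cinner x (g y)"
    and ds: "cinner (d x) y = cinner x (d y)" and ps: "cinner (p x) y = cinner x (p y)" for x y
    using d(2) g(2) p(2) by (simp_all add: projection_iff)
  have X_d: "d x = x" if "(x, 0, w) \<in> X" for x w
  proof -
    have "x \<in> range d" unfolding d(3) using that by (intro CollectI exI)
    then show ?thesis using projection_fixes[OF d(2)] by simp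
  qed
  have gd: "g (d x) = d x" and pv: "p (v x) = v x" for x using Xside[OF v[of x]] by auto
  have vd: "v (d x) = v x" for x
  proof -
    have "v (x - d x) = 0"
      by (rule adj_compose_eq_0[OF vM]) (simp add: v'v M_lin[OF d(1)] dd)
    then show ?thesis by (simp add: M_lin[OF vM])
  qed
  have dg: "d (g x) = d x" for x
  proof (rule cinner_ext_left)
    show "cinner z (d (g x)) = cinner z (d x)" for z
      using ds[of z "g x"] gs[of "d z" x] ds[of z x] gd[of z] by simp
  qed
  have vg: "v (g x) = v x" for x using vd[of "g x"] vd[of x] dg by simp
  have v'p: "adj v (p x) = adj v x" for x
  proof (rule cinner_ext_left)
    show "cinner z (adj v (p x)) = cinner z (adj v x)" for z
      using cinner_adj[OF vM, of z "p x"] cinner_adj[OF vM, of z x] ps[of "v z" x] pv[of z] by simp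
  qed
  have v'v'v: "adj v (v (adj v x)) = adj v x" for x
  proof (rule cinner_ext_left)
    show "cinner z (adj v (v (adj v x))) = cinner z (adj v x)" for z
      using cinner_adj[OF vM, of "d z" x] cinner_adj[OF vM, of z x] ds[of z "adj v x"]
      by (simp only: v'v vd)
  qed
  have vv'v: "v (adj v (v x)) = v x" for x using v'v vd by simp
  have "p (m (g x - d x)) = v (adj v (m (g x - d x)))" if m: "m \<in> M" for m x
  proof -
    note lin = M_lin[OF g(1)] M_lin[OF d(1)] M_lin[OF p(1)] M_lin[OF vM] M_lin[OF v'M] M_lin[OF m]
    have gg: "g (g x) = g x" and pp: "p (p x) = p x" for x using g p by (auto simp: projection_iff)
    \<comment> \<open>The corner element that connects the leftovers of \<open>g\<close> and
      \<open>p\<close>; it is scaled to a contraction \<open>c\<close> so that a square root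
      \<open>h\<close> is available.\<close>
    define b where "b x = p (m (g x - d x)) - v (adj v (m (g x - d x)))" for x
    have gdM: "(\<lambda>x. g x - d x) \<in> M" by (rule M_diff[OF g(1) d(1)])
    have mgM: "(\<lambda>x. m (g x - d x)) \<in> M" by (rule M_compose[OF m gdM])
    have bM: "b \<in> M" unfolding b_def
      by (rule M_diff[OF M_compose[OF p(1) mgM] M_compose[OF vM M_compose[OF v'M mgM]]])
    obtain K where K: "K > 0" "\<And>x. norm (b x) \<le> norm x * K"
      using bounded_linear.pos_bounded[OF bounded_clinear_bounded_linear[OF M_bcl[OF bM]]] by blast
    define c where "c x = (1 / K) *\<^sub>R b x" for x
    have cM: "c \<in> M" unfolding c_def by (rule M_scaleR[OF bM])
    have c1: "norm (c x) \<le> norm x" for x using K by (simp add: c_def field_simps)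
    obtain h where hM: "h \<in> M" and hadj: "adj h = h" and hh: "\<And>u. h (h u) = adj c (c u)"
      using M_contraction_sqrt[OF cM c1] by metis
    have cgd: "c (g x - d x) = c x" for x by (simp add: c_def b_def lin gg gd dg dd)
    have nh: "norm (h x) = norm (c x)" for x
    proof -
      have "complex_of_real ((norm (h x))\<^sup>2) = complex_of_real ((norm (c x))\<^sup>2)"
        unfolding norm_square_adj[OF hM] norm_square_adj[OF cM] hadj hh ..
      then have "(norm (h x))\<^sup>2 = (norm (c x))\<^sup>2" using of_real_eq_iff by blast
      then show ?thesis by (simp add: power2_eq_iff_nonneg)
    qed
    have hgd: "h (g x - d x) = h x" for x
    proof -
      have "c (x - (g x - d x)) = 0" using cgd[of x] by (simp add: M_lin[OF cM])
      then have "h (x - (g x - d x)) = 0" using nh by (metis norm_eq_zero)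
      then show ?thesis by (simp add: M_lin[OF hM])
    qed
    have gdh: "g (h x) - d (h x) = h x" for x
    proof (rule cinner_ext_left)
      fix z
      have "cinner z (g (h x) - d (h x)) = cinner (h (g z - d z)) x"
        by (simp add: cinner_simps gs ds cinner_adj[OF hM] hadj)
      then show "cinner z (g (h x) - d (h x)) = cinner z (h x)"
        by (simp add: hgd cinner_adj[OF hM] hadj)
    qed
    have dh: "d (h x) = 0" for x
      using arg_cong[OF gdh[of x], of d] by (simp add: lin dg dd)
    have gh: "g (h x) = h x" for x using gdh[of x] dh by simp
    have pc: "p (c x) = c x" for x by (simp add: c_def b_def lin pp pv)
    have v'c: "adj v (c x) = 0" for x by (simp add: c_def b_def lin v'p v'v'v)
    \<comment> \<open>Here \<open>h\<close> plays the role of the modulus of \<open>c\<close>: as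
      \<open>h u\<close> and \<open>c u\<close> have equal norms, \<open>h u \<mapsto> c u\<close>
      is the polar part of \<open>c\<close>. It is orthogonal to \<open>X\<close> in the arguments
      by \<open>d h = 0\<close> and in the values by \<open>(adj v) c = 0\<close>.\<close>
    define Y where "Y = {(x + h u, 0::'a, w + c u) | x w u. (x, 0, w) \<in> X}"
    have YI: "(x + h u, 0, w + c u) \<in> Y" if "(x, 0, w) \<in> X" for x w u using that Y_def by blast
    have "isometric_rel Y"
      unfolding isometric_rel_def
    proof (intro conjI allI impI ballI)
      show "(0, 0, 0) \<in> Y" using YI[OF isometric_rel_zero[OF X(1)], of 0] by (simp add: M_lin[OF hM] M_lin[OF cM])
    next
      fix x y w x' y' w' assume "(x, y, w) \<in> Y" "(x', y', w') \<in> Y"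
      then obtain r s u r' s' u' where *: "x = r + h u" "y = 0" "w = s + c u" "(r, 0, s) \<in> X"
        "x' = r' + h u'" "y' = 0" "w' = s' + c u'" "(r', 0, s') \<in> X" unfolding Y_def by blast
      show "(x + x', y + y', w + w') \<in> Y"
        using YI[of "r + r'" "s + s'" "u + u'"] isometric_rel_add[OF X(1) *(4,8)]
        by (simp add: * M_lin[OF hM] M_lin[OF cM] algebra_simps)
    next
      fix k x y w assume "(x, y, w) \<in> Y"
      then obtain r s u where *: "x = r + h u" "y = 0" "w = s + c u" "(r, 0, s) \<in> X" unfolding Y_def by blast
      show "(k *\<^sub>C x, k *\<^sub>C y, k *\<^sub>C w) \<in> Y"
        using YI[of "k *\<^sub>C r" "k *\<^sub>C s" "k *\<^sub>C u"] isometric_rel_scaleC[OF X(1) *(4), of k]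
        by (simp add: * M_lin[OF hM] M_lin[OF cM] scaleC_add_right)
    next
      fix k x y w assume k: "k \<in> M'" and "(x, y, w) \<in> Y"
      then obtain r s u where *: "x = r + h u" "y = 0" "w = s + c u" "(r, 0, s) \<in> X" unfolding Y_def by blast
      show "(k x, k y, k w) \<in> Y"
        using YI[of "k r" "k s" "k u"] isometric_rel_M'[OF X(1) k *(4)]
        by (simp add: * M'_lin[OF k] M_commute[OF hM k] M_commute[OF cM k])
    next
      fix x y w assume "(x, y, w) \<in> Y"
      then obtain r s u where *: "x = r + h u" "y = 0" "w = s + c u" "(r, 0, s) \<in> X" unfolding Y_def by blast
      have "d r = r" using *(4) X_d by simp
      then have "v r = s" using isometric_rel_unique[OF X(1) _ *(4)] v[of r] by simp
      have "cinner r (h u) = 0"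
        using \<open>d r = r\<close> ds[of r "h u"] dh by simp
      moreover have "cinner s (c u) = 0"
        using cinner_adj[OF vM, of r "c u"] v'c \<open>v r = s\<close> by simp
      ultimately show "(norm w)\<^sup>2 = (norm x)\<^sup>2 + (norm y)\<^sup>2"
        using isometric_rel_norm[OF X(1) *(4)] by (simp add: * norm_add_square nh)
    qed
    moreover have "g x = x \<and> y = 0 \<and> p w = w" if "(x, y, w) \<in> Y" for x y w
      using that Xside unfolding Y_def by (auto simp: lin gh pc)
    ultimately have "closure Y \<in> A" by (intro closure_A)
    moreover have "X \<subseteq> Y"
    proof
      fix t assume t: "t \<in> X"
      obtain x y w where [simp]: "t = (x, y, w)" by (rule prod_cases3)
      have "y = 0" using Xside t by simp
      then show "t \<in> Y" using YI[of x w 0] t by (simp add: M_lin[OF hM] M_lin[OF cM])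
    qed
    \<comment> \<open>Maximality puts every \<open>h x\<close> into the range of \<open>d\<close>,
      while \<open>d h = 0\<close>; hence \<open>h\<close>, \<open>c\<close> and \<open>b\<close>
      vanish.\<close>
    ultimately have "closure Y = X" using max closure_subset[of Y] by (meson order_trans)
    then have "(h x, 0, c x) \<in> X"
      using YI[OF isometric_rel_zero[OF X(1)], of x] closure_subset[of Y] by auto
    then have "d (h x) = h x" by (rule X_d)
    then have "c x = 0" using dh nh by (metis norm_eq_zero)
    then show ?thesis using K(1) by (simp add: c_def b_def)
  qed
  then show thesis using that[OF vM vv'v vg pv] v'v by simp
qed

end


section \<open>Doublings\<close>

context vn_algebra
begin

lemma
  assumes "doubling p \<alpha> \<beta>"
  shows doubling_M: "p \<in> M" "\<alpha> \<in> M" "\<beta> \<in> M"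
    and doubling_projection: "projection p"
    and doubling_idem: "p (p x) = p x"
    and doubling_adj_p: "adj p = p"
    and doubling_iso: "adj \<alpha> (\<alpha> x) = p x" "adj \<beta> (\<beta> x) = p x"
    and doubling_sum: "\<alpha> (adj \<alpha> x) + \<beta> (adj \<beta> x) = p x"
  using assms unfolding doubling_def by (auto simp: adj_projection projection_iff)

lemma doubling_commute: "doubling p \<alpha> \<beta> \<Longrightarrow> doubling p \<beta> \<alpha>"
  unfolding doubling_def by (simp add: add.commute)

lemma doubling_p_right:
  assumes d: "doubling p \<alpha> \<beta>"
  shows "\<alpha> (p x) = \<alpha> x"
proof -
  have "\<alpha> (x - p x) = 0"
    by (rule adj_compose_eq_0[OF doubling_M(2)[OF d]])
      (simp add: doubling_iso[OF d] doubling_idem[OF d] M_lin[OF doubling_M(1)[OF d]])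
  then show ?thesis by (simp add: M_lin[OF doubling_M(2)[OF d]])
qed

lemma doubling_adj_p_right:
  assumes d: "doubling p \<alpha> \<beta>"
  shows "adj \<alpha> (p x) = adj \<alpha> x"
proof -
  note M = doubling_M[OF d]
  define z where "z = x - p x"
  have "\<alpha> (adj \<alpha> z) + \<beta> (adj \<beta> z) = 0"
    by (simp add: doubling_sum[OF d] z_def M_lin[OF M(1)] doubling_idem[OF d])
  then have "cinner (\<alpha> (adj \<alpha> z) + \<beta> (adj \<beta> z)) z = 0" by simp
  then have "complex_of_real ((norm (adj \<alpha> z))\<^sup>2 + (norm (adj \<beta> z))\<^sup>2) = 0"
    by (simp only: cinner_simps cinner_adj[OF M(2)] cinner_adj[OF M(3)] cinner_self of_real_add)
  then have "(norm (adj \<alpha> z))\<^sup>2 + (norm (adj \<beta> z))\<^sup>2 = 0" using of_real_eq_0_iff by blast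
  then have "adj \<alpha> z = 0" by (simp add: add_nonneg_eq_0_iff)
  then show ?thesis by (simp add: z_def M_lin[OF M_adj[OF M(2)]])
qed

lemma doubling_p_left:
  assumes d: "doubling p \<alpha> \<beta>"
  shows "p (\<alpha> x) = \<alpha> x"
proof (rule cinner_ext_left)
  note M = doubling_M[OF d]
  show "cinner z (p (\<alpha> x)) = cinner z (\<alpha> x)" for z
    using cinner_adj'[OF M(2), of "p z" x] cinner_adj'[OF M(2), of z x] doubling_adj_p_right[OF d, of z]
      cinner_adj[OF M(1), of z "\<alpha> x"] doubling_adj_p[OF d] by simp
qed

lemma doubling_p_adj_left:
  assumes d: "doubling p \<alpha> \<beta>"
  shows "p (adj \<alpha> x) = adj \<alpha> x"
proof (rule cinner_ext_left)
  note M = doubling_M[OF d]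
  show "cinner z (p (adj \<alpha> x)) = cinner z (adj \<alpha> x)" for z
    using cinner_adj[OF M(2), of "p z" x] cinner_adj[OF M(2), of z x] doubling_p_right[OF d, of z]
      cinner_adj[OF M(1), of z "adj \<alpha> x"] doubling_adj_p[OF d] by simp
qed

lemma doubling_cross:
  assumes d: "doubling p \<alpha> \<beta>"
  shows "adj \<beta> (\<alpha> x) = 0"
proof -
  note M = doubling_M[OF d] and d' = doubling_commute[OF d]
  have "\<alpha> (adj \<alpha> (\<alpha> x)) + \<beta> (adj \<beta> (\<alpha> x)) = \<alpha> x"
    by (simp add: doubling_sum[OF d] doubling_p_left[OF d])
  then have "\<beta> (adj \<beta> (\<alpha> x)) = 0"
    by (simp add: doubling_iso[OF d] doubling_p_right[OF d])
  then have "adj \<beta> (\<beta> (adj \<beta> (\<alpha> x))) = 0" by (simp add: M_lin[OF M_adj[OF M(3)]])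
  then show ?thesis by (simp add: doubling_iso[OF d] doubling_p_adj_left[OF d'])
qed

lemmas doubling_simps = doubling_idem doubling_iso doubling_p_right doubling_adj_p_right
  doubling_p_left doubling_p_adj_left doubling_cross
  doubling_p_right[OF doubling_commute] doubling_adj_p_right[OF doubling_commute]
  doubling_p_left[OF doubling_commute] doubling_p_adj_left[OF doubling_commute]
  doubling_cross[OF doubling_commute]

text \<open>The pair viewed as one isometry of two copies of the range of \<open>p\<close> onto that
  range. Inclusion of graphs then extends the projection and both isometries coherently, as Zorn's
  lemma requires.\<close>

definition doubling_rel :: "('a \<Rightarrow> 'a) \<Rightarrow> ('a \<Rightarrow> 'a) \<Rightarrow> ('a \<Rightarrow> 'a) \<Rightarrow> ('a \<times> 'a \<times> 'a) set" where
  "doubling_rel p \<alpha> \<beta> = {(x, y, w). p x = x \<and> p y = y \<and> w = \<alpha> x + \<beta> y}"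

text \<open>The same graphs without mention of \<open>p\<close>, \<open>\<alpha>\<close>,
  \<open>\<beta>\<close>: the domain is the square of the range. This form passes to closures of
  unions of chains.\<close>

definition self_doubling :: "('a \<times> 'a \<times> 'a) set \<Rightarrow> bool" where
  "self_doubling X \<longleftrightarrow> isometric_rel X \<and> closed X \<and>
     (\<forall>x y. (\<exists>w. (x, y, w) \<in> X) \<longleftrightarrow> x \<in> (snd \<circ> snd) ` X \<and> y \<in> (snd \<circ> snd) ` X)"

lemma range_doubling_rel:
  assumes d: "doubling p \<alpha> \<beta>"
  shows "w \<in> (snd \<circ> snd) ` doubling_rel p \<alpha> \<beta> \<longleftrightarrow> p w = w"
proof
  assume "p w = w"
  then have "w = \<alpha> (adj \<alpha> w) + \<beta> (adj \<beta> w)" by (simp add: doubling_sum[OF d])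
  then have "(adj \<alpha> w, adj \<beta> w, w) \<in> doubling_rel p \<alpha> \<beta>"
    by (simp add: doubling_rel_def doubling_simps[OF d])
  then show "w \<in> (snd \<circ> snd) ` doubling_rel p \<alpha> \<beta>" by force
next
  assume "w \<in> (snd \<circ> snd) ` doubling_rel p \<alpha> \<beta>"
  then show "p w = w"
    by (auto simp: doubling_rel_def M_lin[OF doubling_M(1)[OF d]] doubling_simps[OF d])
qed

lemma self_doubling_doubling_rel:
  assumes d: "doubling p \<alpha> \<beta>"
  shows "self_doubling (doubling_rel p \<alpha> \<beta>)"
  unfolding self_doubling_def
proof (intro conjI allI)
  note M = doubling_M[OF d]
  note lin = M_lin[OF M(1)] M_lin[OF M(2)] M_lin[OF M(3)]
  have norm_eq: "(norm (\<alpha> x + \<beta> y))\<^sup>2 = (norm x)\<^sup>2 + (norm y)\<^sup>2" if "p x = x" "p y = y" for x y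
  proof -
    have "norm (\<alpha> x) = norm x" "norm (\<beta> y) = norm y"
      using that norm_square_adj[OF M(2), of x] norm_square_adj[OF M(3), of y]
      unfolding doubling_iso[OF d] by (simp_all only: cinner_self of_real_eq_iff power2_eq_iff_nonneg norm_ge_zero)
    moreover have "cinner (\<alpha> x) (\<beta> y) = 0"
      by (simp add: cinner_adj[OF M(2)] doubling_cross[OF doubling_commute[OF d]])
    ultimately show ?thesis by (simp add: norm_add_square)
  qed
  show "isometric_rel (doubling_rel p \<alpha> \<beta>)"
    unfolding isometric_rel_def doubling_rel_def
    by (auto simp: lin norm_eq M'_lin M_commute[OF M(1)] M_commute[OF M(2)] M_commute[OF M(3)] scaleC_add_right)
  have cont: "continuous_on UNIV (\<lambda>t::'a\<times>'a\<times>'a. p (fst t))" "continuous_on UNIV (\<lambda>t::'a\<times>'a\<times>'a. p (fst (snd t)))"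
    "continuous_on UNIV (\<lambda>t::'a\<times>'a\<times>'a. \<alpha> (fst t) + \<beta> (fst (snd t)))"
    by (intro continuous_intros continuous_on_compose2[OF bounded_clinear_continuous_on[OF M_bcl[OF M(1)], of UNIV]]
        continuous_on_compose2[OF bounded_clinear_continuous_on[OF M_bcl[OF M(2)], of UNIV]]
        continuous_on_compose2[OF bounded_clinear_continuous_on[OF M_bcl[OF M(3)], of UNIV]]; simp)+
  have "doubling_rel p \<alpha> \<beta> = {t. p (fst t) = fst t} \<inter> {t. p (fst (snd t)) = fst (snd t)} \<inter>
      {t. snd (snd t) = \<alpha> (fst t) + \<beta> (fst (snd t))}"
    by (auto simp: doubling_rel_def)
  moreover have "closed {t::'a\<times>'a\<times>'a. p (fst t) = fst t}" "closed {t::'a\<times>'a\<times>'a. p (fst (snd t)) = fst (snd t)}"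
      "closed {t::'a\<times>'a\<times>'a. snd (snd t) = \<alpha> (fst t) + \<beta> (fst (snd t))}"
    by (rule closed_Collect_eq; intro cont continuous_intros)+
  ultimately show "closed (doubling_rel p \<alpha> \<beta>)" by (simp add: closed_Int)
  show "(\<exists>w. (x, y, w) \<in> doubling_rel p \<alpha> \<beta>) \<longleftrightarrow>
      x \<in> (snd \<circ> snd) ` doubling_rel p \<alpha> \<beta> \<and> y \<in> (snd \<circ> snd) ` doubling_rel p \<alpha> \<beta>" for x y
    unfolding range_doubling_rel[OF d] by (simp add: doubling_rel_def)
qed

text \<open>\<open>\<alpha>\<close> and \<open>\<beta>\<close> are the slices \<open>y = 0\<close>
  and \<open>x = 0\<close>. Both slices have the range of \<open>X\<close> as their domain, so their
  domain projections coincide and give \<open>p\<close>.\<close>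

lemma doubling_of_self_doubling:
  assumes X: "self_doubling X"
  obtains p \<alpha> \<beta> where "doubling p \<alpha> \<beta>" "doubling_rel p \<alpha> \<beta> = X"
proof -
  define R where "R = (snd \<circ> snd) ` X"
  have iso: "isometric_rel X" and cl: "closed X"
    and dom: "\<And>x y. (\<exists>w. (x, y, w) \<in> X) \<longleftrightarrow> x \<in> R \<and> y \<in> R"
    using X unfolding self_doubling_def R_def by blast+
  have R0: "0 \<in> R" using dom isometric_rel_zero[OF iso] by blast
  have in_R: "w \<in> R \<longleftrightarrow> (\<exists>x y. (x, y, w) \<in> X)" for w unfolding R_def by force
  obtain p \<alpha> where p: "p \<in> M" "projection p" "range p = {x. \<exists>w. (x, 0, w) \<in> X}"
    and \<alpha>: "\<alpha> \<in> M" "\<And>x. (p x, 0, \<alpha> x) \<in> X" "\<And>x. adj \<alpha> (\<alpha> x) = p x"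
    by (rule isometric_rel_operator[OF iso cl]) (rule that)
  define Y where "Y = {(x, y, w). (y, x, w) \<in> X}"
  have "isometric_rel Y"
    unfolding isometric_rel_def Y_def mem_Collect_eq prod.case
    using isometric_rel_zero[OF iso] isometric_rel_add[OF iso] isometric_rel_scaleC[OF iso]
      isometric_rel_M'[OF iso] isometric_rel_norm[OF iso] by (simp add: add.commute)
  moreover have "closed Y"
  proof -
    have "Y = (\<lambda>t. (fst (snd t), fst t, snd (snd t))) -` X" by (auto simp: Y_def)
    moreover have "closed ((\<lambda>t. (fst (snd t), fst t, snd (snd t))) -` X)"
      by (rule closed_vimage[OF cl]) (intro continuous_intros)
    ultimately show ?thesis by simp
  qed
  ultimately obtain p2 \<beta> where p2: "p2 \<in> M" "projection p2" "range p2 = {x. \<exists>w. (x, 0, w) \<in> Y}"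
    and \<beta>: "\<beta> \<in> M" "\<And>x. (p2 x, 0, \<beta> x) \<in> Y" "\<And>x. adj \<beta> (\<beta> x) = p2 x"
    by (rule isometric_rel_operator) (rule that)
  have pR: "range p = R" unfolding p(3) using dom R0 by blast
  have p2R: "range p2 = R" unfolding p2(3) Y_def using dom R0 by blast
  have fix_R: "p x = x \<longleftrightarrow> x \<in> R" "p2 x = x \<longleftrightarrow> x \<in> R" for x
    using projection_fixes[OF p(2)] projection_fixes[OF p2(2)] pR p2R by simp_all
  have sym: "cinner (p x) y = cinner x (p y)" "cinner (p2 x) y = cinner x (p2 y)" for x y
    using p(2) p2(2) by (simp_all add: projection_iff)
  have p2p: "p2 (p x) = p x" "p (p2 x) = p2 x" for x using fix_R pR p2R by blast+
  have "p2 x = p x" for x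
  proof (rule cinner_ext_left)
    show "cinner z (p2 x) = cinner z (p x)" for z
      using sym p2p by metis
  qed
  then have p2_eq: "p2 = p" by blast
  have \<beta>X: "(0, p x, \<beta> x) \<in> X" for x using \<beta>(2)[of x] by (simp add: Y_def p2_eq)
  have sumX: "(p x, p y, \<alpha> x + \<beta> y) \<in> X" for x y
    using isometric_rel_add[OF iso \<alpha>(2)[of x] \<beta>X[of y]] by simp
  note lin = M_lin[OF p(1)] M_lin[OF \<alpha>(1)] M_lin[OF \<beta>(1)]
  have X_iff: "(x, y, w) \<in> X \<longleftrightarrow> p x = x \<and> p y = y \<and> w = \<alpha> x + \<beta> y" for x y w
  proof
    assume xyw: "(x, y, w) \<in> X"
    then have "p x = x" "p y = y" using dom fix_R by blast+
    then show "p x = x \<and> p y = y \<and> w = \<alpha> x + \<beta> y"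
      using isometric_rel_unique[OF iso xyw, of "\<alpha> x + \<beta> y"] sumX[of x y] by simp
  next
    assume "p x = x \<and> p y = y \<and> w = \<alpha> x + \<beta> y"
    then show "(x, y, w) \<in> X" using sumX[of x y] by simp
  qed
  have "p w = \<alpha> (adj \<alpha> w) + \<beta> (adj \<beta> w)" for w
  proof -
    have n: "(norm (\<alpha> x + \<beta> y))\<^sup>2 = (norm (\<alpha> x))\<^sup>2 + (norm (\<beta> y))\<^sup>2" for x y
      using isometric_rel_norm[OF iso sumX[of x y]] isometric_rel_norm[OF iso \<alpha>(2)[of x]]
        isometric_rel_norm[OF iso \<beta>X[of y]] by simp
    then have re: "Re (cinner (\<alpha> x) (\<beta> y)) = 0" for x y
      using norm_add_square[of "\<alpha> x" "\<beta> y"] by simp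
    \<comment> \<open>The factor \<open>\<i>\<close> turns the vanishing of real parts into that of
      imaginary parts.\<close>
    have "cinner (\<alpha> x) (\<beta> y) = 0" for x y
      using re[of x y] re[of "\<i> *\<^sub>C x" y] by (simp add: lin cinner_simps complex_eq_iff)
    then have c1: "adj \<alpha> (\<beta> y) = 0" for y
      using cinner_adj[OF \<alpha>(1)] by (intro cinner_ext_left) simp
    have c2: "adj \<beta> (\<alpha> y) = 0" for y
      using cinner_adj[OF \<beta>(1), of _ "\<alpha> y"] \<open>\<And>x y. cinner (\<alpha> x) (\<beta> y) = 0\<close>
      by (intro cinner_ext_left) (metis cinner_commute cinner_zero_right complex_cnj_zero)
    have pa: "p (\<alpha> x) = \<alpha> x" "p (\<beta> x) = \<beta> x" for x
      using \<alpha>(2)[of x] \<beta>X[of x] in_R fix_R by blast+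
    have ad: "adj \<alpha> (p w) = adj \<alpha> w" "adj \<beta> (p w) = adj \<beta> w" for w
      using sym(1) pa cinner_adj[OF \<alpha>(1)] cinner_adj[OF \<beta>(1)] by (intro cinner_ext_left; metis)+
    have "p w \<in> R" using pR by blast
    then obtain x y where xy: "(x, y, p w) \<in> X" using in_R by blast
    then have "p x = x" "p y = y" "p w = \<alpha> x + \<beta> y" using X_iff by blast+
    moreover have "adj \<alpha> (\<alpha> x + \<beta> y) = p x" "adj \<beta> (\<alpha> x + \<beta> y) = p y"
      by (simp_all add: M_lin[OF M_adj[OF \<alpha>(1)]] M_lin[OF M_adj[OF \<beta>(1)]] \<alpha>(3) \<beta>(3) p2_eq c1 c2)
    ultimately show ?thesis using ad[of w] by metis
  qed
  then have "doubling p \<alpha> \<beta>"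
    unfolding doubling_def using p \<alpha> \<beta> p2_eq by simp
  moreover have "doubling_rel p \<alpha> \<beta> = X" unfolding doubling_rel_def using X_iff by auto
  ultimately show thesis by (rule that)
qed

text \<open>The domain condition has to survive limits. From domain to range, convergent values
  force their preimages to converge; from range to domain, convergent arguments force the values to
  be Cauchy.\<close>

lemma self_doubling_closure_Union:
  assumes C: "\<And>X. X \<in> C \<Longrightarrow> self_doubling X" and ne: "C \<noteq> {}"
    and chain: "\<And>X Y. X \<in> C \<Longrightarrow> Y \<in> C \<Longrightarrow> X \<subseteq> Y \<or> Y \<subseteq> X"
  shows "self_doubling (closure (\<Union>C))"
proof -
  have iso: "isometric_rel (\<Union>C)"
    by (rule isometric_rel_Union_chain[OF _ ne chain]) (use C in \<open>simp add: self_doubling_def\<close>)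
  note iso' = isometric_rel_closure[OF iso]
  have dom: "(\<exists>w. (x, y, w) \<in> X) \<longleftrightarrow> (\<exists>r s. (r, s, x) \<in> X) \<and> (\<exists>r s. (r, s, y) \<in> X)" if "X \<in> C" for X x y
  proof -
    have "z \<in> (snd \<circ> snd) ` X \<longleftrightarrow> (\<exists>r s. (r, s, z) \<in> X)" for z by force
    then show ?thesis using C[OF that] unfolding self_doubling_def by simp
  qed
  have in_range: "(\<exists>r s. (r, s, x) \<in> closure (\<Union>C))"
    if s: "\<And>n. \<exists>r t. (r, t, s n) \<in> \<Union>C" "s \<longlonglongrightarrow> x" for s x
  proof -
    obtain r t where rt: "\<And>n. (r n, t n, s n) \<in> \<Union>C" using s(1) by metis
    obtain u v where "r \<longlonglongrightarrow> u" "t \<longlonglongrightarrow> v"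
      by (rule isometric_rel_preimage_limit[OF iso rt s(2)]) (rule that)
    then have "(u, v, x) \<in> closure (\<Union>C)" unfolding closure_seq fst_conv snd_conv using rt s(2) by blast
    then show ?thesis by blast
  qed
  have "(\<exists>w. (x, y, w) \<in> closure (\<Union>C)) \<longleftrightarrow>
      (\<exists>r s. (r, s, x) \<in> closure (\<Union>C)) \<and> (\<exists>r s. (r, s, y) \<in> closure (\<Union>C))" for x y
  proof
    assume "\<exists>w. (x, y, w) \<in> closure (\<Union>C)"
    then obtain w where "(x, y, w) \<in> closure (\<Union>C)" by blast
    then obtain s t r where str: "\<And>n. (s n, t n, r n) \<in> \<Union>C" "s \<longlonglongrightarrow> x" "t \<longlonglongrightarrow> y" "r \<longlonglongrightarrow> w"
      by (rule closure_seqE) (rule that)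
    have "(\<exists>r' t'. (r', t', s n) \<in> \<Union>C) \<and> (\<exists>r' s'. (r', s', t n) \<in> \<Union>C)" for n
    proof -
      obtain X where X: "X \<in> C" "(s n, t n, r n) \<in> X" using str(1)[of n] by (rule UnionE)
      then show ?thesis using dom[OF X(1), of "s n" "t n"] by (meson UnionI)
    qed
    then show "(\<exists>r s. (r, s, x) \<in> closure (\<Union>C)) \<and> (\<exists>r s. (r, s, y) \<in> closure (\<Union>C))"
      using in_range[of s x] in_range[of t y] str(2,3) by simp
  next
    assume "(\<exists>r s. (r, s, x) \<in> closure (\<Union>C)) \<and> (\<exists>r s. (r, s, y) \<in> closure (\<Union>C))"
    then obtain a b c d where ab: "(a, b, x) \<in> closure (\<Union>C)" and cd: "(c, d, y) \<in> closure (\<Union>C)" by blast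
    obtain s t r where str: "\<And>n. (s n, t n, r n) \<in> \<Union>C" "s \<longlonglongrightarrow> a" "t \<longlonglongrightarrow> b" "r \<longlonglongrightarrow> x"
      using ab by (rule closure_seqE) (rule that)
    obtain s' t' r' where str': "\<And>n. (s' n, t' n, r' n) \<in> \<Union>C" "s' \<longlonglongrightarrow> c" "t' \<longlonglongrightarrow> d" "r' \<longlonglongrightarrow> y"
      using cd by (rule closure_seqE) (rule that)
    have "\<exists>w. (r n, r' n, w) \<in> \<Union>C" for n
    proof -
      obtain X where X: "X \<in> C" "(s n, t n, r n) \<in> X" using str(1)[of n] by (rule UnionE)
      obtain Y where Y: "Y \<in> C" "(s' n, t' n, r' n) \<in> Y" using str'(1)[of n] by (rule UnionE)
      have "\<exists>Z\<in>C. (s n, t n, r n) \<in> Z \<and> (s' n, t' n, r' n) \<in> Z"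
        using chain[OF X(1) Y(1)] X Y by blast
      then obtain Z where Z: "Z \<in> C" "(s n, t n, r n) \<in> Z" "(s' n, t' n, r' n) \<in> Z" by blast
      then show ?thesis using dom[OF Z(1), of "r n" "r' n"] by (meson UnionI)
    qed
    then obtain w where w: "\<And>n. (r n, r' n, w n) \<in> \<Union>C" by metis
    have "(norm (w m - w n))\<^sup>2 \<le> (norm (r m - r n) + norm (r' m - r' n))\<^sup>2" for m n
      using isometric_rel_norm[OF iso isometric_rel_diff[OF iso w[of m] w[of n]]]
      by (simp add: power2_sum)
    then have le: "norm (w m - w n) \<le> norm (r m - r n) + norm (r' m - r' n)" for m n
      by (rule power2_le_imp_le) simp
    have "Cauchy w"
    proof (rule CauchyI)
      fix e :: real assume "e > 0"
      then have "e / 2 > 0" by simp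
      then obtain N N' where N: "\<And>m n. m \<ge> N \<Longrightarrow> n \<ge> N \<Longrightarrow> norm (r m - r n) < e / 2"
        "\<And>m n. m \<ge> N' \<Longrightarrow> n \<ge> N' \<Longrightarrow> norm (r' m - r' n) < e / 2"
        using CauchyD[OF LIMSEQ_imp_Cauchy[OF str(4)]] CauchyD[OF LIMSEQ_imp_Cauchy[OF str'(4)]] by metis
      have "norm (w m - w n) < e" if "m \<ge> max N N'" "n \<ge> max N N'" for m n
        using N(1)[of m n] N(2)[of m n] le[of m n] that by simp
      then show "\<exists>N. \<forall>m\<ge>N. \<forall>n\<ge>N. norm (w m - w n) < e" by blast
    qed
    then obtain u where "w \<longlonglongrightarrow> u" by (auto simp: Cauchy_convergent_iff convergent_def)
    then have "(x, y, u) \<in> closure (\<Union>C)"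
      unfolding closure_seq fst_conv snd_conv using w str(4) str'(4) by blast
    then show "\<exists>w. (x, y, w) \<in> closure (\<Union>C)" by blast
  qed
  moreover have "z \<in> (snd \<circ> snd) ` closure (\<Union>C) \<longleftrightarrow> (\<exists>r s. (r, s, z) \<in> closure (\<Union>C))" for z by force
  ultimately show ?thesis unfolding self_doubling_def using iso' by simp
qed

lemma maximal_doubling:
  obtains p \<alpha> \<beta> where "doubling p \<alpha> \<beta>"
    "\<And>p' \<alpha>' \<beta>'. doubling p' \<alpha>' \<beta>' \<Longrightarrow> doubling_rel p \<alpha> \<beta> \<subseteq> doubling_rel p' \<alpha>' \<beta>'
      \<Longrightarrow> doubling_rel p' \<alpha>' \<beta>' = doubling_rel p \<alpha> \<beta>"
proof -
  have "\<exists>X\<in>Collect self_doubling. \<forall>Y\<in>Collect self_doubling. X \<subseteq> Y \<longrightarrow> Y = X"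
  proof (rule subset_Zorn)
    fix C assume C: "subset.chain (Collect self_doubling) C"
    show "\<exists>U\<in>Collect self_doubling. \<forall>X\<in>C. X \<subseteq> U"
    proof (cases "C = {}")
      case True
      have "doubling (\<lambda>x. 0) (\<lambda>x. 0) (\<lambda>x. 0)"
        unfolding doubling_def using M_zero M_bcl[OF M_zero] M_lin[OF M_adj[OF M_zero]] by (simp add: projection_iff)
      from self_doubling_doubling_rel[OF this] show ?thesis
        by (intro bexI[OF _ CollectI]) (simp_all add: True)
    next
      case False
      have "self_doubling X" if "X \<in> C" for X
        using C that unfolding subset_chain_def by auto
      moreover have "X \<subseteq> Y \<or> Y \<subseteq> X" if "X \<in> C" "Y \<in> C" for X Y
        using C that unfolding subset_chain_def by blast
      ultimately have "self_doubling (closure (\<Union>C))"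
        using False by (intro self_doubling_closure_Union)
      moreover have "X \<subseteq> closure (\<Union>C)" if "X \<in> C" for X
        using Union_upper[OF that] closure_subset by (rule order_trans)
      ultimately show ?thesis by (intro bexI[of _ "closure (\<Union>C)"]) auto
    qed
  qed
  then obtain X where "self_doubling X" and max: "\<And>Y. self_doubling Y \<Longrightarrow> X \<subseteq> Y \<Longrightarrow> Y = X"
    by auto
  from this(1) obtain p \<alpha> \<beta> where "doubling p \<alpha> \<beta>" "doubling_rel p \<alpha> \<beta> = X"
    by (rule doubling_of_self_doubling) (rule that)
  then show thesis using that max self_doubling_doubling_rel by metis
qed

end


section \<open>Properly infinite algebras\<close>

context vn_algebra
begin

section \<open>Finite projections and the doubling of the identity\<close>

lemma
  assumes vM: "v \<in> M" and v: "\<And>x. adj v (v x) = g x" and g: "g \<in> M" "projection g"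
  shows partial_isometry_right: "v (g x) = v x" and partial_isometry_left: "g (adj v x) = adj v x"
proof -
  have gg: "g (g x) = g x" and gs: "cinner (g x) y = cinner x (g y)" for x y
    using g by (simp_all add: projection_iff)
  show *: "v (g x) = v x" for x
  proof -
    have "v (x - g x) = 0"
      by (rule adj_compose_eq_0[OF vM]) (simp add: v M_lin[OF g(1)] gg)
    then show ?thesis by (simp add: M_lin[OF vM])
  qed
  show "g (adj v x) = adj v x"
  proof (rule cinner_ext_left)
    show "cinner z (g (adj v x)) = cinner z (adj v x)" for z
      using gs[of z "adj v x"] cinner_adj[OF vM, of "g z" x] cinner_adj[OF vM, of z x] by (simp add: *)
  qed
qed

text \<open>The range projection \<open>w (adj w)\<close> is a subprojection of \<open>g\<close>
  equivalent to \<open>g\<close>, so finiteness identifies the two.\<close>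

lemma finite_projection_isometry:
  assumes fin: "finite_projection M g" and wM: "w \<in> M"
    and w: "\<And>x. adj w (w x) = g x" and gw: "\<And>x. g (w x) = w x"
  shows "w (adj w x) = g x"
proof -
  have g: "g \<in> M" "projection g" using fin by (auto simp: finite_projection_def)
  note iso = partial_isometry_right[OF wM w g] partial_isometry_left[OF wM w g]
  define q where "q x = w (adj w x)" for x
  have w'M: "adj w \<in> M" using wM by (rule M_adj)
  have qM: "q \<in> M" unfolding q_def by (rule M_compose[OF wM w'M])
  have "adj q = q" unfolding q_def by (simp add: adj_compose[OF wM w'M] adj_adj[OF wM])
  then have "projection q"
    by (simp add: projection_iff_adj[OF qM]) (simp add: q_def w iso)
  moreover have "range q \<subseteq> range g" using gw by (auto simp: q_def intro!: range_eqI[of _ g] sym[OF gw])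
  moreover have "mvn_equivalent M g q"
    unfolding mvn_equivalent_def using wM w'M is_adjoint_adj[OF M_bcl[OF wM]] w
    by (intro bexI[of _ w] bexI[of _ "adj w"]) (auto simp: fun_eq_iff q_def)
  ultimately have "q = g" using fin qM unfolding finite_projection_def by blast
  then show ?thesis by (auto simp: q_def[symmetric])
qed

lemma not_finite_projectionE:
  assumes g: "g \<in> M" "projection g" and inf: "\<not> finite_projection M g"
  obtains v x where "v \<in> M" "\<And>x. adj v (v x) = g x" "\<And>x. g (v x) = v x" "v (adj v x) \<noteq> g x"
proof -
  obtain q where q: "q \<in> M" "projection q" "range q \<subseteq> range g" "mvn_equivalent M g q" "q \<noteq> g"
    using g inf unfolding finite_projection_def by blast
  then obtain v w where v: "v \<in> M" "is_adjoint w v" "w \<circ> v = g" "v \<circ> w = q"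
    unfolding mvn_equivalent_def by blast
  have w: "w = adj v" using is_adjoint_unique[OF v(2) is_adjoint_adj[OF M_bcl[OF v(1)]]] .
  have vg: "adj v (v x) = g x" and vq: "v (adj v x) = q x" for x
    using v(3,4) by (auto simp: w fun_eq_iff)
  have "g (v x) = v x" for x
  proof -
    have "q (v x) = v x"
      using partial_isometry_right[OF v(1) vg g, of x] by (simp add: vg flip: vq)
    then have "v x \<in> range g" using q(3) by (metis rangeI subsetD)
    then show ?thesis using projection_fixes[OF g(2)] by blast
  qed
  moreover obtain x where "q x \<noteq> g x" using q(5) by blast
  ultimately show thesis using that[OF v(1) vg] vq by metis
qed

text \<open>A proper isometry \<open>v\<close> of the complement \<open>g\<close> leaves a nonzero
  defect. Its images under the powers of \<open>v\<close> are infinitely many orthogonal copies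
  inside \<open>g\<close>, whose span is doubled and can be joined to \<open>p\<close>.\<close>

lemma doubling_add_complement:
  assumes d: "doubling p \<alpha> \<beta>" and g: "g = (\<lambda>x. x - p x)" and inf: "\<not> finite_projection M g"
  obtains p' \<alpha>' \<beta>' where "doubling p' \<alpha>' \<beta>'" "doubling_rel p \<alpha> \<beta> \<subset> doubling_rel p' \<alpha>' \<beta>'"
proof -
  note M = doubling_M[OF d] and pp = doubling_idem[OF d]
  note linp = M_lin[OF M(1)]
  have ps: "cinner (p x) y = cinner x (p y)" for x y
    using doubling_projection[OF d] by (simp add: projection_iff)
  have gM: "g \<in> M" unfolding g by (rule M_diff[OF M_id M(1)])
  have gproj: "projection g"
    unfolding projection_iff_adj[OF gM] by (simp add: g adj_diff[OF M_id M(1)] adj_id doubling_adj_p[OF d] linp pp)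
  have pg: "p (g x) = 0" and gp: "g (p x) = 0" for x by (simp_all add: g linp pp)
  obtain v z where vM: "v \<in> M" and v'v: "\<And>x. adj v (v x) = g x" and gv: "\<And>x. g (v x) = v x"
    and z: "v (adj v z) \<noteq> g z"
    by (rule not_finite_projectionE[OF gM gproj inf]) (rule that)
  note iso = partial_isometry_right[OF vM v'v gM gproj] partial_isometry_left[OF vM v'v gM gproj]
  have v'M: "adj v \<in> M" using vM by (rule M_adj)
  note linv = M_lin[OF vM] M_lin[OF v'M]
  have pv: "p (v x) = 0" for x using pg[of "v x"] by (simp add: gv)
  have vp: "v (p x) = 0" for x using iso(1)[of "p x"] by (simp add: gp linv)
  have pv': "p (adj v x) = 0" for x using pg[of "adj v x"] by (simp add: iso)
  have v'p: "adj v (p x) = 0" for x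
  proof (rule cinner_ext_left)
    show "cinner y (adj v (p x)) = cinner y 0" for y
      using cinner_adj[OF vM, of y "p x"] ps[of "v y" x] by (simp add: pv)
  qed
  \<comment> \<open>\<open>v\<close> is isometric only on \<open>g\<close>; adding the identity on
    \<open>p\<close> makes it the isometry of the whole space that \<open>vn_shift\<close> asks for,
    with the same defect.\<close>
  define a where "a x = v x + p x" for x
  define f where "f x = x - a (adj a x)" for x
  have aM: "a \<in> M" unfolding a_def by (rule M_add[OF vM M(1)])
  have a'M: "adj a \<in> M" using aM by (rule M_adj)
  have a': "adj a x = adj v x + p x" for x
    unfolding a_def by (simp add: adj_add[OF vM M(1)] doubling_adj_p[OF d])
  have a'a: "adj a (a x) = x" for x
    unfolding a' by (simp add: a_def linv linp v'v v'p pv pp) (simp add: g)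
  note lina = M_lin[OF aM] M_lin[OF a'M]
  have aa'M: "(\<lambda>x. a (adj a x)) \<in> M" by (rule M_compose[OF aM a'M])
  have fM: "f \<in> M" unfolding f_def by (rule M_diff[OF M_id aa'M])
  have "adj f = f" unfolding f_def
    by (simp add: adj_diff[OF M_id aa'M] adj_id adj_compose[OF aM a'M] adj_adj[OF aM])
  then have fproj: "projection f" by (simp add: projection_iff_adj[OF fM]) (simp add: f_def lina a'a)
  interpret vn_shift M a f
    by unfold_locales (simp_all add: aM a'a fM fproj, simp add: f_def lina a'a)
  have f_eq: "f x = g x - v (adj v x)" for x
    unfolding f_def a' by (simp add: a_def linv linp vp pv' pp) (simp add: g)
  have pa: "p (a x) = p x" for x by (simp add: a_def linp pv pp)
  have "p ((a ^^ n) (f x)) = 0" for n x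
    by (induction n) (simp_all add: pa f_eq linp pg pv)
  then have pr: "p (span_proj x) = 0" for x by (rule span_proj_eq_0[OF M(1)])
  have rp: "span_proj (p x) = 0" for x
  proof (rule cinner_ext_left)
    show "cinner y (span_proj (p x)) = cinner y 0" for y
      using projection_span_proj ps[of "span_proj y" x] by (simp add: projection_iff pr)
  qed
  obtain \<gamma> \<delta> where d2: "doubling span_proj \<gamma> \<delta>" using doubling_span_proj by blast
  note M2 = doubling_M[OF d2]
  note lin = linp M_lin[OF M(2)] M_lin[OF M(3)] M_lin[OF M2(1)] M_lin[OF M2(2)] M_lin[OF M2(3)]
    M_lin[OF M_adj[OF M(2)]] M_lin[OF M_adj[OF M(3)]] M_lin[OF M_adj[OF M2(2)]] M_lin[OF M_adj[OF M2(3)]]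
  \<comment> \<open>Operators from orthogonal corners annihilate each other. Arbitrary pairs are
    allowed here so that the swapped doublings give the relations between \<open>\<beta>\<close> and
    \<open>\<delta>\<close>.\<close>
  have mixed: "adj \<alpha> (\<gamma> x) = 0" "adj \<gamma> (\<alpha> x) = 0" "\<alpha> (adj \<gamma> x) = 0" "\<gamma> (adj \<alpha> x) = 0" "\<gamma> (p x) = 0"
    if d: "doubling p \<alpha> \<beta>" and d2: "doubling span_proj \<gamma> \<delta>" for \<alpha> \<beta> \<gamma> \<delta> x
  proof -
    note M = doubling_M[OF d] and M2 = doubling_M[OF d2]
    note lin = M_lin[OF M(2)] M_lin[OF M2(2)] M_lin[OF M_adj[OF M(2)]] M_lin[OF M_adj[OF M2(2)]]
    show "adj \<alpha> (\<gamma> x) = 0"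
      using doubling_adj_p_right[OF d, of "\<gamma> x"] pr[of "\<gamma> x"] doubling_p_left[OF d2, of x] by (simp add: lin)
    show "adj \<gamma> (\<alpha> x) = 0"
      using doubling_adj_p_right[OF d2, of "\<alpha> x"] rp[of "\<alpha> x"] doubling_p_left[OF d, of x] by (simp add: lin)
    show "\<alpha> (adj \<gamma> x) = 0"
      using doubling_p_right[OF d, of "adj \<gamma> x"] pr[of "adj \<gamma> x"] doubling_p_adj_left[OF d2, of x] by (simp add: lin)
    show "\<gamma> (adj \<alpha> x) = 0"
      using doubling_p_right[OF d2, of "adj \<alpha> x"] rp[of "adj \<alpha> x"] doubling_p_adj_left[OF d, of x] by (simp add: lin)
    show "\<gamma> (p x) = 0"
      using doubling_p_right[OF d2, of "p x"] rp[of x] by (simp add: lin)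
  qed
  note mix = mixed[OF d d2] mixed[OF doubling_commute[OF d] doubling_commute[OF d2]]
  define p' where "p' x = p x + span_proj x" for x
  define \<alpha>' where "\<alpha>' x = \<alpha> x + \<gamma> x" for x
  define \<beta>' where "\<beta>' x = \<beta> x + \<delta> x" for x
  have "p' \<in> M" "\<alpha>' \<in> M" "\<beta>' \<in> M"
    unfolding p'_def \<alpha>'_def \<beta>'_def by (rule M_add[OF M(1) M2(1)] M_add[OF M(2) M2(2)] M_add[OF M(3) M2(3)])+
  moreover have "adj p' = p'" unfolding p'_def
    by (simp add: adj_add[OF M(1) M2(1)] doubling_adj_p[OF d] doubling_adj_p[OF d2])
  with \<open>p' \<in> M\<close> have "projection p'"
    by (simp add: projection_iff_adj) (simp add: p'_def lin doubling_idem[OF d] doubling_idem[OF d2] pr rp)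
  moreover have adj': "adj \<alpha>' = (\<lambda>x. adj \<alpha> x + adj \<gamma> x)" "adj \<beta>' = (\<lambda>x. adj \<beta> x + adj \<delta> x)"
    unfolding \<alpha>'_def \<beta>'_def by (simp_all add: adj_add[OF M(2) M2(2)] adj_add[OF M(3) M2(3)])
  moreover have "adj \<alpha>' (\<alpha>' x) = p' x" "adj \<beta>' (\<beta>' x) = p' x" for x
    unfolding adj' unfolding p'_def \<alpha>'_def \<beta>'_def
    by (simp_all add: lin mix doubling_iso[OF d] doubling_iso[OF d2])
  moreover have "\<alpha>' (adj \<alpha>' x) + \<beta>' (adj \<beta>' x) = p' x" for x
  proof -
    have "\<alpha>' (adj \<alpha>' x) + \<beta>' (adj \<beta>' x) = (\<alpha> (adj \<alpha> x) + \<beta> (adj \<beta> x)) + (\<gamma> (adj \<gamma> x) + \<delta> (adj \<delta> x))"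
      unfolding adj' unfolding \<alpha>'_def \<beta>'_def by (simp add: lin mix algebra_simps)
    then show ?thesis by (simp add: doubling_sum[OF d] doubling_sum[OF d2] p'_def)
  qed
  ultimately have d': "doubling p' \<alpha>' \<beta>'" unfolding doubling_def by blast
  moreover have "doubling_rel p \<alpha> \<beta> \<subseteq> doubling_rel p' \<alpha>' \<beta>'"
  proof
    fix t assume "t \<in> doubling_rel p \<alpha> \<beta>"
    then obtain x y where t: "t = (x, y, \<alpha> x + \<beta> y)" and xy: "p x = x" "p y = y"
      unfolding doubling_rel_def by blast
    have "span_proj x = 0" "span_proj y = 0" "\<gamma> x = 0" "\<delta> y = 0"
      using rp[of x] rp[of y] mix(5)[of x] mix(10)[of y] xy by simp_all
    then show "t \<in> doubling_rel p' \<alpha>' \<beta>'"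
      unfolding t doubling_rel_def by (simp add: p'_def \<alpha>'_def \<beta>'_def xy)
  qed
  moreover have "doubling_rel p \<alpha> \<beta> \<noteq> doubling_rel p' \<alpha>' \<beta>'"
  proof
    assume eq: "doubling_rel p \<alpha> \<beta> = doubling_rel p' \<alpha>' \<beta>'"
    \<comment> \<open>The defect vector \<open>f z\<close> is nonzero by the choice of
      \<open>z\<close>; it lies under \<open>p'\<close> and is killed by \<open>p\<close>.\<close>
    have pf: "p (f z) = 0" by (simp add: f_eq linp pg pv)
    then have "p' (f z) = f z" by (simp add: p'_def)
    then have "p (f z) = f z"
      using range_doubling_rel[OF d, of "f z"] range_doubling_rel[OF d', of "f z"] eq by simp
    then have "f z = 0" using pf by simp
    then show False using z by (simp add: f_eq)
  qed
  ultimately show thesis using that by blast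
qed

lemma doubling_finite_complement:
  obtains p \<alpha> \<beta> where "doubling p \<alpha> \<beta>" "finite_projection M (\<lambda>x. x - p x)"
  using maximal_doubling doubling_add_complement by (metis psubset_eq)

text \<open>Let \<open>z\<close> be the central support of the part of \<open>g = 1 - p\<close> left
  unmatched by \<open>v\<close>. Below \<open>z\<close>, \<open>v\<close> exhausts \<open>p\<close>,
  so \<open>p z\<close> is equivalent to a part of the finite \<open>g\<close>; being doubled, it
  must be 0. Then \<open>z\<close> lies under \<open>g\<close> and is a finite central projection,
  hence 0. So \<open>v\<close> matches all of \<open>g\<close> inside \<open>p\<close>, and the
  whole space embeds into the range of \<open>p\<close>.\<close>

lemma doubling_identity:
  assumes pinf: "properly_infinite M"
  obtains \<alpha> \<beta> where "doubling (\<lambda>x. x) \<alpha> \<beta>"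
proof -
  obtain p \<alpha> \<beta> where d: "doubling p \<alpha> \<beta>" and fin0: "finite_projection M (\<lambda>x. x - p x)"
    by (rule doubling_finite_complement)
  define g where "g x = x - p x" for x
  have fin: "finite_projection M g" using fin0 by (simp add: g_def[abs_def])
  have g: "g \<in> M" "projection g" using fin by (auto simp: finite_projection_def)
  note M = doubling_M[OF d]
  have gg: "g (g x) = g x" and gs: "cinner (g x) y = cinner x (g y)" for x y
    using g by (simp_all add: projection_iff)
  obtain v where vM: "v \<in> M" and vv'v: "\<And>x. v (adj v (v x)) = v x" and vg: "\<And>x. v (g x) = v x"
    and pv: "\<And>x. p (v x) = v x"
    and rest: "\<And>m x. m \<in> M \<Longrightarrow> p (m (g x - adj v (v x))) = v (adj v (m (g x - adj v (v x))))"
    by (rule comparison[OF g M(1) doubling_projection[OF d]]) (rule that)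
  have v'M: "adj v \<in> M" using vM by (rule M_adj)
  have \<alpha>'M: "adj \<alpha> \<in> M" and \<beta>'M: "adj \<beta> \<in> M" using M by (simp_all add: M_adj)
  note lin = M_lin[OF g(1)] M_lin[OF M(1)] M_lin[OF vM] M_lin[OF v'M] M_lin[OF M(2)] M_lin[OF M(3)]
    M_lin[OF \<alpha>'M] M_lin[OF \<beta>'M]
  have gv': "g (adj v x) = adj v x" for x
  proof (rule cinner_ext_left)
    show "cinner y (g (adj v x)) = cinner y (adj v x)" for y
      using gs[of y "adj v x"] cinner_adj[OF vM, of "g y" x] cinner_adj[OF vM, of y x] by (simp add: vg)
  qed
  have v'vv': "adj v (v (adj v x)) = adj v x" for x
  proof (rule cinner_ext_left)
    show "cinner y (adj v (v (adj v x))) = cinner y (adj v x)" for y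
      using cinner_adj[OF vM, of y "v (adj v x)"] cinner_adj'[OF vM, of "v y" "adj v x"]
        cinner_adj[OF vM, of "adj v (v y)" x] cinner_adj[OF vM, of y x] by (simp add: vv'v)
  qed
  have v'p: "adj v (p x) = adj v x" for x
  proof (rule cinner_ext_left)
    show "cinner y (adj v (p x)) = cinner y (adj v x)" for y
      using cinner_adj[OF vM, of y "p x"] cinner_adj[OF M(1), of "v y" x] cinner_adj[OF vM, of y x]
      by (simp add: pv doubling_adj_p[OF d])
  qed
  define g1 where "g1 x = g x - adj v (v x)" for x
  have g1M: "g1 \<in> M" unfolding g1_def by (rule M_diff[OF g(1) M_compose[OF v'M vM]])
  have g1s: "cinner (g1 x) y = cinner x (g1 y)" for x y
    by (simp add: g1_def cinner_simps gs cinner_adj[OF vM] cinner_adj'[OF vM])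
  have g1_rest: "p (m (g1 x)) = v (adj v (m (g1 x)))" if "m \<in> M" for m x
    using rest[OF that] by (simp add: g1_def)
  text \<open>The complement of the central support of \<open>g1\<close>.\<close>
  define K where "K = {y. \<forall>m\<in>M. g1 (m y) = 0}"
  have K: "closed_csubspace K"
  proof -
    have "K = (\<Inter>m\<in>M. {y. g1 (m y) = 0})" by (auto simp: K_def)
    moreover have "closed {y. g1 (m y) = 0}" if "m \<in> M" for m
      by (rule closed_Collect_eq[OF bounded_clinear_continuous_on[OF M_bcl[OF M_compose[OF g1M that]]] continuous_on_const])
    ultimately have "closed K" by auto
    then show ?thesis
      by (auto simp: closed_csubspace_def K_def M_lin M_lin[OF g1M])
  qed
  have K_M': "n y \<in> K" if n: "n \<in> M'" and y: "y \<in> K" for n y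
  proof -
    have "g1 (m (n y)) = n (g1 (m y))" if "m \<in> M" for m
      using M_commute[OF that n, of y] M_commute[OF g1M n, of "m y"] by simp
    then show ?thesis using y by (simp add: K_def M'_lin[OF n])
  qed
  obtain k where kM: "k \<in> M" and k: "projection k" "range k = K"
    using projection_in_M[of K thesis] K K_M' that by simp
  have kk: "k (k x) = k x" and ks: "cinner (k x) y = cinner x (k y)" for x y
    using k(1) by (simp_all add: projection_iff)
  have k_iff: "k x = x \<longleftrightarrow> (\<forall>m\<in>M. g1 (m x) = 0)" for x
    using projection_fixes[OF k(1), of x] k(2) by (auto simp: K_def)
  have kmk: "k (m (k x)) = m (k x)" if m: "m \<in> M" for m x
  proof -
    have "g1 (n (m (k x))) = 0" if n: "n \<in> M" for n
      using k_iff[of "k x"] kk[of x] M_compose[OF n m] by (auto dest: bspec)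
    then show ?thesis using k_iff by blast
  qed
  \<comment> \<open>The range of \<open>k\<close> is invariant under \<open>M\<close>; applied to
    \<open>m\<close> and to \<open>adj m\<close>, this makes \<open>k\<close> central.\<close>
  have km: "m (k x) = k (m x)" if m: "m \<in> M" for m x
  proof (rule cinner_ext_left)
    fix y
    have "cinner y (k (m x)) = cinner (adj m (k y)) x"
      using ks[of y "m x"] cinner_adj'[OF m, of "k y" x] by simp
    also have "\<dots> = cinner (k (adj m (k y))) x" by (simp only: kmk[OF M_adj[OF m]])
    also have "\<dots> = cinner y (k (m (k x)))"
      using ks[of "adj m (k y)" x] cinner_adj'[OF m, of "k y" "k x"] ks[of y "m (k x)"] by simp
    finally show "cinner y (m (k x)) = cinner y (k (m x))" by (simp add: kmk[OF m])
  qed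
  define z where "z x = x - k x" for x
  have zM: "z \<in> M" unfolding z_def by (rule M_diff[OF M_id kM])
  have zz: "z (z x) = z x" for x by (simp add: z_def M_lin[OF kM] kk)
  have z_adj: "adj z = z" unfolding z_def
    by (simp add: adj_diff[OF M_id kM] adj_id adj_projection[OF k(1)])
  have zproj: "projection z" using zz z_adj by (simp add: projection_iff_adj[OF zM])
  have zm: "m (z x) = z (m x)" if "m \<in> M" for m x
    by (simp add: z_def M_lin[OF that] km[OF that])
  have z_comm: "z \<in> M'" using zm M_bcl[OF zM] by (auto simp: in_M'_iff)
  note linz = M_lin[OF zM]
  have g1z: "g1 (z x) = g1 x" for x
    using k_iff[of "k x"] M_id kk[of x] by (auto simp: z_def M_lin[OF g1M] dest: bspec[of _ _ "\<lambda>x. x"])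
  \<comment> \<open>The leftover \<open>p - v (adj v)\<close> is sent into \<open>K\<close> because
    \<open>g1_rest\<close>, after taking adjoints, says that \<open>g1 m\<close> annihilates
    it.\<close>
  have pz: "p (z x) = v (adj v (z x))" for x
  proof -
    have "k (p y - v (adj v y)) = p y - v (adj v y)" for y
      unfolding k_iff
    proof
      fix m assume m: "m \<in> M"
      have m': "adj m \<in> M" using m by (rule M_adj)
      show "g1 (m (p y - v (adj v y))) = 0"
      proof (rule cinner_ext_left)
        fix u
        have "cinner u (g1 (m (p y - v (adj v y)))) = cinner (p (adj m (g1 u)) - v (adj v (adj m (g1 u)))) y"
          using g1s[of u "m (p y - v (adj v y))"] cinner_adj'[OF m, of "g1 u" "p y - v (adj v y)"]
            cinner_adj'[OF vM, of "adj m (g1 u)" "adj v y"] cinner_adj[OF vM, of "adj v (adj m (g1 u))" y]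
            cinner_adj[OF M(1), of "adj m (g1 u)" y]
          by (simp add: cinner_simps doubling_adj_p[OF d])
        then show "cinner u (g1 (m (p y - v (adj v y)))) = cinner u 0"
          by (simp add: g1_rest[OF m'])
      qed
    qed
    then have "z (p x - v (adj v x)) = 0" by (simp add: z_def)
    then have "z (p x) = z (v (adj v x))" by (simp add: linz)
    then show ?thesis by (simp add: zm[OF M(1)] zm[OF v'M] zm[OF vM])
  qed
  have vv': "v (adj v (m (z x))) = m (z x)" if "m \<in> M" "\<And>x. p (m x) = m x" for m x
    using pz[of "m x"] that by (simp add: zm[OF that(1)] zm[OF M(1)])
  \<comment> \<open>\<open>\<alpha>\<close>, an isometry of \<open>p z\<close> onto one half of it,
    carried over into \<open>g\<close> by \<open>v\<close>. Adding the identity \<open>e\<close> on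
    the rest of \<open>g\<close> gives an isometry \<open>w\<close> of \<open>g\<close> to which
    finiteness applies.\<close>
  define t where "t x = adj v (\<alpha> (v (z x)))" for x
  have tM: "t \<in> M" unfolding t_def
    by (rule M_compose[OF v'M M_compose[OF M(2) M_compose[OF vM zM]]])
  have t': "adj t x = z (adj v (adj \<alpha> (v x)))" for x
    unfolding t_def
    by (simp add: adj_compose[OF v'M M_compose[OF M(2) M_compose[OF vM zM]]] adj_adj[OF vM]
        adj_compose[OF M(2) M_compose[OF vM zM]] adj_compose[OF vM zM] z_adj)
  define e where "e x = g x - adj v (v (z x))" for x
  have v'vzM: "(\<lambda>x. adj v (v (z x))) \<in> M" by (rule M_compose[OF v'M M_compose[OF vM zM]])
  have eM: "e \<in> M" unfolding e_def by (rule M_diff[OF g(1) v'vzM])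
  have e': "adj e = e"
    unfolding e_def
    by (simp add: adj_diff[OF g(1) v'vzM] adj_projection[OF g(2)] adj_compose[OF v'M M_compose[OF vM zM]]
        adj_compose[OF vM zM] adj_adj[OF vM] z_adj zm[OF vM, symmetric] zm[OF v'M, symmetric])
  define w where "w x = t x + e x" for x
  have wM: "w \<in> M" unfolding w_def by (rule M_add[OF tM eM])
  have w': "adj w x = adj t x + e x" for x unfolding w_def by (simp add: adj_add[OF tM eM] e')
  have ge: "g (e x) = e x" for x by (simp add: e_def lin gg gv')
  have gt: "g (t x) = t x" for x by (simp add: t_def gv')
  have ve: "v (z (e x)) = 0" for x
    by (simp add: e_def linz lin flip: zm[OF g(1)] zm[OF v'M] zm[OF vM])
      (simp add: zm[OF vM, symmetric] zz vg vv'v)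
  have te: "t (e x) = 0" for x using ve[of x] by (simp add: t_def lin)
  have t'e: "adj t (e x) = 0" for x
    using ve[of x] unfolding t' by (simp add: zm[OF vM] zm[OF \<alpha>'M, symmetric] zm[OF v'M, symmetric] lin)
  have et: "e (t x) = 0" for x
  proof -
    have "z (t x) = t x" by (simp add: t_def zm[OF vM] zm[OF M(2)] zm[OF v'M] zz)
    then have "e (t x) = t x - adj v (v (t x))" by (simp add: e_def gt)
    then show ?thesis by (simp add: t_def v'vv')
  qed
  have et': "e (adj t x) = 0" for x
  proof -
    have "z (adj t x) = adj t x" "g (adj t x) = adj t x"
      by (simp_all add: t' zz zm[OF g(1)] gv')
    then have "e (adj t x) = adj t x - adj v (v (adj t x))" by (simp add: e_def)
    moreover have "adj v (v (adj t x)) = adj t x"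
      by (simp add: t' zm[OF vM] zm[OF v'M] v'vv')
    ultimately show ?thesis by simp
  qed
  have vt: "v (t x) = \<alpha> (v (z x))" for x
    using vv'[OF M_compose[OF M(2) vM], of x] by (simp add: t_def doubling_p_left[OF d])
  have ee: "e (e x) = e x" for x
  proof -
    have "adj v (v (z (e x))) = 0" by (simp add: ve lin)
    then show ?thesis by (simp add: e_def[of "e x"] ge)
  qed
  have "adj w (w x) = g x" for x
  proof -
    have "adj w (w x) = adj t (t x) + e x"
      unfolding w' w_def by (simp add: M_lin[OF M_adj[OF tM]] M_lin[OF eM] t'e et ee)
    also have "adj t (t x) = z (adj v (v (z x)))"
      by (simp add: t' vt doubling_iso[OF d] pv)
    also have "\<dots> = adj v (v (z x))" by (simp add: zm[OF vM] zm[OF v'M] zz)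
    finally show ?thesis by (simp add: e_def)
  qed
  moreover have "g (w x) = w x" for x by (simp add: w_def lin gt ge)
  ultimately have ww': "w (adj w x) = g x" for x
    by (rule finite_projection_isometry[OF fin wM])
  have tt': "t (adj t x) = adj v (v (z x))" for x
  proof -
    have "w (adj w x) = t (adj t x) + e x"
      unfolding w' w_def by (simp add: M_lin[OF tM] M_lin[OF eM] te et' ee)
    then show ?thesis by (simp add: ww' e_def)
  qed
  \<comment> \<open>Finiteness made \<open>t\<close> onto, so below \<open>z\<close> the range of
    \<open>\<alpha>\<close> is all of \<open>p\<close> and nothing is left for
    \<open>\<beta>\<close>. Since \<open>\<beta>\<close> is isometric on \<open>p\<close>, this
    gives \<open>p z = 0\<close>.\<close>
  have "\<beta> (adj \<beta> (z x)) = 0" for x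
  proof -
    have "v (t (adj t (adj v x))) = v (adj v (v (z (adj v x))))" by (simp add: tt')
    then have "\<alpha> (v (z (adj t (adj v x)))) = v (adj v (z x))" by (simp add: vt vv'v zm[OF v'M])
    moreover have "z (adj t (adj v x)) = adj t (adj v x)" by (simp add: t' zz)
    moreover have "v (adj t (adj v x)) = adj \<alpha> (z x)"
    proof -
      have "v (adj t (adj v x)) = v (adj v (adj \<alpha> (v (adj v (z x)))))"
        by (simp add: t' zm[OF vM] zm[OF v'M] zm[OF \<alpha>'M])
      also have "\<dots> = v (adj v (adj \<alpha> (z x)))"
        by (simp add: doubling_adj_p_right[OF d] flip: pz)
      also have "\<dots> = adj \<alpha> (z x)"
        using vv'[OF \<alpha>'M doubling_p_adj_left[OF d]] .
      finally show ?thesis .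
    qed
    ultimately have "\<alpha> (adj \<alpha> (z x)) = p (z x)" by (simp add: pz)
    then show ?thesis using doubling_sum[OF d, of "z x"] by simp
  qed
  then have "adj \<beta> (z x) = 0" for x
    using doubling_iso(2)[OF d, of "adj \<beta> (z x)"] doubling_p_adj_left[OF doubling_commute[OF d], of "z x"]
    by (simp add: lin)
  then have pz0: "p (z x) = 0" for x
    using doubling_iso(2)[OF d, of "z x"] by (simp add: zm[OF M(3)] zm[OF \<beta>'M])
  have gz: "g (z x) = z x" for x using pz0[of x] by (simp add: g_def)
  have "finite_projection M z"
  proof (rule ccontr)
    assume "\<not> finite_projection M z"
    then obtain u y where uM: "u \<in> M" and u: "\<And>x. adj u (u x) = z x" "\<And>x. z (u x) = u x"
      and y: "u (adj u y) \<noteq> z y"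
      by (rule not_finite_projectionE[OF zM zproj]) (rule that)
    have u'M: "adj u \<in> M" using uM by (rule M_adj)
    note uiso = partial_isometry_right[OF uM u(1) zM zproj] partial_isometry_left[OF uM u(1) zM zproj]
    \<comment> \<open>A proper isometry \<open>u\<close> of \<open>z\<close>, completed by the
      identity on \<open>g - z\<close>, would be a proper isometry of the finite
      \<open>g\<close>.\<close>
    define s where "s x = g x - z x" for x
    have sM: "s \<in> M" unfolding s_def by (rule M_diff[OF g(1) zM])
    have s': "adj s = s" unfolding s_def
      by (simp add: adj_diff[OF g(1) zM] adj_projection[OF g(2)] z_adj)
    have zs: "z (s x) = 0" and sz: "s (z x) = 0" and gs: "g (s x) = s x" and ss: "s (s x) = s x" for x
      by (simp_all add: s_def linz lin gg gz zz zm[OF g(1), symmetric])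
    have us: "u (s x) = 0" "adj u (s x) = 0" "s (u x) = 0" "s (adj u x) = 0" for x
    proof -
      show "u (s x) = 0" using uiso(1)[of "s x"] by (simp add: zs M_lin[OF uM])
      have "adj u (z y) = adj u y" for y using uiso(2)[of y] by (simp add: zm[OF u'M])
      then show "adj u (s x) = 0" by (metis zs M_lin(6)[OF u'M])
      show "s (u x) = 0" using sz[of "u x"] by (simp add: u)
      show "s (adj u x) = 0" using sz[of "adj u x"] by (simp add: uiso)
    qed
    define r where "r x = u x + s x" for x
    have rM: "r \<in> M" unfolding r_def by (rule M_add[OF uM sM])
    have r': "adj r x = adj u x + s x" for x unfolding r_def by (simp add: adj_add[OF uM sM] s')
    have "adj r (r x) = g x" for x
      unfolding r' r_def by (simp add: M_lin[OF u'M] M_lin[OF sM] us u ss) (simp add: s_def)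
    moreover have "g (r x) = r x" for x
      using gz[of "u x"] by (simp add: r_def lin gs u)
    ultimately have "r (adj r y) = g y" by (rule finite_projection_isometry[OF fin rM])
    then show False
      using y unfolding r' r_def by (simp add: M_lin[OF uM] M_lin[OF sM] us ss) (simp add: s_def)
  qed
  then have "z = (\<lambda>x. 0)"
    using pinf zM z_comm zproj unfolding properly_infinite_def by blast
  then have "g1 x = 0" for x using g1z[of x] by (simp add: M_lin[OF g1M])
  then have v'v: "adj v (v x) = g x" for x by (simp add: g1_def)
  \<comment> \<open>\<open>g\<close> goes through \<open>v\<close> into the \<open>\<beta>\<close>
    half of \<open>p\<close>, while \<open>p\<close> itself goes into the \<open>\<alpha>\<close>
    half.\<close>
  define a where "a x = \<beta> (v x) + \<alpha> x" for x
  have \<beta>vM: "(\<lambda>x. \<beta> (v x)) \<in> M" by (rule M_compose[OF M(3) vM])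
  have aM: "a \<in> M" unfolding a_def by (rule M_add[OF \<beta>vM M(2)])
  have a': "adj a x = adj v (adj \<beta> x) + adj \<alpha> x" for x
    unfolding a_def by (simp add: adj_add[OF \<beta>vM M(2)] adj_compose[OF M(3) vM])
  have "adj a (a x) = x" for x
    unfolding a' a_def by (simp add: lin doubling_simps[OF d] pv v'v) (simp add: g_def)
  moreover have "p (a x) = a x" for x by (simp add: a_def lin doubling_simps[OF d])
  ultimately obtain y where yM: "y \<in> M" and y: "\<And>x. adj y (y x) = x" "\<And>x. y (adj y x) = p x"
    using Schroeder_Bernstein_isometry[OF aM _ M(1) doubling_projection[OF d]] by metis
  have y'M: "adj y \<in> M" using yM by (rule M_adj)
  have py: "p (y x) = y x" for x using y(2)[of "y x"] by (simp add: y(1))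
  have conj: "(\<lambda>x. adj y (m (y x))) \<in> M" "adj (\<lambda>x. adj y (m (y x))) = (\<lambda>x. adj y (adj m (y x)))"
    if m: "m \<in> M" for m
  proof -
    show "(\<lambda>x. adj y (m (y x))) \<in> M" by (rule M_compose[OF y'M M_compose[OF m yM]])
    show "adj (\<lambda>x. adj y (m (y x))) = (\<lambda>x. adj y (adj m (y x)))"
      by (simp add: adj_compose[OF y'M M_compose[OF m yM]] adj_compose[OF m yM] adj_adj[OF yM])
  qed
  \<comment> \<open>\<open>y\<close> identifies the whole space with the range of \<open>p\<close>;
    conjugation transports the doubling.\<close>
  have "doubling (\<lambda>x. x) (\<lambda>x. adj y (\<alpha> (y x))) (\<lambda>x. adj y (\<beta> (y x)))"
    unfolding doubling_def conj(2)[OF M(2)] conj(2)[OF M(3)]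
  proof (intro conjI allI conj M M_id)
    show "projection (\<lambda>x::'a. x)" by (simp add: projection_iff_adj[OF M_id] adj_id)
    show "adj y (adj \<alpha> (y (adj y (\<alpha> (y x))))) = x" "adj y (adj \<beta> (y (adj y (\<beta> (y x))))) = x" for x
      by (simp_all add: y doubling_simps[OF d] py)
    show "adj y (\<alpha> (y (adj y (adj \<alpha> (y x))))) + adj y (\<beta> (y (adj y (adj \<beta> (y x))))) = x" for x
      by (simp add: y doubling_simps[OF d] doubling_sum[OF d] py flip: M_lin(2)[OF y'M])
  qed
  then show thesis by (rule that)
qed

text \<open>One isometry \<open>a\<close> of a doubling of the identity may have a unitary part; a
  Schroeder--Bernstein argument absorbs it into the range of the other isometry.\<close>

lemma pure_isometry:
  assumes pinf: "properly_infinite M"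
  obtains S f where "vn_shift M S f" "\<And>x. (\<And>n. vn_shift.coord S f n x = 0) \<Longrightarrow> x = 0"
proof -
  obtain a b where d: "doubling (\<lambda>x. x) a b" using doubling_identity[OF pinf] .
  note M = doubling_M[OF d]
  have ab: "adj a (a x) = x" "adj b (b x) = x" "adj a (b x) = 0" "adj b (a x) = 0" for x
    using doubling_iso[OF d, of x] doubling_cross[OF d, of x] doubling_cross[OF doubling_commute[OF d], of x]
    by simp_all
  have a'M: "adj a \<in> M" and b'M: "adj b \<in> M" using M by (simp_all add: M_adj)
  define f where "f x = b (adj b x)" for x
  have fM: "f \<in> M" unfolding f_def by (rule M_compose[OF M(3) b'M])
  have "adj f = f" unfolding f_def by (simp add: adj_compose[OF M(3) b'M] adj_adj[OF M(3)])
  then have fproj: "projection f"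
    by (simp add: projection_iff_adj[OF fM]) (simp add: f_def ab)
  interpret vn_shift M a f
    by unfold_locales (simp_all add: M fM fproj ab, simp add: f_def ab)
  define q where "q = span_proj"
  have q: "q \<in> M" "projection q" unfolding q_def by (rule span_proj_M, rule projection_span_proj)
  \<comment> \<open>\<open>b\<close> maps the whole space into the first copy and thus under
    \<open>q\<close>, so \<open>q\<close> is equivalent to the identity.\<close>
  have qb: "q (b x) = b x" for x
    using span_proj_f[of "b x"] by (simp add: q_def f_def ab)
  obtain y where yM: "y \<in> M" and y: "\<And>x. adj y (y x) = x" "\<And>x. y (adj y x) = q x"
    using Schroeder_Bernstein_isometry[OF M(3) _ q qb] ab by metis
  have y'M: "adj y \<in> M" using yM by (rule M_adj)
  have qy: "q (y x) = y x" for x using y(2)[of "y x"] by (simp add: y(1))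
  have qa: "q (a x) = a (q x)" and qa': "q (adj a x) = adj a (q x)" and qf: "q (f x) = f x" for x
    by (simp_all add: q_def span_proj_a span_proj_a')
  have conj: "(\<lambda>x. adj y (m (y x))) \<in> M" "adj (\<lambda>x. adj y (m (y x))) = (\<lambda>x. adj y (adj m (y x)))"
    if m: "m \<in> M" for m
  proof -
    show "(\<lambda>x. adj y (m (y x))) \<in> M" by (rule M_compose[OF y'M M_compose[OF m yM]])
    show "adj (\<lambda>x. adj y (m (y x))) = (\<lambda>x. adj y (adj m (y x)))"
      by (simp add: adj_compose[OF y'M M_compose[OF m yM]] adj_compose[OF m yM] adj_adj[OF yM])
  qed
  \<comment> \<open>The restriction of \<open>a\<close> to the range of \<open>q\<close>, where it
    is a pure shift, transported to the whole space.\<close>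
  define S where "S x = adj y (a (y x))" for x
  define h where "h x = adj y (f (y x))" for x
  have SM: "S \<in> M" and hM: "h \<in> M" unfolding S_def h_def by (rule conj M fM)+
  have S': "adj S x = adj y (adj a (y x))" for x unfolding S_def by (simp add: conj(2)[OF M(2)])
  have h': "adj h = h" unfolding h_def by (simp add: conj(2)[OF fM] adj_projection[OF fproj])
  interpret S: vn_shift M S h
  proof
    show "S \<in> M" "h \<in> M" by (fact SM hM)+
    show "adj S (S x) = x" for x
      unfolding S' by (simp add: S_def y qa qy a_iso)
    show "projection h"
      unfolding projection_iff_adj[OF hM] by (simp add: h') (simp add: h_def y qf)
    show "adj S (h x) = 0" for x
      unfolding S' by (simp add: h_def y qf adj_a_f M_lin[OF y'M])
  qed
  have S'n: "y ((adj S ^^ n) x) = (adj a ^^ n) (y x)" for n x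
  proof (induction n)
    case (Suc n)
    have "y ((adj S ^^ Suc n) x) = q (adj a (y ((adj S ^^ n) x)))" by (simp add: S' y)
    also have "\<dots> = adj a (y ((adj S ^^ n) x))" unfolding qa' qy ..
    finally show ?case using Suc by simp
  qed simp
  have "x = 0" if 0: "\<And>n. S.coord n x = 0" for x
  proof -
    have "coord n (y x) = 0" for n
    proof -
      have "y (S.coord n x) = f ((adj a ^^ n) (y x))"
        by (simp add: S.coord_def h_def y S'n qf)
      then show ?thesis using 0[of n] by (simp add: coord_def M_lin[OF yM])
    qed
    then have "(\<lambda>n. (a ^^ n) (coord n (y x))) = (\<lambda>n. 0)" by (simp add: M_lin[OF M_funpow[OF M(2)]])
    then have "q (y x) = 0" using span_proj_sums[of "y x"] sums_unique2[OF _ sums_zero] by (simp add: q_def)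
    then have "adj y (y x) = 0" by (simp add: qy M_lin[OF y'M])
    then show ?thesis by (simp add: y)
  qed
  then show thesis using that S.vn_shift_axioms by blast
qed

end


section \<open>Unbounded operators from contractions\<close>

lemma Im_cinner_self_adjoint:
  assumes "\<And>x y. cinner (P x) y = cinner x (P y)"
  shows "Im (cinner (P x) x) = 0"
  using assms[of x x] arg_cong[OF cinner_commute[of x "P x"], of Im] by simp

context vn_algebra
begin

text \<open>For positive \<open>P\<close> and \<open>1 - P\<close>, strictness of the two
  inequalities is injectivity of these operators.\<close>

definition strict_contraction :: "('a \<Rightarrow> 'a) \<Rightarrow> bool" where
  "strict_contraction P \<longleftrightarrow> P \<in> M \<and> adj P = P \<and>
     (\<forall>x. x \<noteq> 0 \<longrightarrow> 0 < Re (cinner (P x) x) \<and> Re (cinner (P x) x) < (norm x)\<^sup>2)"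

text \<open>The graph of \<open>P\<inverse> - 1\<close>; the name refers to the odds \<open>(1 - t) / t\<close> of a probability \<open>t\<close>.\<close>

definition odds_operator :: "('a \<Rightarrow> 'a) \<Rightarrow> 'a operator" where
  "odds_operator P = {(x, y). x = P (x + y)}"

lemma odds_operator_iff:
  assumes "P \<in> M"
  shows "(x, y) \<in> odds_operator P \<longleftrightarrow> (\<exists>u. x = P u \<and> y = u - P u)"
proof
  assume "(x, y) \<in> odds_operator P"
  then have "x = P (x + y)" by (simp add: odds_operator_def)
  then show "\<exists>u. x = P u \<and> y = u - P u" by (metis add_diff_cancel_left')
qed (auto simp: odds_operator_def)

lemma
  assumes P: "strict_contraction P"
  shows strict_contraction_inj: "P x = 0 \<Longrightarrow> x = 0"
    and strict_contraction_complement_inj: "x - P x = 0 \<Longrightarrow> x = 0"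
    and strict_contraction_M: "P \<in> M"
    and strict_contraction_symmetric: "cinner (P x) y = cinner x (P y)"
proof -
  show M: "P \<in> M" using P by (simp add: strict_contraction_def)
  have "adj P = P" using P by (simp add: strict_contraction_def)
  then show "cinner (P x) y = cinner x (P y)" using cinner_adj[OF M, of x y] by simp
  show "x = 0" if "P x = 0" using P that unfolding strict_contraction_def by force
  show "x = 0" if "x - P x = 0"
  proof (rule ccontr)
    assume "x \<noteq> 0"
    then have "Re (cinner (P x) x) < (norm x)\<^sup>2" using P unfolding strict_contraction_def by blast
    moreover have "P x = x" using that by simp
    ultimately show False by (simp add: cinner_self)
  qed
qed

lemma strict_contraction_nonneg:
  assumes P: "strict_contraction P"
  shows "0 \<le> Re (cinner (P x) x)" "Re (cinner (P x) x) \<le> (norm x)\<^sup>2"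
  using P unfolding strict_contraction_def by (cases "x = 0"; force)+

text \<open>The orthogonal complement of the range of a symmetric operator is its kernel, here
  0.\<close>

lemma dense_range:
  assumes P: "strict_contraction P"
  shows "closure (range P) = UNIV"
proof -
  note M = strict_contraction_M[OF P]
  have seq: "x \<in> closure (range P) \<longleftrightarrow> (\<exists>u. (\<lambda>n. P (u n)) \<longlonglongrightarrow> x)" for x
  proof
    assume "x \<in> closure (range P)"
    then obtain s where s: "\<forall>n. s n \<in> range P" "s \<longlonglongrightarrow> x"
      unfolding closure_sequential by (elim exE conjE)
    from s(1) have "\<forall>n. \<exists>u. s n = P u" by blast
    from choice[OF this] obtain u where "\<forall>n. s n = P (u n)" ..
    then have "s = (\<lambda>n. P (u n))" by (intro ext) simp
    then show "\<exists>u. (\<lambda>n. P (u n)) \<longlonglongrightarrow> x" using s(2) by (intro exI[of _ u]) simp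
  next
    assume "\<exists>u. (\<lambda>n. P (u n)) \<longlonglongrightarrow> x"
    then obtain u where "(\<lambda>n. P (u n)) \<longlonglongrightarrow> x" ..
    then show "x \<in> closure (range P)"
      unfolding closure_sequential by (intro exI[of _ "\<lambda>n. P (u n)"]) simp
  qed
  have "closed_csubspace (closure (range P))"
    unfolding closed_csubspace_def
  proof (intro conjI ballI allI)
    show "0 \<in> closure (range P)"
      unfolding seq by (intro exI[of _ "\<lambda>_. 0"]) (simp add: M_lin[OF M])
    show "x + y \<in> closure (range P)" if "x \<in> closure (range P)" "y \<in> closure (range P)" for x y
    proof -
      obtain u v where "(\<lambda>n. P (u n)) \<longlonglongrightarrow> x" "(\<lambda>n. P (v n)) \<longlonglongrightarrow> y"
        using \<open>x \<in> closure (range P)\<close> \<open>y \<in> closure (range P)\<close> unfolding seq by (elim exE)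
      then show ?thesis unfolding seq
        by (intro exI[of _ "\<lambda>n. u n + v n"]) (simp add: M_lin[OF M] tendsto_add)
    qed
    show "c *\<^sub>C x \<in> closure (range P)" if x: "x \<in> closure (range P)" for c x
    proof -
      obtain u where "(\<lambda>n. P (u n)) \<longlonglongrightarrow> x" using x unfolding seq ..
      then show ?thesis unfolding seq
        by (intro exI[of _ "\<lambda>n. c *\<^sub>C u n"]) (simp add: M_lin[OF M] tendsto_scaleC)
    qed
  qed simp
  then obtain q where q: "projection q" "range q = closure (range P)" by (rule projection_exists)
  have "x \<in> closure (range P)" for x
  proof -
    have "cinner y (P (x - q x)) = 0" for y
    proof -
      have "P y \<in> range q" unfolding q(2) by (rule subsetD[OF closure_subset rangeI])
      then have "q (P y) = P y" using projection_fixes[OF q(1)] by simp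
      moreover have "cinner (q (P y)) x = cinner (P y) (q x)" using q(1) by (simp add: projection_iff)
      ultimately have "cinner (P y) (q x) = cinner (P y) x" by simp
      then show ?thesis using strict_contraction_symmetric[OF P, of y "x - q x"] by (simp add: cinner_diff_right)
    qed
    then have "P (x - q x) = 0" by (intro cinner_ext_left) simp
    then have "x - q x = 0" by (rule strict_contraction_inj[OF P])
    then have "x \<in> range q" using projection_fixes[OF q(1), of x] by simp
    then show ?thesis unfolding q(2) .
  qed
  then show ?thesis by blast
qed

lemma Domain_odds_operator: "P \<in> M \<Longrightarrow> Domain (odds_operator P) = range P"
  by (auto simp: Domain_iff odds_operator_iff)

lemma Domain_converse_odds_operator: "P \<in> M \<Longrightarrow> Domain ((odds_operator P)\<inverse>) = range (\<lambda>x. x - P x)"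
  by (auto simp: Range_iff odds_operator_iff)

text \<open>With \<open>u = x + y\<close> the graph consists of the pairs
  \<open>(P u, u - P u)\<close>, so each claim becomes a statement about the bounded
  \<open>P\<close>. The adjoint relation tested on all \<open>u\<close> is literally
  \<open>y = P (y + z)\<close>.\<close>

lemma odds_operator_properties:
  assumes P: "strict_contraction P"
  shows "self_adjoint_operator (odds_operator P)" "positive_operator (odds_operator P)"
    "one_to_one_operator (odds_operator P)" "affiliated (odds_operator P) M"
proof -
  note M = strict_contraction_M[OF P] and sym = strict_contraction_symmetric[OF P]
  note lin = M_lin[OF M]
  note iff = odds_operator_iff[OF M]
  let ?A = "odds_operator P"
  have lo: "linear_operator ?A"
    unfolding linear_operator_def
  proof (intro conjI allI impI)
    show "single_valued ?A"
    proof (rule single_valuedI)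
      fix x y z assume "(x, y) \<in> ?A" "(x, z) \<in> ?A"
      then obtain u v where uv: "x = P u" "y = u - P u" "x = P v" "z = v - P v" unfolding iff by blast
      then have "P (u - v) = 0" by (simp add: lin)
      then have "u = v" using strict_contraction_inj[OF P] by fastforce
      then show "y = z" using uv by simp
    qed
    show "(0, 0) \<in> ?A" by (simp add: odds_operator_def lin)
    show "(x + x', y + y') \<in> ?A" if "(x, y) \<in> ?A" "(x', y') \<in> ?A" for x y x' y'
    proof -
      have "x = P (x + y)" "x' = P (x' + y')" using that by (simp_all add: odds_operator_def)
      then have "x + x' = P ((x + y) + (x' + y'))" by (simp only: lin(2))
      also have "(x + y) + (x' + y') = (x + x') + (y + y')" by (simp add: add_ac)
      finally show ?thesis unfolding odds_operator_def by blast
    qed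
    show "(c *\<^sub>C x, c *\<^sub>C y) \<in> ?A" if "(x, y) \<in> ?A" for c x y
    proof -
      have "x = P (x + y)" using that by (simp add: odds_operator_def)
      then have "c *\<^sub>C x = P (c *\<^sub>C (x + y))" by (simp only: lin(1))
      then show ?thesis unfolding odds_operator_def scaleC_add_right by blast
    qed
  qed
  have "op_adjoint ?A = ?A"
  proof (intro set_eqI)
    fix t :: "'a \<times> 'a"
    obtain y z where t: "t = (y, z)" by (cases t)
    have "t \<in> op_adjoint ?A \<longleftrightarrow> (\<forall>u. cinner (u - P u) y = cinner (P u) z)"
      unfolding t op_adjoint_def mem_Collect_eq prod.case iff by blast
    also have "\<dots> \<longleftrightarrow> (\<forall>u. cinner u y = cinner u (P (y + z)))"
    proof -
      have "cinner (u - P u) y = cinner u y - cinner u (P y)" "cinner (P u) z = cinner u (P z)"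
        "cinner u (P (y + z)) = cinner u (P y) + cinner u (P z)" for u
        by (simp_all only: cinner_diff_left cinner_add_right sym lin)
      then show ?thesis by (simp only: diff_eq_eq add.commute)
    qed
    also have "\<dots> \<longleftrightarrow> y = P (y + z)" using cinner_ext_left[of y "P (y + z)"] by metis
    finally show "t \<in> op_adjoint ?A \<longleftrightarrow> t \<in> ?A" by (simp add: t odds_operator_def)
  qed
  then show "self_adjoint_operator ?A"
    using lo dense_range[OF P]
    by (simp add: self_adjoint_operator_def densely_defined_def Domain_odds_operator[OF M])
  show "positive_operator ?A"
    unfolding positive_operator_def
  proof (intro allI impI)
    fix x y assume "(x, y) \<in> ?A"
    then obtain u where u: "x = P u" "y = u - P u" unfolding iff by blast
    \<comment> \<open>The identity \<open>P (1 - P) = (1 - P) P (1 - P) + P (1 - P) P\<close>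
      evaluated at \<open>u\<close>; both terms are visibly positive, without a square root of
      \<open>P\<close>.\<close>
    have eq: "cinner y x = cinner (P y) y + cinner x x - cinner (P x) x"
      by (simp add: u cinner_simps lin sym)
    have "Re (cinner y x) \<ge> 0"
      using strict_contraction_nonneg(1)[OF P, of y] strict_contraction_nonneg(2)[OF P, of x]
      unfolding eq by (simp add: cinner_self)
    moreover have "Im (cinner y x) = 0"
      unfolding eq by (simp add: Im_cinner_self_adjoint[of P, OF sym] cinner_self)
    ultimately show "cinner y x \<in> \<real>\<^sub>\<ge>\<^sub>0" by (simp add: complex_nonneg_Reals_iff)
  qed
  show "one_to_one_operator ?A"
    unfolding one_to_one_operator_def
  proof (rule single_valuedI)
    fix y x x' assume "(y, x) \<in> ?A\<inverse>" "(y, x') \<in> ?A\<inverse>"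
    then obtain u v where uv: "x = P u" "y = u - P u" "x' = P v" "y = v - P v" unfolding converse_iff iff by blast
    then have "(u - v) - P (u - v) = 0" by (simp add: lin algebra_simps)
    then have "u = v" using strict_contraction_complement_inj[OF P] by fastforce
    then show "x = x'" using uv by simp
  qed
  have "closed ?A"
  proof -
    have "?A = {t. fst t = P (fst t + snd t)}" by (auto simp: odds_operator_def)
    moreover have "closed {t. fst t = P (fst t + snd t)}"
      by (intro closed_Collect_eq continuous_intros
          continuous_on_compose2[OF bounded_clinear_continuous_on[OF M_bcl[OF M], of UNIV]]) simp
    ultimately show ?thesis by simp
  qed
  moreover have "op_graph U O ?A O op_adjoint (op_graph U) = ?A"
    if U: "U \<in> M'" "unitary U" for U
  proof -
    obtain V where V: "is_adjoint V U" "V \<circ> U = id" "U \<circ> V = id" using U(2) unfolding unitary_def by blast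
    have VU: "V (U x) = x" and UV: "U (V x) = x" for x using V(2,3) by (auto simp: fun_eq_iff)
    have UP: "P (U x) = U (P x)" for x using M U(1) by (rule M_commute)
    have graph: "op_adjoint (op_graph U) = op_graph V" using V(1) by (simp add: is_adjoint_def)
    have "(x, y) \<in> op_graph U O ?A O op_graph V \<longleftrightarrow> (U x, U y) \<in> ?A" for x y
      using VU UV by (auto simp: op_graph_def relcomp_unfold)
    moreover have "(U x, U y) \<in> ?A \<longleftrightarrow> (x, y) \<in> ?A" for x y
    proof -
      have "U x = P (U x + U y) \<longleftrightarrow> U x = U (P (x + y))"
        by (simp add: UP flip: M'_lin(2)[OF U(1)])
      also have "\<dots> \<longleftrightarrow> x = P (x + y)" using VU by metis
      finally show ?thesis by (simp add: odds_operator_def)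
    qed
    ultimately show ?thesis unfolding graph by auto
  qed
  ultimately show "affiliated ?A M"
    using lo by (simp add: affiliated_def closed_operator_def)
qed

text \<open>The operator \<open>(1 - S) \<oplus> S\<close> in the decomposition given by
  \<open>\<alpha>\<close> and \<open>\<beta>\<close>. Its complement is
  \<open>S \<oplus> (1 - S)\<close>, of the same shape with the summands exchanged.\<close>

definition skew_sum :: "('a \<Rightarrow> 'a) \<Rightarrow> ('a \<Rightarrow> 'a) \<Rightarrow> ('a \<Rightarrow> 'a) \<Rightarrow> 'a \<Rightarrow> 'a" where
  "skew_sum \<alpha> \<beta> S x = \<alpha> (adj \<alpha> x - S (adj \<alpha> x)) + \<beta> (S (adj \<beta> x))"

lemma
  assumes d: "doubling (\<lambda>x. x) \<alpha> \<beta>" and S: "strict_contraction S"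
  shows strict_contraction_skew_sum: "strict_contraction (skew_sum \<alpha> \<beta> S)"
    and skew_sum_complement: "x - skew_sum \<alpha> \<beta> S x = \<alpha> (S (adj \<alpha> x)) + \<beta> (adj \<beta> x - S (adj \<beta> x))"
proof -
  note M = doubling_M[OF d] and SM = strict_contraction_M[OF S]
  have M': "adj \<alpha> \<in> M" "adj \<beta> \<in> M" using M by (simp_all add: M_adj)
  note lin = M_lin[OF M(2)] M_lin[OF M(3)] M_lin[OF SM] M_lin[OF M'(1)] M_lin[OF M'(2)]
  have S\<alpha>M: "(\<lambda>x. S (adj \<alpha> x)) \<in> M" and S\<beta>M: "(\<lambda>x. S (adj \<beta> x)) \<in> M"
    by (rule M_compose[OF SM M'(1)], rule M_compose[OF SM M'(2)])
  have M1: "(\<lambda>x. adj \<alpha> x - S (adj \<alpha> x)) \<in> M" by (rule M_diff[OF M'(1) S\<alpha>M])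
  have cM: "skew_sum \<alpha> \<beta> S \<in> M"
    unfolding skew_sum_def[abs_def]
    by (rule M_add[OF M_compose[OF M(2) M1] M_compose[OF M(3) S\<beta>M]])
  have sum: "\<alpha> (adj \<alpha> x) + \<beta> (adj \<beta> x) = x" for x by (rule doubling_sum[OF d])
  show "x - skew_sum \<alpha> \<beta> S x = \<alpha> (S (adj \<alpha> x)) + \<beta> (adj \<beta> x - S (adj \<beta> x))" for x
    using sum[of x] by (simp add: skew_sum_def lin algebra_simps)
  note ssym = strict_contraction_symmetric[OF S]
  have ip: "cinner (skew_sum \<alpha> \<beta> S x) y =
      cinner (adj \<alpha> x - S (adj \<alpha> x)) (adj \<alpha> y) + cinner (S (adj \<beta> x)) (adj \<beta> y)" for x y
    by (simp only: skew_sum_def cinner_add_left cinner_adj[OF M(2)] cinner_adj[OF M(3)])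
  have "adj (skew_sum \<alpha> \<beta> S) = skew_sum \<alpha> \<beta> S"
  proof (rule adj_eqI)
    show "cinner (skew_sum \<alpha> \<beta> S x) y = cinner x (skew_sum \<alpha> \<beta> S y)" for x y
      unfolding ip unfolding skew_sum_def
      by (simp add: cinner_add_right cinner_diff_left cinner_diff_right ssym
          cinner_adj'[OF M(2)] cinner_adj'[OF M(3)] lin)
  qed
  moreover have "0 < Re (cinner (skew_sum \<alpha> \<beta> S x) x) \<and> Re (cinner (skew_sum \<alpha> \<beta> S x) x) < (norm x)\<^sup>2"
    if x: "x \<noteq> 0" for x
  proof -
    define u v where "u = adj \<alpha> x" and "v = adj \<beta> x"
    have "u \<noteq> 0 \<or> v \<noteq> 0" using sum[of x] x by (auto simp: u_def v_def lin)
    have "cinner x x = cinner (\<alpha> u + \<beta> v) x" using sum[of x] by (simp add: u_def v_def)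
    also have "\<dots> = cinner u u + cinner v v"
      by (simp only: cinner_add_left cinner_adj[OF M(2)] cinner_adj[OF M(3)] u_def v_def)
    finally have nx: "(norm x)\<^sup>2 = (norm u)\<^sup>2 + (norm v)\<^sup>2"
      unfolding cinner_self by (metis of_real_add of_real_eq_iff)
    have c: "Re (cinner (skew_sum \<alpha> \<beta> S x) x) = (norm u)\<^sup>2 - Re (cinner (S u) u) + Re (cinner (S v) v)"
      unfolding ip u_def[symmetric] v_def[symmetric] by (simp add: cinner_diff_left cinner_self)
    have u: "u \<noteq> 0 \<Longrightarrow> 0 < Re (cinner (S u) u) \<and> Re (cinner (S u) u) < (norm u)\<^sup>2"
      and v: "v \<noteq> 0 \<Longrightarrow> 0 < Re (cinner (S v) v) \<and> Re (cinner (S v) v) < (norm v)\<^sup>2"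
      using S unfolding strict_contraction_def by blast+
    show ?thesis
      using \<open>u \<noteq> 0 \<or> v \<noteq> 0\<close> u v strict_contraction_nonneg[OF S, of u] strict_contraction_nonneg[OF S, of v]
      unfolding c nx by linarith
  qed
  ultimately show "strict_contraction (skew_sum \<alpha> \<beta> S)"
    unfolding strict_contraction_def using cM by blast
qed

end

section \<open>Independent operator ranges\<close>

locale vn_pure_shift = vn_shift M a f for M :: "('a::chilbert_space \<Rightarrow> 'a) set" and a f +
  assumes coord_eq_0: "\<And>x. (\<And>n. coord n x = 0) \<Longrightarrow> x = 0"
begin

lemma coord_ext: "(\<And>n. coord n x = coord n y) \<Longrightarrow> x = y"
  using coord_eq_0[of "x - y"] by (simp add: M_lin[OF coord_M])

lemma doubling_ident: "\<exists>\<alpha> \<beta>. doubling (\<lambda>x. x) \<alpha> \<beta>"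
proof -
  have "span_proj = (\<lambda>x. x)" by (rule ext, rule coord_ext) (rule coord_span_proj)
  then show ?thesis using doubling_span_proj by simp
qed

section \<open>Diagonal operators and the rotation\<close>

definition diag :: "(nat \<Rightarrow> real) \<Rightarrow> 'a \<Rightarrow> 'a" where
  "diag w = shift_op (\<lambda>n. n) (\<lambda>n. n) w"

lemma
  assumes "\<And>n. \<bar>w n\<bar> \<le> K"
  shows diag_M: "diag w \<in> M" and adj_diag: "adj (diag w) = diag w"
    and coord_diag: "coord n (diag w x) = w n *\<^sub>R coord n x"
    and norm_diag: "norm (diag w x) \<le> K * norm x"
  unfolding diag_def
  using shift_op_M[OF inj_ident inj_ident, of w K] adj_shift_op[OF inj_ident inj_ident, of w K]
    coord_shift_op[OF inj_ident inj_ident, of w K n x] norm_shift_op[OF inj_ident inj_ident, of w K x] assms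
  by simp_all

text \<open>The offset 2 makes the weights sum to 1/2 and bounds each by 1/4, which yields the norm
  bounds for \<open>T\<close> and \<open>D\<close> behind
  \<open>strict_contraction_thin\<close>.\<close>

definition "decay n = (1 / 2 :: real) ^ (n + 2)"

lemma decay_pos: "0 < decay n" by (simp add: decay_def)

lemma decay_le: "decay n \<le> 1 / 4"
  using power_le_one[of "1 / 2 :: real" n] by (simp add: decay_def)

text \<open>Sines and cosines of the rotation relating the two decompositions of \<open>H\<close>.\<close>

definition "D = diag decay"
definition "C = diag (\<lambda>n. sqrt (1 - (decay n)\<^sup>2))"

lemma decay_square_le: "(decay n)\<^sup>2 \<le> 1 / 4"
proof -
  have "(decay n)\<^sup>2 \<le> (1 / 4)\<^sup>2" using decay_pos decay_le by (intro power_mono) (auto simp: less_imp_le)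
  then show ?thesis by (simp add: power2_eq_square)
qed

text \<open>The lower bound, convenient rather than sharp, keeps \<open>C\<close> from changing the
  rate at which coordinates decay.\<close>

lemma cos_weight: "1 / 2 \<le> sqrt (1 - (decay n)\<^sup>2)" "sqrt (1 - (decay n)\<^sup>2) \<le> 1"
proof -
  have "(1 / 2)\<^sup>2 \<le> 1 - (decay n)\<^sup>2" using decay_square_le[of n] by (simp add: power2_eq_square)
  then show "1 / 2 \<le> sqrt (1 - (decay n)\<^sup>2)" by (rule real_le_rsqrt)
  show "sqrt (1 - (decay n)\<^sup>2) \<le> 1" by simp
qed

lemma abs_decay: "\<bar>decay n\<bar> \<le> 1 / 4"
  using decay_pos[of n] decay_le[of n] by simp

lemma abs_cos: "\<bar>sqrt (1 - (decay n)\<^sup>2)\<bar> \<le> 1"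
  using cos_weight[of n] unfolding abs_le_iff by linarith

lemma
  shows DM: "D \<in> M" and D_adj: "adj D = D"
    and coord_D: "coord n (D x) = decay n *\<^sub>R coord n x"
    and norm_D: "norm (D x) \<le> 1 / 4 * norm x"
  unfolding D_def
  by (rule diag_M[of decay "1/4"] adj_diag[of decay "1/4"] coord_diag[of decay "1/4"] norm_diag[of decay "1/4"];
      rule abs_decay)+

lemma
  shows CM: "C \<in> M" and C_adj: "adj C = C"
    and coord_C: "coord n (C x) = sqrt (1 - (decay n)\<^sup>2) *\<^sub>R coord n x"
  unfolding C_def
  by (rule diag_M[of _ 1] adj_diag[of _ 1] coord_diag[of _ 1]; rule abs_cos)+

lemma CC_DD: "C (C x) + D (D x) = x"
proof (rule coord_ext)
  fix n
  have "(decay n)\<^sup>2 \<le> 1" using decay_square_le[of n] by simp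
  then have "sqrt (1 - (decay n)\<^sup>2) * sqrt (1 - (decay n)\<^sup>2) + decay n * decay n = 1"
    by (simp add: power2_eq_square)
  then have "(sqrt (1 - (decay n)\<^sup>2) * sqrt (1 - (decay n)\<^sup>2) + decay n * decay n) *\<^sub>R coord n x = coord n x"
    by (simp only: scaleR_one)
  then show "coord n (C (C x) + D (D x)) = coord n x"
    by (simp only: M_lin[OF coord_M] coord_C coord_D scaleR_add_left scaleR_scaleR)
qed

lemma C_D: "C (D x) = D (C x)"
  by (rule coord_ext) (simp only: coord_C coord_D scaleR_scaleR mult.commute)

lemma D_eq_0: "D x = 0 \<Longrightarrow> x = 0"
proof (rule coord_eq_0)
  fix n assume "D x = 0"
  then show "coord n x = 0" using coord_D[of n x] decay_pos[of n] by (simp add: M_lin[OF coord_M])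
qed

text \<open>For \<open>i\<close> in {0, 1} the parity keeps two families of places apart;
  \<open>prod_encode\<close> gives every coordinate \<open>n\<close> its own infinite sequence of
  places, indexed by \<open>k\<close>.\<close>

definition slot :: "nat \<Rightarrow> nat \<Rightarrow> nat \<Rightarrow> nat" where
  "slot i k n = 2 * prod_encode (n, k) + i"

lemma inj_slot: "inj (slot i k)"
  by (auto simp: slot_def inj_on_def)

definition spread :: "nat \<Rightarrow> nat \<Rightarrow> 'a \<Rightarrow> 'a" where
  "spread i k = shift_op (slot i k) (\<lambda>n. n) (\<lambda>_. 1)"

lemma spread_M: "spread i k \<in> M"
  unfolding spread_def by (rule shift_op_M[OF inj_slot inj_ident, of _ 1]) simp

lemma norm_spread: "norm (spread i k x) \<le> norm x"
  unfolding spread_def using norm_shift_op[OF inj_slot inj_ident, of "\<lambda>_. 1" 1 i k x] by simp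

lemma coord_spread: "coord (slot i k n) (spread i k x) = coord n x"
  unfolding spread_def by (subst coord_shift_op[OF inj_slot inj_ident, of _ 1]) simp_all

lemma coord_spread_outside: "m \<notin> range (slot i k) \<Longrightarrow> coord m (spread i k x) = 0"
  unfolding spread_def by (subst coord_shift_op_outside[OF inj_slot inj_ident, of _ 1]) simp_all

text \<open>The range of \<open>W i \<circ> D\<close> consists of vectors whose coordinates at \<open>slot i k n\<close> decay in \<open>k\<close>
  only like \<open>2\<^sup>-\<^sup>k\<close>, whereas the coordinates of vectors in the range of \<open>D\<close> decay there at
  least like \<open>4\<^sup>-\<^sup>k\<close>.\<close>

definition T :: "nat \<Rightarrow> 'a \<Rightarrow> 'a" where
  "T i x = (\<Sum>k. decay k *\<^sub>R spread i k x)"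

text \<open>The summand \<open>x\<close> makes \<open>adj (W i)\<close> injective, since
  \<open>T i\<close> has norm at most 1/2.\<close>

definition W :: "nat \<Rightarrow> 'a \<Rightarrow> 'a" where
  "W i x = x + T i x"

lemma decay_sums: "decay sums (1 / 2)"
proof -
  have "(\<lambda>n. (1 / 2 :: real) ^ n * (1 / 4)) sums (1 / (1 - 1 / 2) * (1 / 4))"
    by (intro sums_mult2 geometric_sums) simp
  then show ?thesis by (simp add: decay_def[abs_def])
qed

lemma norm_T_term: "norm (decay k *\<^sub>R spread i k x) \<le> decay k * norm x"
  using norm_spread decay_pos[of k] by (simp add: mult_left_mono)

lemma T_sums: "(\<lambda>k. decay k *\<^sub>R spread i k x) sums T i x"
  unfolding T_def
proof (rule summable_sums)
  show "summable (\<lambda>k. decay k *\<^sub>R spread i k x)"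
    by (rule summable_comparison_test'[OF summable_mult2[OF sums_summable[OF decay_sums], of "norm x"]])
      (use norm_T_term in simp)
qed

lemma norm_T_partial: "norm (\<Sum>k<N. decay k *\<^sub>R spread i k x) \<le> 1 / 2 * norm x"
proof -
  have "norm (\<Sum>k<N. decay k *\<^sub>R spread i k x) \<le> (\<Sum>k<N. decay k * norm x)"
    by (rule sum_norm_le) (rule norm_T_term)
  also have "\<dots> = (\<Sum>k<N. decay k) * norm x" by (simp add: sum_distrib_right)
  also have "(\<Sum>k<N. decay k) \<le> 1 / 2"
    using sum_le_suminf[OF sums_summable[OF decay_sums], of "{..<N}"] sums_unique[OF decay_sums]
      less_imp_le[OF decay_pos] by simp
  finally show ?thesis by (simp add: mult_right_mono)
qed

lemma T_M: "T i \<in> M"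
proof (rule M_limit[OF _ _ norm_T_partial])
  show "(\<lambda>x. \<Sum>k<N. decay k *\<^sub>R spread i k x) \<in> M" for N
    by (rule M_sum) (rule M_scaleR[OF spread_M])
  show "(\<lambda>N. \<Sum>k<N. decay k *\<^sub>R spread i k x) \<longlonglongrightarrow> T i x" for x
    using T_sums by (simp add: sums_def)
qed

lemma norm_T: "norm (T i x) \<le> 1 / 2 * norm x"
proof (rule LIMSEQ_le_const2)
  show "(\<lambda>N. norm (\<Sum>k<N. decay k *\<^sub>R spread i k x)) \<longlonglongrightarrow> norm (T i x)"
    using T_sums by (intro tendsto_norm) (simp add: sums_def)
qed (use norm_T_partial in blast)

lemma coord_T_sums: "(\<lambda>k. decay k *\<^sub>R coord m (spread i k x)) sums coord m (T i x)"
  using bounded_linear.sums[OF bounded_clinear_bounded_linear[OF M_bcl[OF coord_M[of m]]] T_sums[of i x]]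
  by (simp add: M_lin[OF coord_M])

lemma coord_T: "coord (slot i k n) (T i x) = decay k *\<^sub>R coord n x"
proof -
  have "slot i k n \<notin> range (slot i j)" if "j \<noteq> k" for j
    using that by (auto simp: slot_def)
  then have "coord (slot i k n) (spread i j x) = (if j = k then coord n x else 0)" for j
    by (simp add: coord_spread coord_spread_outside)
  then have "(\<lambda>j. decay j *\<^sub>R coord (slot i k n) (spread i j x)) = (\<lambda>j. if j = k then decay j *\<^sub>R coord n x else 0)"
    by auto
  then show ?thesis
    using coord_T_sums[of "slot i k n" i x] sums_single[of k "\<lambda>j. decay j *\<^sub>R coord n x"] sums_unique2 by simp
qed

lemma coord_T_other:
  assumes "i < 2" "j < 2" "i \<noteq> j"
  shows "coord (slot i k n) (T j x) = 0"
proof -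
  have "slot i k n \<notin> range (slot j l)" for l
  proof
    assume "slot i k n \<in> range (slot j l)"
    then obtain u where "2 * prod_encode (n, k) + i = 2 * prod_encode (u, l) + j" by (auto simp: slot_def)
    then show False using assms by presburger
  qed
  then have "(\<lambda>l. decay l *\<^sub>R coord (slot i k n) (spread j l x)) = (\<lambda>l. 0)"
    by (simp add: coord_spread_outside)
  then show ?thesis using coord_T_sums[of "slot i k n" j x] sums_unique2[OF _ sums_zero] by simp
qed

lemma W_M: "W i \<in> M"
  unfolding W_def[abs_def] by (rule M_add[OF M_id T_M])

lemma coord_W_D: "coord (slot i k n) (W i (D x)) =
    decay (slot i k n) *\<^sub>R coord (slot i k n) x + (decay k * decay n) *\<^sub>R coord n x"
  by (simp add: W_def M_lin[OF coord_M] coord_T coord_D)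

lemma coord_W_D_other: "i < 2 \<Longrightarrow> j < 2 \<Longrightarrow> i \<noteq> j \<Longrightarrow>
    coord (slot i k n) (W j (D x)) = decay (slot i k n) *\<^sub>R coord (slot i k n) x"
  by (simp add: W_def M_lin[OF coord_M] coord_T_other coord_D)

text \<open>\<open>prod_encode (n, k)\<close> is at least \<open>k\<close>, so doubling it in
  \<open>slot\<close> squares the rate \<open>2 ^ k\<close>.\<close>

lemma decay_slot_le: "decay (slot i k n) \<le> decay k * (1 / 2) ^ k"
proof -
  have "2 * k + 2 \<le> slot i k n + 2" using le_prod_encode_2[of k n] by (simp add: slot_def)
  then have "decay (slot i k n) \<le> (1 / 2) ^ (2 * k + 2)"
    unfolding decay_def by (intro power_decreasing) auto
  also have "(1 / 2 :: real) ^ (2 * k + 2) = decay k * (1 / 2) ^ k"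
    by (simp add: decay_def mult_2 power_add)
  finally show ?thesis .
qed

text \<open>After division by \<open>decay k\<close> the right side is at most
  \<open>K / 2 ^ k\<close>, while the left side does not depend on \<open>k\<close>. The factor 1/2
  is the lower bound of the cosines.\<close>

lemma slow_coord_eq_0:
  assumes "\<And>k. 1 / 2 * (decay k * decay n * norm (coord n y)) \<le> decay (slot i k n) * K"
  shows "coord n y = 0"
proof -
  have "0 \<le> 1 / 2 * (decay 0 * decay n * norm (coord n y))"
    using decay_pos[of 0] decay_pos[of n] by (intro mult_nonneg_nonneg) auto
  then have "0 \<le> decay (slot i 0 n) * K" using assms[of 0] by linarith
  then have K: "0 \<le> K" using decay_pos[of "slot i 0 n"] by (simp add: zero_le_mult_iff)
  have "1 / 2 * (decay n * norm (coord n y)) \<le> (1 / 2) ^ k * K" for k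
  proof -
    have "decay k * (1 / 2 * (decay n * norm (coord n y))) \<le> decay k * ((1 / 2) ^ k * K)"
      using order_trans[OF assms[of k] mult_right_mono[OF decay_slot_le K]] by (simp add: mult_ac)
    then show ?thesis using decay_pos[of k] by (simp add: mult_le_cancel_left_pos)
  qed
  moreover have "(\<lambda>k. (1 / 2) ^ k * K) \<longlonglongrightarrow> 0 * K"
    by (intro tendsto_mult LIMSEQ_power_zero tendsto_const) simp
  ultimately have "1 / 2 * (decay n * norm (coord n y)) \<le> 0 * K"
    by (intro LIMSEQ_le_const) auto
  then show ?thesis using decay_pos[of n] by (simp add: mult_le_0_iff)
qed

text \<open>In the slots of \<open>i = 1\<close> the operator \<open>T 0\<close> is invisible, so
  all terms decay fast except the slow one from \<open>y\<close>, which must vanish. The slots of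
  \<open>i = 0\<close> then treat \<open>z\<close> likewise, and injectivity of \<open>D\<close>
  settles \<open>u\<close>.\<close>

lemma independent_ranges:
  assumes eq: "D u + C (W 1 (D y)) = W 0 (D z)"
  shows "u = 0" "y = 0"
proof -
  show y0: "y = 0"
  proof (rule coord_eq_0)
    fix n
    show "coord n y = 0"
    proof (rule slow_coord_eq_0[where i = 1])
      fix k
      define m where "m = slot 1 k n"
      define c where "c = sqrt (1 - (decay m)\<^sup>2)"
      have c: "1 / 2 \<le> c" "c \<le> 1" unfolding c_def by (rule cos_weight)+
      have "decay m *\<^sub>R coord m u + c *\<^sub>R (decay m *\<^sub>R coord m y + (decay k * decay n) *\<^sub>R coord n y) = decay m *\<^sub>R coord m z"
        using arg_cong[OF eq, of "coord m"] unfolding m_def c_def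
        by (simp add: M_lin[OF coord_M] coord_D coord_C coord_W_D[of 1, simplified] coord_W_D_other)
      then have e: "(c * (decay k * decay n)) *\<^sub>R coord n y
          = decay m *\<^sub>R (coord m z - coord m u - c *\<^sub>R coord m y)"
        by (simp add: algebra_simps)
      have "norm (coord m z - coord m u - c *\<^sub>R coord m y) \<le> norm z + norm u + norm y"
      proof -
        have "norm (c *\<^sub>R coord m y) \<le> 1 * norm y"
          using c norm_coord_le[of m y] unfolding norm_scaleR by (intro mult_mono) auto
        then show ?thesis
          using norm_triangle_ineq4[of "coord m z - coord m u" "c *\<^sub>R coord m y"]
            norm_triangle_ineq4[of "coord m z" "coord m u"] norm_coord_le[of m z] norm_coord_le[of m u] by linarith
      qed
      then have "decay m * norm (coord m z - coord m u - c *\<^sub>R coord m y) \<le> decay m * (norm z + norm u + norm y)"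
        using less_imp_le[OF decay_pos[of m]] by (intro mult_left_mono)
      moreover have "c * (decay k * decay n * norm (coord n y)) = decay m * norm (coord m z - coord m u - c *\<^sub>R coord m y)"
        using arg_cong[OF e, of norm] decay_pos[of k] decay_pos[of n] decay_pos[of m] c by (simp add: abs_mult mult.assoc)
      moreover have "1 / 2 * (decay k * decay n * norm (coord n y)) \<le> c * (decay k * decay n * norm (coord n y))"
        using c decay_pos[of k] decay_pos[of n] by (intro mult_right_mono) auto
      ultimately show "1 / 2 * (decay k * decay n * norm (coord n y)) \<le> decay (slot 1 k n) * (norm z + norm u + norm y)"
        unfolding m_def by linarith
    qed
  qed
  then have eq': "D u = W 0 (D z)"
    using eq by (simp add: M_lin[OF DM] M_lin[OF CM] M_lin[OF W_M])
  have "z = 0"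
  proof (rule coord_eq_0)
    fix n
    show "coord n z = 0"
    proof (rule slow_coord_eq_0[where i = 0])
      fix k
      define m where "m = slot 0 k n"
      have "decay m *\<^sub>R coord m u = decay m *\<^sub>R coord m z + (decay k * decay n) *\<^sub>R coord n z"
        using arg_cong[OF eq', of "coord m"] unfolding m_def
        by (simp add: coord_D coord_W_D)
      then have e: "(decay k * decay n) *\<^sub>R coord n z = decay m *\<^sub>R (coord m u - coord m z)"
        by (simp add: algebra_simps)
      have "norm (coord m u - coord m z) \<le> norm u + norm z"
        using norm_triangle_ineq4[of "coord m u" "coord m z"] norm_coord_le[of m z] norm_coord_le[of m u] by linarith
      then have "decay m * norm (coord m u - coord m z) \<le> decay m * (norm u + norm z)"
        using less_imp_le[OF decay_pos[of m]] by (intro mult_left_mono)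
      moreover have "decay k * decay n * norm (coord n z) = decay m * norm (coord m u - coord m z)"
        using arg_cong[OF e, of norm] decay_pos[of k] decay_pos[of n] decay_pos[of m] by (simp add: abs_mult mult.assoc)
      moreover have "0 \<le> decay k * decay n * norm (coord n z)"
        using decay_pos[of k] decay_pos[of n] by (intro mult_nonneg_nonneg) auto
      ultimately show "1 / 2 * (decay k * decay n * norm (coord n z)) \<le> decay (slot 0 k n) * (norm u + norm z)"
        unfolding m_def by linarith
    qed
  qed
  then have "D u = 0" using eq' by (simp add: M_lin[OF DM] M_lin[OF W_M])
  then show "u = 0" by (rule D_eq_0)
qed

text \<open>The product of \<open>W i \<circ> D\<close> with its adjoint: positive, with range
  inside that of \<open>W i \<circ> D\<close>.\<close>

definition thin :: "nat \<Rightarrow> 'a \<Rightarrow> 'a" where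
  "thin i x = W i (D (D (adj (W i) x)))"

lemma strict_contraction_thin: "strict_contraction (thin i)"
  unfolding strict_contraction_def
proof (intro conjI allI impI)
  have W'M: "adj (W i) \<in> M" by (rule M_adj[OF W_M])
  have thin_eq: "thin i = (\<lambda>x. W i (D (D (adj (W i) x))))" by (rule ext) (rule thin_def)
  have DWM: "(\<lambda>x. D (D (adj (W i) x))) \<in> M" by (rule M_compose[OF DM M_compose[OF DM W'M]])
  show "thin i \<in> M" unfolding thin_eq by (rule M_compose[OF W_M[of i] DWM])
  show "adj (thin i) = thin i"
  proof -
    have "adj (thin i) = (\<lambda>x. adj (\<lambda>x. D (D (adj (W i) x))) (adj (W i) x))"
      unfolding thin_eq by (rule adj_compose[OF W_M[of i] DWM])
    moreover have "adj (\<lambda>x. D (D (adj (W i) x))) = (\<lambda>x. adj (\<lambda>x. D (adj (W i) x)) (adj D x))"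
      by (rule adj_compose[OF DM M_compose[OF DM W'M]])
    moreover have "adj (\<lambda>x. D (adj (W i) x)) = (\<lambda>x. adj (adj (W i)) (adj D x))"
      by (rule adj_compose[OF DM W'M])
    ultimately show ?thesis by (simp add: thin_eq D_adj adj_adj[OF W_M])
  qed
  fix x :: 'a assume x: "x \<noteq> 0"
  have ip: "Re (cinner (thin i x) x) = (norm (D (adj (W i) x)))\<^sup>2"
    using cinner_adj[OF W_M[of i], of "D (D (adj (W i) x))" x] cinner_adj[OF DM, of "D (adj (W i) x)" "adj (W i) x"]
    by (simp add: thin_def D_adj cinner_self)
  have W': "adj (W i) x = x + adj (T i) x"
    unfolding W_def[abs_def] by (simp add: adj_add[OF M_id T_M] adj_id)
  have nT: "norm (adj (T i) x) \<le> 1 / 2 * norm x" by (rule norm_adj_le[OF T_M norm_T])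
  have "adj (W i) x \<noteq> 0"
  proof
    assume "adj (W i) x = 0"
    then have "x = - adj (T i) x" unfolding W' eq_neg_iff_add_eq_0 .
    then have "norm x = norm (adj (T i) x)" using norm_minus_cancel[of "adj (T i) x"] by simp
    then show False using nT x by simp
  qed
  then have "D (adj (W i) x) \<noteq> 0" using D_eq_0 by blast
  then show "0 < Re (cinner (thin i x) x)" unfolding ip by simp
  have "norm (D (adj (W i) x)) \<le> 1 / 4 * norm (adj (W i) x)" by (rule norm_D)
  moreover have "norm (adj (W i) x) \<le> 3 / 2 * norm x"
    unfolding W' using norm_triangle_ineq[of x "adj (T i) x"] nT by linarith
  moreover have "0 < norm x" using x by simp
  \<comment> \<open>The bounds multiply to 1/4 * 3/2 = 3/8.\<close>
  ultimately have "norm (D (adj (W i) x)) < norm x" by linarith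
  then show "Re (cinner (thin i x) x) < (norm x)\<^sup>2"
    unfolding ip by (intro power_strict_mono) auto
qed

section \<open>The two transversal contractions\<close>

lemma independent_thin_ranges:
  assumes "D u + C (thin 1 y) = thin 0 z"
  shows "u = 0" "thin 1 y = 0"
proof -
  note * = independent_ranges[OF assms[unfolded thin_def]]
  show "u = 0" by (rule *(1))
  show "thin 1 y = 0" unfolding thin_def *(2) by (simp add: M_lin[OF DM] M_lin[OF W_M])
qed

lemma transversal_contractions:
  obtains P R where "strict_contraction P" "strict_contraction R"
    "range P \<inter> range R = {0}" "range (\<lambda>x. x - P x) \<inter> range (\<lambda>x. x - R x) = {0}"
proof -
  obtain \<alpha> \<beta> where d: "doubling (\<lambda>x. x) \<alpha> \<beta>" using doubling_ident by blast
  note M = doubling_M[OF d]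
  have M': "adj \<alpha> \<in> M" "adj \<beta> \<in> M" using M by (simp_all add: M_adj)
  note lin = M_lin[OF M(2)] M_lin[OF M(3)] M_lin[OF M'(1)] M_lin[OF M'(2)] M_lin[OF CM] M_lin[OF DM]
  have ab: "adj \<alpha> (\<alpha> x) = x" "adj \<beta> (\<beta> x) = x" "adj \<alpha> (\<beta> x) = 0" "adj \<beta> (\<alpha> x) = 0" for x
    using doubling_iso[OF d, of x] doubling_cross[OF d, of x] doubling_cross[OF doubling_commute[OF d], of x]
    by simp_all
  \<comment> \<open>\<open>\<gamma>\<close> and \<open>\<delta>\<close> are the columns of the
    rotation matrix with entries \<open>C\<close>, \<open>-D\<close>, \<open>D\<close>,
    \<open>C\<close>; it is unitary since \<open>C\<close> and \<open>D\<close> are self-adjoint and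
    commute and their squares add up to 1.\<close>
  define \<gamma> where "\<gamma> x = \<alpha> (C x) + \<beta> (D x)" for x
  define \<delta> where "\<delta> x = \<beta> (C x) - \<alpha> (D x)" for x
  have \<gamma>M: "\<gamma> \<in> M" and \<delta>M: "\<delta> \<in> M" unfolding \<gamma>_def \<delta>_def
    by (rule M_add[OF M_compose[OF M(2) CM] M_compose[OF M(3) DM]],
        rule M_diff[OF M_compose[OF M(3) CM] M_compose[OF M(2) DM]])
  have \<gamma>': "adj \<gamma> x = C (adj \<alpha> x) + D (adj \<beta> x)" and \<delta>': "adj \<delta> x = C (adj \<beta> x) - D (adj \<alpha> x)" for x
    unfolding \<gamma>_def \<delta>_def
    by (simp_all add: adj_add[OF M_compose[OF M(2) CM] M_compose[OF M(3) DM]]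
        adj_diff[OF M_compose[OF M(3) CM] M_compose[OF M(2) DM]]
        adj_compose[OF M(2) CM] adj_compose[OF M(3) DM] adj_compose[OF M(3) CM] adj_compose[OF M(2) DM] C_adj D_adj)
  have proj: "adj \<alpha> (\<gamma> x) = C x" "adj \<beta> (\<gamma> x) = D x" "adj \<alpha> (\<delta> x) = - D x" "adj \<beta> (\<delta> x) = C x" for x
    by (simp_all add: \<gamma>_def \<delta>_def lin ab)
  have d2: "doubling (\<lambda>x. x) \<gamma> \<delta>"
    unfolding doubling_def
  proof (intro conjI allI M_id \<gamma>M \<delta>M)
    show "projection (\<lambda>x::'a. x)" using doubling_projection[OF d] .
    show "adj \<gamma> (\<gamma> x) = x" for x using CC_DD[of x] by (simp add: \<gamma>' proj)
    show "adj \<delta> (\<delta> x) = x" for x using CC_DD[of x] by (simp add: \<delta>' proj lin)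
    show "\<gamma> (adj \<gamma> x) + \<delta> (adj \<delta> x) = x" for x
    proof -
      have "\<gamma> (adj \<gamma> x) + \<delta> (adj \<delta> x)
          = \<alpha> (C (C (adj \<alpha> x)) + D (D (adj \<alpha> x))) + \<beta> (C (C (adj \<beta> x)) + D (D (adj \<beta> x)))"
        by (simp add: \<gamma>' \<delta>' \<gamma>_def \<delta>_def lin C_D algebra_simps)
      then show ?thesis using doubling_sum[OF d] by (simp add: CC_DD)
    qed
  qed
  define P where "P = skew_sum \<alpha> \<beta> (thin 0)"
  define R where "R = skew_sum \<gamma> \<delta> (thin 1)"
  note thin = strict_contraction_thin
  have P: "strict_contraction P" and R: "strict_contraction R"
    unfolding P_def R_def by (rule strict_contraction_skew_sum[OF d thin] strict_contraction_skew_sum[OF d2 thin])+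
  have lin_PR: "P 0 = 0" "R 0 = 0"
    using M_lin(6)[OF strict_contraction_M[OF P]] M_lin(6)[OF strict_contraction_M[OF R]] by simp_all
  note lin2 = M_lin[OF \<gamma>M] M_lin[OF \<delta>M]
  have range_Int: "range F \<inter> range G = {0}"
    if disj: "\<And>w x y. w = F x \<Longrightarrow> w = G y \<Longrightarrow> w = 0" and "F 0 = 0" "G 0 = 0" for F G :: "'a \<Rightarrow> 'a"
  proof (intro subset_antisym subsetI)
    show "w \<in> {0}" if w: "w \<in> range F \<inter> range G" for w
    proof -
      from w obtain x y where "w = F x" "w = G y" by (elim IntE rangeE)
      then have "w = 0" by (rule disj)
      then show ?thesis by simp
    qed
    have "0 \<in> range F" "0 \<in> range G"
      using rangeI[of F 0] rangeI[of G 0] \<open>F 0 = 0\<close> \<open>G 0 = 0\<close> by simp_all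
    then show "w \<in> range F \<inter> range G" if "w \<in> {0}" for w using that by simp
  qed
  have "w = 0" if w: "w = P x" "w = R y" for w x y
  proof -
    define u where "u = adj \<gamma> y - thin 1 (adj \<gamma> y)"
    have wR: "w = \<gamma> u + \<delta> (thin 1 (adj \<delta> y))" using w(2) by (simp add: R_def skew_sum_def u_def)
    \<comment> \<open>The \<open>\<beta>\<close> component is the one in which \<open>P\<close> is
      thin; in the rotated decomposition it takes the form
      \<open>D u + C (thin 1 _)\<close>.\<close>
    have "adj \<beta> w = thin 0 (adj \<beta> x)" using w(1) by (simp add: P_def skew_sum_def M_lin(2)[OF M'(2)] ab)
    moreover have "adj \<beta> w = D u + C (thin 1 (adj \<delta> y))"
      unfolding wR by (simp add: M_lin(2)[OF M'(2)] proj)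
    ultimately have "u = 0 \<and> thin 1 (adj \<delta> y) = 0"
      using independent_thin_ranges[of u "adj \<delta> y" "adj \<beta> x"] by simp
    then show ?thesis unfolding wR by (simp add: lin2)
  qed
  then have "range P \<inter> range R = {0}" using lin_PR by (rule range_Int)
  have zero2: "w = 0" if w: "w = x - P x" "w = y - R y" for w x y
  proof -
    define u where "u = adj \<delta> y - thin 1 (adj \<delta> y)"
    have wR: "w = \<gamma> (thin 1 (adj \<gamma> y)) + \<delta> u"
      using w(2) by (simp add: R_def skew_sum_complement[OF d2 thin] u_def)
    have "w = \<alpha> (thin 0 (adj \<alpha> x)) + \<beta> (adj \<beta> x - thin 0 (adj \<beta> x))"
      using w(1) by (simp add: P_def skew_sum_complement[OF d thin])
    \<comment> \<open>\<open>1 - P\<close> is thin in the \<open>\<alpha>\<close> component. There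
      the sine of \<open>\<delta>\<close> is negative, hence \<open>- u\<close> below.\<close>
    then have "adj \<alpha> w = thin 0 (adj \<alpha> x)" by (simp add: M_lin(2)[OF M'(1)] ab)
    moreover have "adj \<alpha> w = D (- u) + C (thin 1 (adj \<gamma> y))"
      unfolding wR by (simp add: M_lin(2)[OF M'(1)] proj M_lin[OF DM])
    ultimately have "- u = 0 \<and> thin 1 (adj \<gamma> y) = 0"
      using independent_thin_ranges[of "- u" "adj \<gamma> y" "adj \<alpha> x"] by simp
    then show ?thesis unfolding wR by (simp add: lin2)
  qed
  have "range (\<lambda>x. x - P x) \<inter> range (\<lambda>x. x - R x) = {0}"
  proof (rule range_Int)
    show "w = 0" if "w = x - P x" "w = y - R y" for w x y using that by (rule zero2)
  qed (simp_all add: lin_PR)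
  with \<open>range P \<inter> range R = {0}\<close> show thesis using that P R by blast
qed

end

theorem theorem8p2:
  fixes M :: "('a::chilbert_space \<Rightarrow> 'a) set"
  assumes "von_neumann_algebra M"
    and "properly_infinite M"
  shows "\<exists>A B :: 'a operator.
     self_adjoint_operator A \<and> positive_operator A \<and> one_to_one_operator A \<and> affiliated A M \<and>
     self_adjoint_operator B \<and> positive_operator B \<and> one_to_one_operator B \<and> affiliated B M \<and>
     Domain A \<inter> Domain B = {0} \<and>
     Domain (A\<inverse>) \<inter> Domain (B\<inverse>) = {0}"
proof -
  interpret vn_algebra M by unfold_locales (rule assms)
  obtain S f where "vn_pure_shift M S f"
  proof (rule pure_isometry[OF assms(2)])
    fix S f
    assume S: "vn_shift M S f" and pure: "\<And>x. (\<And>n. vn_shift.coord S f n x = 0) \<Longrightarrow> x = 0"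
    have "vn_pure_shift M S f"
      by (intro vn_pure_shift.intro vn_pure_shift_axioms.intro S) (rule pure)
    then show thesis by (rule that)
  qed
  then interpret vn_pure_shift M S f .
  obtain P R where PR: "strict_contraction P" "strict_contraction R"
    "range P \<inter> range R = {0}" "range (\<lambda>x. x - P x) \<inter> range (\<lambda>x. x - R x) = {0}"
    by (rule transversal_contractions)
  note M = strict_contraction_M[OF PR(1)] strict_contraction_M[OF PR(2)]
  show ?thesis
    using odds_operator_properties[OF PR(1)] odds_operator_properties[OF PR(2)] PR(3,4)
    by (intro exI[of _ "odds_operator P"] exI[of _ "odds_operator R"])
      (simp add: Domain_odds_operator[OF M(1)] Domain_odds_operator[OF M(2)]
        Domain_converse_odds_operator[OF M(1)] Domain_converse_odds_operator[OF M(2)] del: Domain_converse)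
qed

end
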